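(* Let $m,N\ge1$, $1\le r\le\infty$ with conjugate exponent $r'$, $1\le q<\infty$ and $0<p<\infty$. Let $X$ be an $\mathcal L_{q,1}^g$-space and let $T\in\mathcal L(^m\ell_r^N;X)$. Suppose that $r,q,p$ satisfy one of the following conditions: (a) $r=q=2$; (b) $r=2$ and either $p<q<2$ or $p=q$; (c) $p<r'<2$ and either $p<q\le 2$ or $p=q$. Then $$\pi_p(T)=\frac{1}{c_{r',p}^m}\Big(\int_{\mathbb K^N}\dots\int_{\mathbb K^N}\|T(z^{(1)},\dots,z^{(m)})\|_X^p\,d\mu^N_{r'}(z^{(1)})\dots d\mu^N_{r'}(z^{(m)})\Big)^{1/p}.$$
   Context: $\mathbb K=\mathbb R$ or $\mathbb C$; $\ell_r^N$ is $\mathbb K^N$ with the $\ell_r$-norm; $1/r+1/r'=1$. $\mathcal L(^mE;F)$ is the space of continuous $m$-linear maps $E\times\dots\times E\to F$ between Banach spaces. Multiple summing norm: for a continuous $m$-linear $T:E_1\times\dots\times E_m\to F$, $\pi_p(T)$ is the infimum of all $C>0$ such that for all finite sequences $(x^k_{j_k})_{j_k=1}^{J_k}\subset E_k$, $k=1,\dots,m$, $$\Big(\sum_{j_1,\dots,j_m}\|T(x^1_{j_1},\dots,x^m_{j_m})\|_F^p\Big)^{1/p}\le C\,w_p((x^1_{j})_{j})\cdots w_p((x^m_{j})_{j}),\qquad w_p((y_j)_j)=\sup_{\gamma\in B_{E'}}\Big(\sum_j|\gamma(y_j)|^p\Big)^{1/p}.$$ $\mathcal L_{q,\lambda}^g$-spaces: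 a normed space $X$ is an $\mathcal L_{q,\lambda}^g$-space ($1\le\lambda<\infty$) if for each finite dimensional subspace $M\subset X$ and each $\varepsilon>0$ there are $k\in\mathbb N$ and linear operators $R:M\to\ell_q^k$, $S:\ell_q^k\to X$ with $S\circ R$ equal to the inclusion $M\hookrightarrow X$ and $\|S\|\,\|R\|\le\lambda+\varepsilon$. Stable measures: for $0<s<2$, $\mu_s^1$ is the $s$-stable Lévy measure on $\mathbb K$, i.e. the Borel probability measure with $\int_{\mathbb K}e^{i\,\mathrm{Re}(z\bar w)}d\mu_s^1(z)=e^{-|w|^s}$ for all $w\in\mathbb K$; $\mu_2^1$ is the standard Gaussian measure on $\mathbb K$; $\mu_s^N$ is the $N$-fold product of $\mu_s^1$ on $\mathbb K^N$. The constant $c_{s,q}=\big(\int_{\mathbb K}|z|^q\,d\mu_s^1(z)\big)^{1/q}$ is finite for $0<q<s$ if $s<2$ and for all $0<q<\infty$ if $s=2$. These measures satisfy $c_{s,q}\|\alpha\|_{\ell_s^N}=\big(\int_{\mathbb K^N}|\sum_j\alpha_jz_j|^q\,d\mu_s^N(z)\big)^{1/q}$ for $\alpha\in\mathbb K^N$ and such $q$. *)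

theory Defs
  imports "HOL-Probability.Probability" "HOL-Library.Function_Algebras"
begin

text \<open>
  The scalar field. Up to isometric isomorphism, this class has exactly two models, the reals and
  the complex numbers: a commutative field of finite dimension over the reals is one of these two,
  and its multiplicative norm is then the usual modulus. The inner product, being determined by
  the norm, is the real part of \<open>z * cnj w\<close>.
\<close>

class real_or_complex = real_normed_field + euclidean_space

instance real :: real_or_complex ..

instance complex :: real_or_complex ..

lemma inner_real_eq: "inner z w = z * (w::real)"
  by simp

lemma inner_complex_eq: "inner z w = Re (z * cnj w)"
  by (simp add: inner_complex_def)

text \<open>
  HOL-Analysis has no class of complex normed spaces, so a normed space over the scalar
  field is a real normed space together with a compatible scalar multiplication.
\<close>

locale scalar_normed_space = vector_space scale
  for scale :: "'k::real_or_complex \<Rightarrow> 'x::real_normed_vector \<Rightarrow> 'x" +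
  assumes norm_scale: "norm (scale a x) = norm a * norm x"
    and scale_of_real: "scale (of_real t) x = t *\<^sub>R x"

definition lp_norm :: "'i set \<Rightarrow> ennreal \<Rightarrow> ('i \<Rightarrow> 'k::real_or_complex) \<Rightarrow> real" where
  "lp_norm I r x =
     (if r = \<infinity> then Max ((\<lambda>i. norm (x i)) ` I)
      else (\<Sum>i\<in>I. norm (x i) powr enn2real r) powr (1 / enn2real r))"

text \<open>
  \<open>ell_norm r\<close> is the norm of the space of scalar \<open>'n\<close>-tuples with the \<open>r\<close>-norm. It differs from
  the class-based norm of the vector type (the case \<open>r = 2\<close>), but induces the same topology.
\<close>

definition ell_norm :: "ennreal \<Rightarrow> 'k::real_or_complex ^ 'n \<Rightarrow> real" where
  "ell_norm r x = lp_norm UNIV r (\<lambda>i. x $ i)"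

definition dual_ball ::
  "('k::real_or_complex \<Rightarrow> 'e::ab_group_add \<Rightarrow> 'e) \<Rightarrow> ('e \<Rightarrow> real) \<Rightarrow> ('e \<Rightarrow> 'k) set" where
  "dual_ball sE nE = {\<gamma>. Vector_Spaces.linear sE (*) \<gamma> \<and> (\<forall>x. norm (\<gamma> x) \<le> nE x)}"

definition weak_norm ::
  "('k::real_or_complex \<Rightarrow> 'e::ab_group_add \<Rightarrow> 'e) \<Rightarrow> ('e \<Rightarrow> real) \<Rightarrow> real \<Rightarrow> nat \<Rightarrow> (nat \<Rightarrow> 'e) \<Rightarrow> real"
  where
  "weak_norm sE nE p J y =
     (SUP \<gamma>\<in>dual_ball sE nE. (\<Sum>j<J. norm (\<gamma> (y j)) powr p) powr (1 / p))"

definition multilinear ::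
  "('k::real_or_complex \<Rightarrow> 'e::ab_group_add \<Rightarrow> 'e) \<Rightarrow> ('k \<Rightarrow> 'x::ab_group_add \<Rightarrow> 'x)
     \<Rightarrow> (('m \<Rightarrow> 'e) \<Rightarrow> 'x) \<Rightarrow> bool" where
  "multilinear sE sX T \<longleftrightarrow> (\<forall>i x. Vector_Spaces.linear sE sX (\<lambda>v. T (x(i := v))))"

text \<open>
  The multiple summing norm of \<open>T\<close>, a map on \<open>'m\<close>-tuples from the space with scalar
  multiplication \<open>sE\<close> and norm \<open>nE\<close>. It takes the value \<open>\<infinity>\<close> if no constant is admissible.
\<close>

definition multiple_summing_norm ::
  "('k::real_or_complex \<Rightarrow> 'e::ab_group_add \<Rightarrow> 'e) \<Rightarrow> ('e \<Rightarrow> real) \<Rightarrow> real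
     \<Rightarrow> (('m::finite \<Rightarrow> 'e) \<Rightarrow> 'x::real_normed_vector) \<Rightarrow> ennreal" where
  "multiple_summing_norm sE nE p T =
     Inf (ennreal ` {C. C > 0 \<and>
       (\<forall>(J :: 'm \<Rightarrow> nat) (x :: 'm \<Rightarrow> nat \<Rightarrow> 'e).
          (\<Sum>j\<in>PiE UNIV (\<lambda>k. {..<J k}). norm (T (\<lambda>k. x k (j k))) powr p) powr (1 / p)
            \<le> C * (\<Prod>k\<in>UNIV. weak_norm sE nE p (J k) (x k)))})"

definition linear_on ::
  "'a set \<Rightarrow> ('k \<Rightarrow> 'a::ab_group_add \<Rightarrow> 'a) \<Rightarrow> ('k \<Rightarrow> 'b::ab_group_add \<Rightarrow> 'b) \<Rightarrow> ('a \<Rightarrow> 'b) \<Rightarrow> bool"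
  where
  "linear_on A sA sB f \<longleftrightarrow>
     (\<forall>x\<in>A. \<forall>y\<in>A. f (x + y) = f x + f y) \<and> (\<forall>c. \<forall>x\<in>A. f (sA c x) = sB c (f x))"

definition operator_norm ::
  "'a set \<Rightarrow> ('a \<Rightarrow> real) \<Rightarrow> ('b \<Rightarrow> real) \<Rightarrow> ('a \<Rightarrow> 'b) \<Rightarrow> real" where
  "operator_norm A nA nB f = (SUP x\<in>{x\<in>A. nA x \<le> 1}. nB (f x))"

text \<open>
  The dimension \<open>k\<close> of the middle space below is bound inside the formula, so scalar
  \<open>k\<close>-tuples are encoded there as sequences vanishing from index \<open>k\<close> on.
\<close>

definition tuples :: "nat \<Rightarrow> (nat \<Rightarrow> 'k::real_or_complex) set" where
  "tuples k = {x. \<forall>i\<ge>k. x i = 0}"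

definition tuple_scale :: "'k::real_or_complex \<Rightarrow> (nat \<Rightarrow> 'k) \<Rightarrow> (nat \<Rightarrow> 'k)" where
  "tuple_scale c x = (\<lambda>i. c * x i)"

definition Lg_space ::
  "real \<Rightarrow> real \<Rightarrow> ('k::real_or_complex \<Rightarrow> 'x::real_normed_vector \<Rightarrow> 'x) \<Rightarrow> bool" where
  "Lg_space q l sX \<longleftrightarrow> scalar_normed_space sX \<and>
     (\<forall>M. (\<exists>B. finite B \<and> M = module.span sX B) \<longrightarrow>
       (\<forall>\<epsilon>>0. \<exists>k R S.
          R ` M \<subseteq> tuples k \<and> linear_on M sX tuple_scale R \<and>
          linear_on (tuples k) tuple_scale sX S \<and>
          (\<forall>x\<in>M. S (R x) = x) \<and>
          operator_norm (tuples k) (lp_norm {..<k} (ennreal q)) norm S *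
            operator_norm M norm (lp_norm {..<k} (ennreal q)) R \<le> l + \<epsilon>))"

definition standard_gaussian :: "'k::real_or_complex measure" where
  "standard_gaussian =
     density lborel (\<lambda>z. ennreal ((2 * pi) powr (- real DIM('k) / 2) * exp (- (norm z)\<^sup>2 / 2)))"

text \<open>
  For \<open>s < 2\<close> a Borel measure is determined by its characteristic function, so this predicate
  singles out exactly one measure for every \<open>0 < s \<le> 2\<close>. At \<open>s = 2\<close> the convention changes: the
  standard Gaussian measure has characteristic function \<open>exp (- (norm w)\<^sup>2 / 2)\<close>.
\<close>

definition is_stable_measure :: "real \<Rightarrow> 'k::real_or_complex measure \<Rightarrow> bool" where
  "is_stable_measure s \<mu> \<longleftrightarrow>
     (0 < s \<and> s < 2 \<and> prob_space \<mu> \<and> sets \<mu> = sets borel \<and>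
        (\<forall>w. (CLINT z|\<mu>. iexp (inner z w)) = complex_of_real (exp (- (norm w powr s)))))
     \<or> (s = 2 \<and> \<mu> = standard_gaussian)"

definition product_measure :: "'k::real_or_complex measure \<Rightarrow> ('k ^ 'n) measure" where
  "product_measure \<mu> = distr (PiM (UNIV :: 'n set) (\<lambda>_. \<mu>)) borel vec_lambda"

definition stable_const :: "'k::real_or_complex measure \<Rightarrow> real \<Rightarrow> real" where
  "stable_const \<mu> q = (LINT z|\<mu>. norm z powr q) powr (1 / q)"

end

theory Submission imports Defs begin

text \<open>
  Write \<open>\<nu>\<close> for the product measure on the space of tuples, \<open>s\<close> for the exponent conjugate to \<open>r\<close>, and
  \<open>c\<close> for the stable constant. For a linear functional \<open>\<gamma>\<close> there are two ways to measure the family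
  of its values. Stability gives \<open>\<integral>|\<gamma>|^p d\<nu> = c^p \<parallel>\<gamma>\<parallel>^p\<close>, the norm being that of \<open>\<ell>\<^sub>s\<close>, which by duality is
  the dual norm (\<open>functional_moment\<close>); and the definition of the weak norm gives
  \<open>\<Sum>\<^sub>j |\<gamma>(x\<^sub>j)|^p \<le> w\<^sub>p(x)^p \<parallel>\<gamma>\<parallel>^p\<close> (\<open>weak_norm_bound\<close>). Hence, as far as powers of functionals are
  concerned, the point masses at the \<open>x\<^sub>j\<close> are dominated by \<open>w\<^sub>p(x)^p / c^p\<close> times \<open>\<nu>\<close>.

  Upper estimate. A scalar-valued multilinear map is a functional in each variable, so Tonelli's
  theorem transfers this domination one variable at a time to the full product
  (\<open>multilinear_domination\<close>). For values in \<open>\<ell>\<^sub>q^k\<close> it is enough that \<open>y \<mapsto> \<parallel>y\<parallel>^p\<close> is an average, or a limit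
  of averages, of functions \<open>|\<lambda>(y)|^p\<close> with \<open>\<lambda>\<close> linear, because domination is preserved by averages
  (\<open>lq_domination\<close>). For \<open>p = q\<close> the coordinates serve as the \<open>\<lambda>\<close>, for \<open>q = 2\<close> Gaussian combinations
  of them, and for \<open>p < q < 2\<close> combinations that are asymptotically \<open>q\<close>-stable. The range of \<open>T\<close> spans
  a finite-dimensional space, which the hypothesis on \<open>X\<close> places inside some \<open>\<ell>\<^sub>q^k\<close> up to a factor
  \<open>1 + \<epsilon>\<close> (\<open>Lg_space_factorization\<close>); letting \<open>\<epsilon>\<close> tend to zero gives \<open>multiple_sum_le\<close>.

  Lower estimate. An admissible constant is tested on discretisations of \<open>\<nu>\<close>: a simple function \<open>f\<close> close
  to the identity has finitely many values \<open>v\<^sub>j\<close>, and the vectors \<open>\<nu>(f = v\<^sub>j)^(1/p) v\<^sub>j\<close> turn the sum over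
  \<open>T\<close> into \<open>\<integral>\<parallel>T(f z\<^sub>1, \<dots>, f z\<^sub>m)\<parallel>^p\<close>, while their weak norms exceed \<open>c\<close> only slightly (\<open>weak_norm_sample_le\<close>,
  \<open>admissible_constant_ge\<close>).

  Two devices keep the probability theory one-dimensional. Absolute moments of a scalar variable are
  recovered from its real marginals by averaging over an independent Gaussian, so that uniqueness of
  real characteristic functions suffices (\<open>moment_sum\<close>). And a \<open>q\<close>-stable variable is replaced by a
  Gaussian with random variance, the variance being a normalised sum of Pareto variables; only
  Laplace transforms of such sums enter (\<open>pareto_moment_limit\<close>).
\<close>

section \<open>Isotropic stable measures\<close>

text \<open>
  The norm is multiplicative, so multiplication by a scalar is a multiple of an isometry; the inner
  product follows by polarisation.
\<close>

lemma inner_mult_mult: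
  fixes a x y :: "'k::real_or_complex"
  shows "inner (a * x) (a * y) = (norm a)\<^sup>2 * inner x y"
proof -
  have "(norm (a * x + a * y))\<^sup>2 = (norm a)\<^sup>2 * (norm (x + y))\<^sup>2"
    by (metis distrib_left norm_mult power_mult_distrib)
  then show ?thesis
    by (simp add: dot_norm norm_mult power_mult_distrib algebra_simps diff_divide_distrib)
qed

text \<open>
  The adjoint of multiplication by \<open>a\<close>; over the complex numbers it is \<open>cnj a * w\<close>. Division by zero
  gives zero, so the formula covers \<open>a = 0\<close>.
\<close>

definition mult_adjoint :: "'k::real_or_complex \<Rightarrow> 'k \<Rightarrow> 'k" where
  "mult_adjoint a w = (norm a)\<^sup>2 *\<^sub>R (w / a)"

lemma inner_mult_adjoint:
  fixes a z w :: "'k::real_or_complex"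
  shows "inner (a * z) w = inner z (mult_adjoint a w)"
proof (cases "a = 0")
  case False
  then have "inner (a * z) w = inner (a * z) (a * (w / a))" by simp
  then show ?thesis unfolding inner_mult_mult by (simp add: mult_adjoint_def)
qed (simp add: mult_adjoint_def)

lemma norm_mult_adjoint: "norm (mult_adjoint a w) = norm a * norm w"
  by (cases "a = 0") (simp_all add: mult_adjoint_def norm_divide power2_eq_square)

text \<open>
  The scale \<open>\<kappa>\<close> covers both normalisations at once: it is \<open>1\<close> for the stable measures of index below
  two and \<open>1/2\<close> for the standard Gaussian measure.
\<close>

locale isotropic_stable = prob_space \<mu> for \<mu> :: "'k::real_or_complex measure" +
  fixes s \<kappa> :: real
  assumes sets_eq_borel: "sets \<mu> = sets borel"
    and index_pos: "0 < s" and scale_pos: "0 < \<kappa>"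
    and char_fun: "(CLINT z|\<mu>. iexp (inner z w)) = complex_of_real (exp (- (\<kappa> * norm w powr s)))"
begin

declare sets_eq_borel [measurable_cong]

lemma measurable_eq_borel [simp]: "measurable \<mu> N = measurable borel N"
  by (rule measurable_cong_sets) (simp_all add: sets_eq_borel)

lemma measurable_PiM_eq_borel [simp]:
  "measurable (PiM I (\<lambda>_. \<mu>)) N = measurable (PiM I (\<lambda>_. borel)) N"
  by (intro measurable_cong_sets sets_PiM_cong refl sets_eq_borel)

lemma space_UNIV [simp]: "space \<mu> = UNIV"
  using sets_eq_imp_space_eq[OF sets_eq_borel] by simp

end

text \<open>
  Lebesgue measure on a Euclidean space is the product of the Lebesgue measures along an orthonormal
  basis, and the Gaussian density and the character both factorise, which leaves the characteristic
  function of the real standard normal law.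
\<close>

lemma standard_gaussian_char:
  fixes w :: "'k::real_or_complex"
  shows "(CLINT z|standard_gaussian. iexp (inner z w)) = complex_of_real (exp (- (norm w)\<^sup>2 / 2))"
proof -
  interpret product_sigma_finite "\<lambda>_::'k. lborel :: real measure" ..
  let ?c = "(2 * pi) powr (- real DIM('k) / 2)"
  let ?h = "\<lambda>b x. complex_of_real (std_normal_density x) * iexp (inner b w * x)"
  have c: "?c = (\<Prod>b\<in>(Basis::'k set). 1 / sqrt (2 * pi))"
  proof -
    have "(\<Prod>b\<in>(Basis::'k set). 1 / sqrt (2 * pi)) = ((2 * pi) powr (- (1/2))) ^ DIM('k)"
      by (simp add: powr_minus powr_half_sqrt inverse_eq_divide)
    also have "\<dots> = ((2 * pi) powr (- (1/2))) powr (real DIM('k))" by (simp add: powr_realpow)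
    also have "\<dots> = ?c" by (simp add: powr_powr)
    finally show ?thesis by simp
  qed
  have eq: "(?c * exp (- (norm z)\<^sup>2 / 2)) *\<^sub>R iexp (inner z w) = (\<Prod>b\<in>Basis. ?h b (x b))"
    if z: "z = (\<Sum>b\<in>Basis. x b *\<^sub>R b)" for z :: 'k and x
  proof -
    have xb: "inner z b = x b" if "b \<in> Basis" for b
      using that by (simp add: z)
    have "(norm z)\<^sup>2 = (\<Sum>b\<in>Basis. (x b)\<^sup>2)"
      unfolding power2_norm_eq_inner euclidean_inner[of z z]
      by (intro sum.cong) (simp_all add: xb power2_eq_square)
    then have e: "exp (- (norm z)\<^sup>2 / 2) = (\<Prod>b\<in>(Basis::'k set). exp (- (x b)\<^sup>2 / 2))"
      by (simp add: exp_sum[symmetric] sum_negf sum_divide_distrib)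
    have "inner z w = (\<Sum>b\<in>Basis. inner b w * x b)"
      by (simp add: z inner_sum_left mult.commute)
    then have i: "iexp (inner z w) = (\<Prod>b\<in>(Basis::'k set). iexp (inner b w * x b))"
      by (simp add: exp_sum[symmetric] sum_distrib_left)
    show ?thesis
      unfolding e i c
      by (simp add: scaleR_conv_of_real prod.distrib[symmetric] std_normal_density_def del: prod_constant)
  qed
  have int: "integrable lborel (?h b)" for b
  proof -
    have "integrable lborel (\<lambda>x. norm (?h b x))" using integrable_normal_density[of 1 0] by (simp add: norm_mult)
    then show ?thesis by (rule integrable_norm_cancel) measurable
  qed
  have one: "(LBINT x. ?h b x) = complex_of_real (exp (- (inner b w)\<^sup>2 / 2))" for b
  proof -
    have "char std_normal_distribution (inner b w) = (LBINT x. ?h b x)"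
      unfolding char_def by (subst integral_density) (simp_all add: scaleR_conv_of_real)
    then show ?thesis by (simp add: char_std_normal_distribution)
  qed
  have "(CLINT z|standard_gaussian. iexp (inner z w))
      = (LBINT z. (?c * exp (- (norm z)\<^sup>2 / 2)) *\<^sub>R iexp (inner z w))"
    unfolding standard_gaussian_def by (subst integral_density) simp_all
  also have "\<dots> = (LINT x|PiM Basis (\<lambda>_. lborel). (\<Prod>b\<in>Basis. ?h b (x b)))"
    by (subst lborel_eq, subst integral_distr)
      (measurable, rule Bochner_Integration.integral_cong[OF refl eq[OF refl]])
  also have "\<dots> = (\<Prod>b\<in>(Basis::'k set). complex_of_real (exp (- (inner b w)\<^sup>2 / 2)))"
    by (simp only: product_integral_prod[OF finite_Basis int] one)
  also have "\<dots> = complex_of_real (exp (\<Sum>b\<in>(Basis::'k set). - (inner b w)\<^sup>2 / 2))"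
    by (simp add: exp_sum)
  also have "(\<Sum>b\<in>(Basis::'k set). - (inner b w)\<^sup>2 / 2) = - (norm w)\<^sup>2 / 2"
    unfolding power2_norm_eq_inner euclidean_inner[of w w]
    by (simp add: sum_negf sum_divide_distrib power2_eq_square inner_commute)
  finally show ?thesis .
qed

lemma sets_standard_gaussian [simp, measurable_cong]: "sets standard_gaussian = sets borel"
  by (simp add: standard_gaussian_def)

lemma isotropic_stable_standard_gaussian:
  "isotropic_stable (standard_gaussian :: 'k::real_or_complex measure) 2 (1/2)"
proof -
  let ?G = "standard_gaussian :: 'k measure"
  have "complex_of_real (measure ?G (space ?G)) = 1"
    using standard_gaussian_char[of "0::'k"] by (simp add: scaleR_conv_of_real)
  then have "measure ?G (space ?G) = 1" using of_real_eq_1_iff by blast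
  then have "emeasure ?G (space ?G) = 1"
    by (metis emeasure_eq_ennreal_measure ennreal_1 measure_zero_top zero_neq_one)
  then interpret prob_space ?G by (rule prob_spaceI)
  show ?thesis
    by unfold_locales (simp_all add: standard_gaussian_char)
qed

lemma is_stable_measure_isotropic_stable:
  assumes "is_stable_measure s \<mu>"
  shows "\<exists>\<kappa>. isotropic_stable \<mu> s \<kappa>"
proof (cases "s = 2")
  case True
  then show ?thesis
    using assms isotropic_stable_standard_gaussian by (auto simp: is_stable_measure_def)
next
  case False
  then have "isotropic_stable \<mu> s 1"
    using assms by (simp add: is_stable_measure_def isotropic_stable_def isotropic_stable_axioms_def)
  then show ?thesis ..
qed

context isotropic_stable
begin

lemma prob_UNIV [simp]: "prob UNIV = 1"
  using prob_space by simp

lemma integrable_iexp_inner: "integrable \<mu> (\<lambda>z. iexp (inner z w))"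
  by (rule integrable_const_bound[where B=1]) auto

text \<open>
  Coefficients move to the other side of the inner product, and independence turns the expectation
  into a product of values of the characteristic function.
\<close>

lemma char_inner_sum:
  fixes \<alpha> :: "'i \<Rightarrow> 'k"
  assumes I: "finite I"
  shows "char (distr (PiM I (\<lambda>_. \<mu>)) borel (\<lambda>z. inner (\<Sum>i\<in>I. \<alpha> i * z i) w)) t =
    complex_of_real (exp (- (\<kappa> * (\<bar>t\<bar> * norm w) powr s * (\<Sum>i\<in>I. norm (\<alpha> i) powr s))))"
proof -
  interpret product_prob_space "\<lambda>_::'i. \<mu>" ..
  have "char (distr (PiM I (\<lambda>_. \<mu>)) borel (\<lambda>z. inner (\<Sum>i\<in>I. \<alpha> i * z i) w)) t
    = (CLINT z|PiM I (\<lambda>_. \<mu>). iexp (t * inner (\<Sum>i\<in>I. \<alpha> i * z i) w))"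
    unfolding char_def by (subst integral_distr) simp_all
  also have "\<dots> = (CLINT z|PiM I (\<lambda>_. \<mu>). (\<Prod>i\<in>I. iexp (inner (z i) (mult_adjoint (\<alpha> i) (t *\<^sub>R w)))))"
  proof (intro Bochner_Integration.integral_cong refl)
    fix z :: "'i \<Rightarrow> 'k"
    have "t * inner (\<Sum>i\<in>I. \<alpha> i * z i) w = (\<Sum>i\<in>I. inner (z i) (mult_adjoint (\<alpha> i) (t *\<^sub>R w)))"
      by (simp add: inner_mult_adjoint[symmetric] inner_sum_left sum_distrib_left)
    then show "iexp (t * inner (\<Sum>i\<in>I. \<alpha> i * z i) w) = (\<Prod>i\<in>I. iexp (inner (z i) (mult_adjoint (\<alpha> i) (t *\<^sub>R w))))"
      using I by (simp add: exp_sum[symmetric] sum_distrib_left)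
  qed
  also have "\<dots> = (\<Prod>i\<in>I. CLINT z|\<mu>. iexp (inner z (mult_adjoint (\<alpha> i) (t *\<^sub>R w))))"
    by (rule product_integral_prod[OF I integrable_iexp_inner])
  also have "\<dots> = complex_of_real (exp (\<Sum>i\<in>I. - (\<kappa> * (norm (\<alpha> i) * (\<bar>t\<bar> * norm w)) powr s)))"
    using I by (simp add: char_fun norm_mult_adjoint exp_sum)
  also have "(\<Sum>i\<in>I. - (\<kappa> * (norm (\<alpha> i) * (\<bar>t\<bar> * norm w)) powr s))
      = - (\<kappa> * (\<bar>t\<bar> * norm w) powr s * (\<Sum>i\<in>I. norm (\<alpha> i) powr s))"
    by (simp add: sum_negf sum_distrib_left powr_mult mult_ac)
  finally show ?thesis .
qed

lemma char_inner:
  "char (distr \<mu> borel (\<lambda>z. inner z w)) t = complex_of_real (exp (- (\<kappa> * (\<bar>t\<bar> * norm w) powr s)))"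
proof -
  have "char (distr \<mu> borel (\<lambda>z. inner z w)) t = (CLINT z|\<mu>. iexp (inner z (t *\<^sub>R w)))"
    unfolding char_def by (subst integral_distr) simp_all
  then show ?thesis by (simp only: char_fun norm_scaleR)
qed

lemma distr_inner_cong:
  assumes "norm v = norm w"
  shows "distr \<mu> borel (\<lambda>z. inner z v) = distr \<mu> borel (\<lambda>z. inner z w)"
proof (rule Levy_uniqueness)
  show "char (distr \<mu> borel (\<lambda>z. inner z v)) = char (distr \<mu> borel (\<lambda>z. inner z w))"
    by (rule ext) (simp only: char_inner assms)
qed (auto intro!: real_distribution_distr)

text \<open>
  Stability, on the level of real marginals: both sides have the same characteristic function.
\<close>

lemma distr_inner_sum:
  fixes \<alpha> :: "'i \<Rightarrow> 'k"
  assumes I: "finite I"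
  shows "distr (PiM I (\<lambda>_. \<mu>)) borel (\<lambda>z. inner (\<Sum>i\<in>I. \<alpha> i * z i) w) =
    distr \<mu> borel (\<lambda>z. inner z (((\<Sum>i\<in>I. norm (\<alpha> i) powr s) powr (1 / s)) *\<^sub>R w))"
proof (rule Levy_uniqueness)
  interpret P: prob_space "PiM I (\<lambda>_. \<mu>)" by (intro prob_space_PiM prob_space_axioms)
  show "real_distribution (distr (PiM I (\<lambda>_. \<mu>)) borel (\<lambda>z. inner (\<Sum>i\<in>I. \<alpha> i * z i) w))"
    by (rule P.real_distribution_distr) simp
  let ?S = "\<Sum>i\<in>I. norm (\<alpha> i) powr s"
  have "0 \<le> ?S" by (simp add: sum_nonneg)
  then have "(\<bar>t\<bar> * norm ((?S powr (1 / s)) *\<^sub>R w)) powr s = (\<bar>t\<bar> * norm w) powr s * ?S" for t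
    using index_pos by (simp add: powr_mult powr_powr)
  then show "char (distr (PiM I (\<lambda>_. \<mu>)) borel (\<lambda>z. inner (\<Sum>i\<in>I. \<alpha> i * z i) w)) =
    char (distr \<mu> borel (\<lambda>z. inner z (((\<Sum>i\<in>I. norm (\<alpha> i) powr s) powr (1 / s)) *\<^sub>R w)))"
    by (intro ext) (simp only: char_inner_sum[OF I] char_inner mult.assoc)
qed (auto intro!: real_distribution_distr)

text \<open>
  Isotropy: the law of a marginal depends only on the length of the direction.
\<close>

lemma inner_moment:
  "(\<integral>\<^sup>+z. ennreal (\<bar>inner z w\<bar> powr p) \<partial>\<mu>) =
     ennreal (norm w powr p) * (\<integral>\<^sup>+z. ennreal (\<bar>inner z 1\<bar> powr p) \<partial>\<mu>)"
proof -
  have "(\<integral>\<^sup>+z. ennreal (\<bar>inner z w\<bar> powr p) \<partial>\<mu>)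
      = (\<integral>\<^sup>+x. ennreal (\<bar>x\<bar> powr p) \<partial>distr \<mu> borel (\<lambda>z. inner z w))"
    by (subst nn_integral_distr) simp_all
  also have "distr \<mu> borel (\<lambda>z. inner z w) = distr \<mu> borel (\<lambda>z. inner z (norm w *\<^sub>R 1))"
    by (rule distr_inner_cong) simp
  also have "(\<integral>\<^sup>+x. ennreal (\<bar>x\<bar> powr p) \<partial>distr \<mu> borel (\<lambda>z. inner z (norm w *\<^sub>R 1)))
      = (\<integral>\<^sup>+z. ennreal (norm w powr p) * ennreal (\<bar>inner z 1\<bar> powr p) \<partial>\<mu>)"
    by (subst nn_integral_distr) (simp_all add: abs_mult powr_mult ennreal_mult)
  finally show ?thesis by (simp add: nn_integral_cmult)
qed

text \<open>
  If the marginal vanished almost surely, the characteristic function would be \<open>1\<close> at \<open>1\<close>.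
\<close>

lemma inner_moment_pos:
  "0 < (\<integral>\<^sup>+z. ennreal (\<bar>inner z (1::'k)\<bar> powr p) \<partial>\<mu>)"
proof (rule ccontr)
  assume "\<not> ?thesis"
  then have "(\<integral>\<^sup>+z. ennreal (\<bar>inner z (1::'k)\<bar> powr p) \<partial>\<mu>) = 0" by (simp add: not_less)
  then have "AE z in \<mu>. ennreal (\<bar>inner z (1::'k)\<bar> powr p) = 0"
    by (subst (asm) nn_integral_0_iff_AE) simp_all
  then have "AE z in \<mu>. inner z (1::'k) = 0"
    by eventually_elim (simp add: powr_eq_0_iff)
  then have "(CLINT z|\<mu>. iexp (inner z 1)) = (CLINT z|\<mu>. 1)"
    by (intro integral_cong_AE) auto
  then show False using scale_pos by (simp add: char_fun scaleR_conv_of_real)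
qed

end

interpretation gaussian: isotropic_stable "standard_gaussian :: 'k::real_or_complex measure" 2 "1/2"
  by (rule isotropic_stable_standard_gaussian)

lemma powr_le_one_plus_power:
  fixes x p :: real
  assumes "0 \<le> x" "0 \<le> p" "p \<le> real n"
  shows "x powr p \<le> 1 + x ^ n"
proof (cases "x \<le> 1")
  case True
  then have "x powr p \<le> 1" using assms by (simp add: powr_le1)
  then show ?thesis using assms by (meson add_increasing2 zero_le_power)
next
  case False
  then have "x powr p \<le> x powr (real n)" using assms by (intro powr_mono) auto
  then show ?thesis using False by (simp add: powr_realpow)
qed

lemma powr_sum_le:
  fixes f :: "'i \<Rightarrow> real"
  assumes I: "finite I" and f: "\<And>i. i \<in> I \<Longrightarrow> 0 \<le> f i" and p: "0 < p"
  shows "(\<Sum>i\<in>I. f i) powr p \<le> real (card I) powr p * (\<Sum>i\<in>I. f i powr p)"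
proof (cases "I = {}")
  case False
  have "Max (f ` I) \<in> f ` I" using I False by (intro Max_in) auto
  then obtain c where c: "c \<in> I" "f c = Max (f ` I)" by auto
  then have le: "f i \<le> f c" if "i \<in> I" for i using I that by simp
  have "(\<Sum>i\<in>I. f i) \<le> real (card I) * f c" using le by (intro sum_bounded_above) auto
  then have "(\<Sum>i\<in>I. f i) powr p \<le> (real (card I) * f c) powr p"
    using p f by (intro powr_mono2) (auto intro: sum_nonneg)
  also have "\<dots> = real (card I) powr p * f c powr p" using f c by (simp add: powr_mult)
  also have "\<dots> \<le> real (card I) powr p * (\<Sum>i\<in>I. f i powr p)"
    using I c(1) by (intro mult_left_mono member_le_sum) auto
  finally show ?thesis .
qed simp

lemma norm_powr_le_sum_Basis:
  fixes z :: "'a::euclidean_space"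
  assumes "0 < p"
  shows "norm z powr p \<le> real DIM('a) powr p * (\<Sum>b\<in>Basis. \<bar>inner z b\<bar> powr p)"
proof -
  have "norm z powr p \<le> (\<Sum>b\<in>Basis. \<bar>inner z b\<bar>) powr p"
    using assms by (intro powr_mono2 norm_le_l1) auto
  also have "\<dots> \<le> real DIM('a) powr p * (\<Sum>b\<in>Basis. \<bar>inner z b\<bar> powr p)"
    using assms by (intro powr_sum_le) auto
  finally show ?thesis .
qed

text \<open>
  The marginal is a real standard normal variable, all of whose moments are finite.
\<close>

lemma gaussian_inner_moment_finite:
  assumes "0 < p"
  shows "(\<integral>\<^sup>+z. ennreal (\<bar>inner z (1::'k::real_or_complex)\<bar> powr p) \<partial>standard_gaussian) < \<infinity>"
proof -
  let ?D = "distr (standard_gaussian :: 'k measure) borel (\<lambda>z. inner z 1)"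
  obtain n where n: "p \<le> real n" using real_arch_simple by blast
  have D: "?D = std_normal_distribution"
  proof (rule Levy_uniqueness)
    show "char ?D = char std_normal_distribution"
      by (intro ext) (simp add: gaussian.char_inner char_std_normal_distribution)
    show "real_distribution std_normal_distribution"
      using real_dist_normal_dist by simp
  qed (auto intro!: gaussian.real_distribution_distr)
  have "(\<integral>\<^sup>+z. ennreal (\<bar>inner z (1::'k)\<bar> powr p) \<partial>standard_gaussian) = (\<integral>\<^sup>+x. ennreal (\<bar>x\<bar> powr p) \<partial>?D)"
    by (subst nn_integral_distr) simp_all
  also have "\<dots> \<le> (\<integral>\<^sup>+x. ennreal (1 + \<bar>x\<bar> ^ n) \<partial>?D)"
    using n assms by (intro nn_integral_mono ennreal_leI powr_le_one_plus_power) auto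
  also have "\<dots> = (\<integral>\<^sup>+x. ennreal (std_normal_density x * \<bar>x\<bar> ^ 0 + std_normal_density x * \<bar>x\<bar> ^ n) \<partial>lborel)"
    unfolding D by (subst nn_integral_density) (simp_all add: ennreal_mult[symmetric] distrib_left)
  also have "\<dots> < \<infinity>"
  proof -
    have "integrable lborel (\<lambda>x. std_normal_density x * \<bar>x\<bar> ^ 0 + std_normal_density x * \<bar>x\<bar> ^ n)"
      by (intro Bochner_Integration.integrable_add integrable_std_normal_moment_abs)
    then show ?thesis
      by (subst (asm) integrable_iff_bounded) (simp add: abs_of_nonneg)
  qed
  finally show ?thesis .
qed

lemma gaussian_moment_finite:
  assumes "0 < p"
  shows "(\<integral>\<^sup>+z. ennreal (norm (z::'k::real_or_complex) powr p) \<partial>standard_gaussian) < \<infinity>"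
proof -
  have "(\<integral>\<^sup>+z. ennreal (norm (z::'k) powr p) \<partial>standard_gaussian)
     \<le> (\<integral>\<^sup>+z. ennreal (real DIM('k) powr p) * (\<Sum>b\<in>Basis. ennreal (\<bar>inner (z::'k) b\<bar> powr p)) \<partial>standard_gaussian)"
    using norm_powr_le_sum_Basis[OF assms, where 'a='k]
    by (intro nn_integral_mono) (simp add: sum_ennreal ennreal_mult[symmetric] sum_nonneg ennreal_leI)
  also have "\<dots> = ennreal (real DIM('k) powr p) * (\<Sum>b\<in>Basis. \<integral>\<^sup>+z. ennreal (\<bar>inner (z::'k) b\<bar> powr p) \<partial>standard_gaussian)"
    by (simp add: nn_integral_cmult nn_integral_sum del: sum_ennreal)
  also have "\<dots> < \<infinity>"
  proof -
    have "(\<integral>\<^sup>+z. ennreal (\<bar>inner (z::'k) b\<bar> powr p) \<partial>standard_gaussian) < \<infinity>" for b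
      using gaussian_inner_moment_finite[OF assms, where 'k='k]
      by (subst gaussian.inner_moment) (simp add: ennreal_mult_less_top)
    then show ?thesis by (simp add: ennreal_mult_less_top)
  qed
  finally show ?thesis .
qed

context isotropic_stable
begin

text \<open>
  For a Gaussian \<open>g\<close> independent of everything else, the expectation of \<open>|\<langle>y, g\<rangle>|^p\<close> is a constant times
  \<open>|y|^p\<close>. Exchanging the order of integration therefore reduces the moment of the sum to moments of
  its real marginals, whose laws are known by stability.
\<close>

lemma moment_sum:
  fixes \<alpha> :: "'i \<Rightarrow> 'k"
  assumes I: "finite I" and p: "0 < p"
  shows "(\<integral>\<^sup>+z. ennreal (norm (\<Sum>i\<in>I. \<alpha> i * z i) powr p) \<partial>PiM I (\<lambda>_. \<mu>)) =
    ennreal ((\<Sum>i\<in>I. norm (\<alpha> i) powr s) powr (p / s)) * (\<integral>\<^sup>+z. ennreal (norm z powr p) \<partial>\<mu>)"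
proof -
  interpret P: prob_space "PiM I (\<lambda>_. \<mu>)" by (intro prob_space_PiM prob_space_axioms)
  interpret PG: pair_sigma_finite "PiM I (\<lambda>_. \<mu>)" "standard_gaussian :: 'k measure" ..
  interpret MG: pair_sigma_finite \<mu> "standard_gaussian :: 'k measure" ..
  let ?S = "\<Sum>i\<in>I. norm (\<alpha> i) powr s" and ?Y = "\<lambda>z. \<Sum>i\<in>I. \<alpha> i * z i"
  let ?G = "standard_gaussian :: 'k measure"
  \<comment> \<open>The constant of the Gaussian average; it is cancelled at the end, hence must be neither zero nor infinite.\<close>
  define c where "c = (\<integral>\<^sup>+g. ennreal (\<bar>inner g (1::'k)\<bar> powr p) \<partial>?G)"
  have c: "c \<noteq> 0" "c \<noteq> \<infinity>"
    using gaussian.inner_moment_pos[where 'k='k, of p] gaussian_inner_moment_finite[OF p, where 'k='k]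
    by (auto simp: c_def)
  have S: "0 \<le> ?S" by (simp add: sum_nonneg)
  have avg: "c * ennreal (norm y powr p) = (\<integral>\<^sup>+g. ennreal (\<bar>inner y g\<bar> powr p) \<partial>?G)" for y :: 'k
    using gaussian.inner_moment[of y p] by (simp add: c_def inner_commute mult.commute)
  have marg: "(\<integral>\<^sup>+z. ennreal (\<bar>inner (?Y z) g\<bar> powr p) \<partial>PiM I (\<lambda>_. \<mu>))
     = ennreal (?S powr (p / s)) * (\<integral>\<^sup>+z. ennreal (\<bar>inner z g\<bar> powr p) \<partial>\<mu>)" for g :: 'k
  proof -
    have "(\<integral>\<^sup>+z. ennreal (\<bar>inner (?Y z) g\<bar> powr p) \<partial>PiM I (\<lambda>_. \<mu>))
      = (\<integral>\<^sup>+x. ennreal (\<bar>x\<bar> powr p) \<partial>distr (PiM I (\<lambda>_. \<mu>)) borel (\<lambda>z. inner (?Y z) g))"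
      by (subst nn_integral_distr) simp_all
    also have "\<dots> = (\<integral>\<^sup>+z. ennreal (?S powr (p / s)) * ennreal (\<bar>inner z g\<bar> powr p) \<partial>\<mu>)"
      unfolding distr_inner_sum[OF I] using S
      by (subst nn_integral_distr) (simp_all add: abs_mult powr_mult powr_powr ennreal_mult)
    finally show ?thesis by (simp add: nn_integral_cmult)
  qed
  have "c * (\<integral>\<^sup>+z. ennreal (norm (?Y z) powr p) \<partial>PiM I (\<lambda>_. \<mu>))
      = (\<integral>\<^sup>+z. \<integral>\<^sup>+g. ennreal (\<bar>inner (?Y z) g\<bar> powr p) \<partial>?G \<partial>PiM I (\<lambda>_. \<mu>))"
    by (subst nn_integral_cmult[symmetric]) (simp_all add: avg)
  also have "\<dots> = (\<integral>\<^sup>+g. \<integral>\<^sup>+z. ennreal (\<bar>inner (?Y z) g\<bar> powr p) \<partial>PiM I (\<lambda>_. \<mu>) \<partial>?G)"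
    by (rule PG.Fubini'[symmetric]) measurable
  also have "\<dots> = (\<integral>\<^sup>+g. ennreal (?S powr (p / s)) * (\<integral>\<^sup>+z. ennreal (\<bar>inner z g\<bar> powr p) \<partial>\<mu>) \<partial>?G)"
    by (simp only: marg)
  also have "\<dots> = ennreal (?S powr (p / s)) * (\<integral>\<^sup>+g. (\<integral>\<^sup>+z. ennreal (\<bar>inner z g\<bar> powr p) \<partial>\<mu>) \<partial>?G)"
    by (rule nn_integral_cmult) measurable
  also have "(\<integral>\<^sup>+g. (\<integral>\<^sup>+z. ennreal (\<bar>inner z g\<bar> powr p) \<partial>\<mu>) \<partial>?G)
     = (\<integral>\<^sup>+z. (\<integral>\<^sup>+g. ennreal (\<bar>inner z g\<bar> powr p) \<partial>?G) \<partial>\<mu>)"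
    by (rule MG.Fubini') measurable
  also have "\<dots> = c * (\<integral>\<^sup>+z. ennreal (norm z powr p) \<partial>\<mu>)"
    by (subst nn_integral_cmult[symmetric]) (simp_all add: avg)
  finally have "c * (\<integral>\<^sup>+z. ennreal (norm (?Y z) powr p) \<partial>PiM I (\<lambda>_. \<mu>)) =
    c * (ennreal (?S powr (p / s)) * (\<integral>\<^sup>+z. ennreal (norm z powr p) \<partial>\<mu>))"
    by (simp add: mult_ac)
  then show ?thesis using c by (simp add: ennreal_mult_cancel_left)
qed

lemma moment_pos: "0 < (\<integral>\<^sup>+z. ennreal (norm z powr p) \<partial>\<mu>)"
proof (rule ccontr)
  assume "\<not> ?thesis"
  then have "(\<integral>\<^sup>+z. ennreal (norm z powr p) \<partial>\<mu>) = 0" by (simp add: not_less)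
  then have "AE z in \<mu>. ennreal (norm z powr p) = 0"
    by (subst (asm) nn_integral_0_iff_AE) simp_all
  then have "AE z in \<mu>. ennreal (\<bar>inner z (1::'k)\<bar> powr p) = 0"
    by eventually_elim (simp add: powr_eq_0_iff)
  then have "(\<integral>\<^sup>+z. ennreal (\<bar>inner z (1::'k)\<bar> powr p) \<partial>\<mu>) = 0"
    by (subst nn_integral_0_iff_AE) simp_all
  then show False using inner_moment_pos[of p] by simp
qed

end

section \<open>Powers as integrals of exponentials\<close>

text \<open>
  The constant in \<open>\<integral> (1 - exp (- A u^a)) u^(-1-b) du = const * A^(b/a)\<close>; it is finite for \<open>0 < b < a\<close>.
\<close>

definition power_const :: "real \<Rightarrow> real \<Rightarrow> ennreal" where
  "power_const a b =
     (\<integral>\<^sup>+u. ennreal ((1 - exp (- (u powr a))) * u powr (-1 - b)) * indicator {0<..} u \<partial>lborel)"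

text \<open>
  Substituting \<open>u = A^(-1/a) u'\<close> removes \<open>A\<close> from the exponent and produces the factor \<open>A^(b/a)\<close>.
\<close>

lemma nn_integral_power_exp:
  assumes "0 < a" "0 < b" "0 \<le> A"
  shows "(\<integral>\<^sup>+u. ennreal ((1 - exp (- (A * u powr a))) * u powr (-1 - b)) * indicator {0<..} u \<partial>lborel)
    = ennreal (A powr (b / a)) * power_const a b"
proof (cases "A = 0")
  case False
  define c where "c = A powr (- (1 / a))"
  have c: "0 < c" using False assms by (simp add: c_def)
  have "c powr a = inverse A"
    unfolding c_def powr_powr using assms by (simp add: powr_neg_one inverse_eq_divide)
  then have ca: "A * (c * u) powr a = u powr a" if "0 < u" for u
    using that c False by (simp add: powr_mult)
  have cb: "c * (c * u) powr (-1 - b) = A powr (b / a) * u powr (-1 - b)" if "0 < u" for u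
  proof -
    have "c * (c * u) powr (-1 - b) = (c powr 1 * c powr (-1 - b)) * u powr (-1 - b)"
      using that c by (simp add: powr_mult)
    also have "c powr 1 * c powr (-1 - b) = c powr (- b)"
      by (simp only: powr_add[symmetric]) simp
    also have "\<dots> = A powr (b / a)" by (simp add: c_def powr_powr)
    finally show ?thesis .
  qed
  have "(\<integral>\<^sup>+u. ennreal ((1 - exp (- (A * u powr a))) * u powr (-1 - b)) * indicator {0<..} u \<partial>lborel)
     = ennreal \<bar>c\<bar> * (\<integral>\<^sup>+u. ennreal ((1 - exp (- (A * (0 + c * u) powr a))) * (0 + c * u) powr (-1 - b))
          * indicator {0<..} (0 + c * u) \<partial>lborel)"
    using c by (intro nn_integral_real_affine) auto
  also have "\<dots> = (\<integral>\<^sup>+u. ennreal c * (ennreal ((1 - exp (- (A * (c * u) powr a))) * (c * u) powr (-1 - b))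
          * indicator {0<..} (c * u)) \<partial>lborel)"
    using c by (simp add: nn_integral_cmult)
  also have "\<dots> = (\<integral>\<^sup>+u. ennreal (A powr (b / a)) *
      (ennreal ((1 - exp (- (u powr a))) * u powr (-1 - b)) * indicator {0<..} u) \<partial>lborel)"
  proof (intro nn_integral_cong)
    fix u :: real
    show "ennreal c * (ennreal ((1 - exp (- (A * (c * u) powr a))) * (c * u) powr (-1 - b))
          * indicator {0<..} (c * u)) = ennreal (A powr (b / a)) *
      (ennreal ((1 - exp (- (u powr a))) * u powr (-1 - b)) * indicator {0<..} u)"
    proof (cases "0 < u")
      case True
      have "c * ((1 - exp (- (A * (c * u) powr a))) * (c * u) powr (-1 - b))
        = (1 - exp (- (A * (c * u) powr a))) * (c * (c * u) powr (-1 - b))" by simp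
      also have "\<dots> = A powr (b / a) * ((1 - exp (- (u powr a))) * u powr (-1 - b))"
        unfolding ca[OF True] cb[OF True] by simp
      finally show ?thesis using True c by (simp add: ennreal_mult'[symmetric])
    qed (use c in \<open>simp add: zero_less_mult_iff\<close>)
  qed
  also have "\<dots> = ennreal (A powr (b / a)) * power_const a b"
    unfolding power_const_def by (rule nn_integral_cmult) measurable
  finally show ?thesis .
qed simp

lemma power_const_pos:
  assumes "0 < a" "0 < b"
  shows "0 < power_const a b"
proof -
  let ?m = "(1 - exp (-1)) * 2 powr (-1 - b) :: real"
  have "0 < ennreal ?m * emeasure lborel {1..2::real}" by (simp add: ennreal_zero_less_mult_iff)
  also have "\<dots> = (\<integral>\<^sup>+u. ennreal ?m * indicator {1..2} u \<partial>(lborel::real measure))"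
    by (subst nn_integral_cmult_indicator) auto
  also have "\<dots> \<le> power_const a b"
    unfolding power_const_def
  proof (intro nn_integral_mono)
    fix u :: real
    show "ennreal ?m * indicator {1..2} u \<le> ennreal ((1 - exp (- (u powr a))) * u powr (-1 - b)) * indicator {0<..} u"
    proof (cases "u \<in> {1..2}")
      case True
      then have "1 \<le> u powr a" using assms by (simp add: ge_one_powr_ge_zero)
      moreover have "2 powr (-1 - b) \<le> u powr (-1 - b)"
        using True assms by (intro powr_mono2') auto
      ultimately have "?m \<le> (1 - exp (- (u powr a))) * u powr (-1 - b)"
        by (intro mult_mono) auto
      then show ?thesis using True by (simp add: ennreal_leI)
    qed simp
  qed
  finally show ?thesis .
qed

text \<open>
  Near zero the integrand is at most \<open>u^(a-b-1)\<close>, near infinity at most \<open>u^(-1-b)\<close>.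
\<close>

lemma power_const_finite:
  assumes "0 < b" "b < a"
  shows "power_const a b < \<infinity>"
proof -
  have "power_const a b \<le> (\<integral>\<^sup>+u. ennreal (u powr (a - b - 1)) * indicator {0..1} u
      + ennreal (u powr (-1 - b)) * indicator {1..} u \<partial>lborel)"
    unfolding power_const_def
  proof (intro nn_integral_mono)
    fix u :: real
    show "ennreal ((1 - exp (- (u powr a))) * u powr (-1 - b)) * indicator {0<..} u
       \<le> ennreal (u powr (a - b - 1)) * indicator {0..1} u + ennreal (u powr (-1 - b)) * indicator {1..} u"
    proof (cases "0 < u")
      case True
      show ?thesis
      proof (cases "u \<le> 1")
        case u: True
        have "1 - exp (- (u powr a)) \<le> u powr a" using exp_ge_add_one_self[of "- (u powr a)"] by simp
        then have "(1 - exp (- (u powr a))) * u powr (-1 - b) \<le> u powr a * u powr (-1 - b)"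
          by (intro mult_right_mono) auto
        also have "\<dots> = u powr (a - b - 1)" by (simp add: powr_add[symmetric] algebra_simps)
        finally have "ennreal ((1 - exp (- (u powr a))) * u powr (-1 - b)) \<le> ennreal (u powr (a - b - 1))"
          by (rule ennreal_leI)
        then show ?thesis using u True by (simp add: add_increasing2)
      next
        case False
        have "(1 - exp (- (u powr a))) * u powr (-1 - b) \<le> 1 * u powr (-1 - b)"
          by (intro mult_right_mono) auto
        then have "ennreal ((1 - exp (- (u powr a))) * u powr (-1 - b)) \<le> ennreal (u powr (-1 - b))"
          by (intro ennreal_leI) simp
        then show ?thesis using False True by simp
      qed
    qed simp
  qed
  also have "\<dots> = (\<integral>\<^sup>+u. ennreal (u powr (a - b - 1)) * indicator {0..1} u \<partial>lborel)
      + (\<integral>\<^sup>+u. ennreal (u powr (-1 - b)) * indicator {1..} u \<partial>lborel)"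
    by (rule nn_integral_add) measurable
  also have "\<dots> < \<infinity>"
    using nn_integral_has_integral_lebesgue'[OF _ has_integral_powr_from_0[of "a - b - 1" 1]]
      nn_integral_has_integral_lebesgue'[OF _ has_integral_powr_to_inf[of "-1 - b" 1]] assms
    by simp
  finally show ?thesis .
qed

context isotropic_stable
begin

lemma nn_integral_one_minus_cos:
  "(\<integral>\<^sup>+z. ennreal (1 - cos (inner z w)) \<partial>\<mu>) = ennreal (1 - exp (- (\<kappa> * norm w powr s)))"
proof -
  have "(LINT z|\<mu>. cos (inner z w)) = Re (CLINT z|\<mu>. iexp (inner z w))"
    by (subst integral_Re[symmetric, OF integrable_iexp_inner]) (simp add: Re_exp)
  also have "\<dots> = exp (- (\<kappa> * norm w powr s))" by (simp only: char_fun Re_complex_of_real)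
  finally have I: "(LINT z|\<mu>. cos (inner z w)) = exp (- (\<kappa> * norm w powr s))" .
  have i: "integrable \<mu> (\<lambda>z. cos (inner z w))"
    by (rule integrable_const_bound[where B=1]) auto
  have "(\<integral>\<^sup>+z. ennreal (1 - cos (inner z w)) \<partial>\<mu>) = ennreal (LINT z|\<mu>. 1 - cos (inner z w))"
    using i by (intro nn_integral_eq_integral) auto
  also have "(LINT z|\<mu>. 1 - cos (inner z w)) = 1 - exp (- (\<kappa> * norm w powr s))"
    using i by (subst Bochner_Integration.integral_diff) (auto simp: I scaleR_conv_of_real)
  finally show ?thesis .
qed

text \<open>
  The Gaussian function \<open>exp (- u |z|^2)\<close> is itself a Gaussian average of characters, so averaging it over
  the stable measure amounts to averaging the stable characteristic function over the Gaussian.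
\<close>

lemma nn_integral_one_minus_exp_square:
  assumes "0 < u"
  shows "(\<integral>\<^sup>+z. ennreal (1 - exp (- ((norm z)\<^sup>2 * u))) \<partial>\<mu>) =
    (\<integral>\<^sup>+g. ennreal (1 - exp (- (\<kappa> * 2 powr (s / 2) * norm (g::'k) powr s * u powr (s / 2)))) \<partial>standard_gaussian)"
proof -
  interpret MG: pair_sigma_finite \<mu> "standard_gaussian :: 'k measure" ..
  \<comment> \<open>With this factor the Gaussian characteristic function at \<open>?r *\<^sub>R z\<close> is \<open>exp (- u |z|^2)\<close>.\<close>
  let ?r = "sqrt (2 * u)"
  have g: "(\<integral>\<^sup>+g. ennreal (1 - cos (inner g (?r *\<^sub>R z))) \<partial>standard_gaussian) = ennreal (1 - exp (- ((norm z)\<^sup>2 * u)))"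
    for z :: 'k
    using assms by (simp add: gaussian.nn_integral_one_minus_cos power_mult_distrib mult_ac del: inner_scaleR_right)
  have m: "(\<integral>\<^sup>+z. ennreal (1 - cos (inner z (?r *\<^sub>R g))) \<partial>\<mu>)
     = ennreal (1 - exp (- (\<kappa> * 2 powr (s / 2) * norm g powr s * u powr (s / 2))))" for g :: 'k
    using assms by (simp add: nn_integral_one_minus_cos powr_mult powr_half_sqrt[symmetric] powr_powr mult_ac del: inner_scaleR_right)
  have "(\<integral>\<^sup>+z. ennreal (1 - exp (- ((norm z)\<^sup>2 * u))) \<partial>\<mu>)
     = (\<integral>\<^sup>+z. \<integral>\<^sup>+g. ennreal (1 - cos (inner g (?r *\<^sub>R z))) \<partial>standard_gaussian \<partial>\<mu>)"
    by (simp only: g)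
  also have "\<dots> = (\<integral>\<^sup>+g. \<integral>\<^sup>+z. ennreal (1 - cos (inner g (?r *\<^sub>R z))) \<partial>\<mu> \<partial>standard_gaussian)"
    by (rule MG.Fubini'[symmetric]) measurable
  also have "\<dots> = (\<integral>\<^sup>+g. \<integral>\<^sup>+z. ennreal (1 - cos (inner z (?r *\<^sub>R g))) \<partial>\<mu> \<partial>standard_gaussian)"
    by (simp add: inner_commute)
  finally show ?thesis by (simp only: m)
qed

text \<open>
  The power \<open>|z|^p\<close> is written as an integral of \<open>1 - exp (- u |z|^2)\<close> against \<open>u^(-1-p/2)\<close>. Averaged over
  the stable measure this becomes an integral of \<open>1 - exp (- const * |g|^s u^(s/2))\<close> with \<open>g\<close> Gaussian,
  which converges because \<open>p < s\<close> and is a multiple of the Gaussian moment of order \<open>p\<close>.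
\<close>

lemma moment_finite:
  assumes p: "0 < p" "p < s"
  shows "(\<integral>\<^sup>+z. ennreal (norm z powr p) \<partial>\<mu>) < \<infinity>"
proof -
  interpret mu_lborel: pair_sigma_finite \<mu> "lborel :: real measure" ..
  interpret gauss_lborel: pair_sigma_finite "standard_gaussian :: 'k measure" "lborel :: real measure" ..
  let ?G = "standard_gaussian :: 'k measure"
  let ?w = "\<lambda>u::real. ennreal (u powr (-1 - p / 2)) * indicator {0<..} u"
  let ?B = "\<lambda>g. \<kappa> * 2 powr (s / 2) * norm (g::'k) powr s"
  have "power_const 1 (p / 2) * (\<integral>\<^sup>+z. ennreal (norm z powr p) \<partial>\<mu>)
      = (\<integral>\<^sup>+z. \<integral>\<^sup>+u. ennreal (1 - exp (- ((norm z)\<^sup>2 * u))) * ?w u \<partial>lborel \<partial>\<mu>)"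
  proof -
    have "power_const 1 (p / 2) * ennreal (norm z powr p)
        = (\<integral>\<^sup>+u. ennreal (1 - exp (- ((norm z)\<^sup>2 * u))) * ?w u \<partial>lborel)" for z :: 'k
    proof -
      have "(norm z)\<^sup>2 = norm z powr 2" by (cases "z = 0") simp_all
      then have *: "((norm z)\<^sup>2) powr (p / 2 / 1) = norm z powr p" by (simp only: powr_powr) simp
      have "(\<integral>\<^sup>+u. ennreal (1 - exp (- ((norm z)\<^sup>2 * u))) * ?w u \<partial>lborel) =
        (\<integral>\<^sup>+u. ennreal ((1 - exp (- ((norm z)\<^sup>2 * u powr 1))) * u powr (-1 - p / 2)) * indicator {0<..} u \<partial>lborel)"
        by (intro nn_integral_cong) (auto simp: indicator_def ennreal_mult)
      also have "\<dots> = ennreal (((norm z)\<^sup>2) powr (p / 2 / 1)) * power_const 1 (p / 2)"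
        using p by (intro nn_integral_power_exp) auto
      finally show ?thesis by (simp only: * mult.commute)
    qed
    then show ?thesis by (subst nn_integral_cmult[symmetric]) simp_all
  qed
  also have "\<dots> = (\<integral>\<^sup>+u. \<integral>\<^sup>+z. ennreal (1 - exp (- ((norm z)\<^sup>2 * u))) * ?w u \<partial>\<mu> \<partial>lborel)"
    by (rule mu_lborel.Fubini'[symmetric]) measurable
  also have "\<dots> = (\<integral>\<^sup>+u. \<integral>\<^sup>+g. ennreal (1 - exp (- (?B g * u powr (s / 2)))) * ?w u \<partial>?G \<partial>lborel)"
  proof (intro nn_integral_cong)
    fix u :: real
    show "(\<integral>\<^sup>+z. ennreal (1 - exp (- ((norm z)\<^sup>2 * u))) * ?w u \<partial>\<mu>)
      = (\<integral>\<^sup>+g. ennreal (1 - exp (- (?B g * u powr (s / 2)))) * ?w u \<partial>?G)"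
      by (cases "0 < u") (simp_all add: nn_integral_multc nn_integral_one_minus_exp_square)
  qed
  also have "\<dots> = (\<integral>\<^sup>+g. \<integral>\<^sup>+u. ennreal (1 - exp (- (?B g * u powr (s / 2)))) * ?w u \<partial>lborel \<partial>?G)"
    by (rule gauss_lborel.Fubini') measurable
  also have "\<dots> = (\<integral>\<^sup>+g. ennreal ((\<kappa> * 2 powr (s / 2)) powr (p / s)) * ennreal (norm (g::'k) powr p)
      * power_const (s / 2) (p / 2) \<partial>?G)"
  proof (intro nn_integral_cong)
    fix g :: 'k
    have "(\<integral>\<^sup>+u. ennreal (1 - exp (- (?B g * u powr (s / 2)))) * ?w u \<partial>lborel)
      = (\<integral>\<^sup>+u. ennreal ((1 - exp (- (?B g * u powr (s / 2)))) * u powr (-1 - p / 2)) * indicator {0<..} u \<partial>lborel)"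
      using scale_pos by (intro nn_integral_cong) (auto simp: indicator_def ennreal_mult)
    also have "\<dots> = ennreal (?B g powr ((p / 2) / (s / 2))) * power_const (s / 2) (p / 2)"
      using p scale_pos by (intro nn_integral_power_exp) auto
    also have "?B g powr ((p / 2) / (s / 2)) = (\<kappa> * 2 powr (s / 2)) powr (p / s) * norm g powr p"
      using p scale_pos by (simp add: powr_mult powr_powr)
    finally show "(\<integral>\<^sup>+u. ennreal (1 - exp (- (?B g * u powr (s / 2)))) * ?w u \<partial>lborel)
      = ennreal ((\<kappa> * 2 powr (s / 2)) powr (p / s)) * ennreal (norm g powr p) * power_const (s / 2) (p / 2)"
      by (simp add: ennreal_mult)
  qed
  also have "\<dots> = ennreal ((\<kappa> * 2 powr (s / 2)) powr (p / s)) * (\<integral>\<^sup>+g. ennreal (norm (g::'k) powr p) \<partial>?G)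
      * power_const (s / 2) (p / 2)"
    by (simp add: nn_integral_multc nn_integral_cmult)
  also have "\<dots> < \<infinity>"
    using gaussian_moment_finite[OF p(1), where 'k='k] power_const_finite[of "p / 2" "s / 2"] p
    by (simp add: ennreal_mult_less_top)
  finally have "power_const 1 (p / 2) * (\<integral>\<^sup>+z. ennreal (norm z powr p) \<partial>\<mu>) < \<infinity>" .
  then show ?thesis
    using power_const_pos[of 1 "p / 2"] p by (auto simp: ennreal_mult_less_top)
qed

end

section \<open>Pareto sums approximate positive stable laws\<close>

text \<open>
  The density \<open>a y^(-1-a)\<close> has mass \<open>n\<close> on the half-line starting at \<open>n^(-1/a)\<close>. This is the law of
  \<open>n^(-1/a) Y\<close> for a Pareto variable \<open>Y\<close> with tail \<open>y^(-a)\<close>, so the sum of \<open>n\<close> independent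
  copies converges in law to a positive \<open>a\<close>-stable variable if \<open>a < 1\<close>.
\<close>

definition pareto :: "real \<Rightarrow> real \<Rightarrow> real measure" where
  "pareto a n = density lborel (\<lambda>y. ennreal (a / n * y powr (-1 - a)) * indicator {n powr (- 1 / a)..} y)"

lemma sets_pareto [simp, measurable_cong]: "sets (pareto a n) = sets borel"
  by (simp add: pareto_def)

lemma space_pareto [simp]: "space (pareto a n) = UNIV"
  by (simp add: pareto_def)

lemma prob_space_pareto:
  assumes "0 < a" "0 < n"
  shows "prob_space (pareto a n)"
proof
  let ?e = "n powr (- 1 / a)"
  have "((\<lambda>y. y powr (-1 - a)) has_integral - (?e powr (-1 - a + 1)) / (-1 - a + 1)) {?e..}"
    using assms by (intro has_integral_powr_to_inf) auto
  moreover have "- (?e powr (-1 - a + 1)) / (-1 - a + 1) = n / a"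
    using assms by (simp add: powr_powr)
  ultimately have "((\<lambda>y. y powr (-1 - a)) has_integral n / a) {?e..}" by (simp only:)
  then have "((\<lambda>y. a / n * y powr (-1 - a)) has_integral a / n * (n / a)) {?e..}"
    by (rule has_integral_mult_right)
  then have "integral\<^sup>N lborel (\<lambda>y. ennreal (a / n * y powr (-1 - a)) * indicator {?e..} y) = ennreal (a / n * (n / a))"
    using assms by (intro nn_integral_has_integral_lebesgue') auto
  then show "emeasure (pareto a n) (space (pareto a n)) = 1"
    using assms by (simp add: pareto_def emeasure_density)
qed

text \<open>
  The Laplace exponent of the Levy measure \<open>a y^(-1-a) dy\<close> truncated at \<open>n^(-1/a)\<close>, the density of
  \<open>pareto a n\<close> without its normalising factor \<open>1/n\<close>.
\<close>

definition levy_exponent :: "real \<Rightarrow> real \<Rightarrow> real \<Rightarrow> real" where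
  "levy_exponent a n t = enn2real
     (\<integral>\<^sup>+y. ennreal ((1 - exp (- (t * y))) * (a * y powr (-1 - a))) * indicator {n powr (- 1 / a)..} y \<partial>lborel)"

lemma levy_exponent_measurable [measurable]: "levy_exponent a n \<in> borel_measurable borel"
  unfolding levy_exponent_def by measurable

lemma nn_integral_levy:
  assumes "0 < a" "0 \<le> t"
  shows "(\<integral>\<^sup>+y. ennreal ((1 - exp (- (t * y))) * (a * y powr (-1 - a))) * indicator {0<..} y \<partial>lborel)
    = ennreal (a * t powr a) * power_const 1 a"
proof -
  have "(\<integral>\<^sup>+y. ennreal ((1 - exp (- (t * y))) * (a * y powr (-1 - a))) * indicator {0<..} y \<partial>lborel)
    = (\<integral>\<^sup>+y. ennreal a * (ennreal ((1 - exp (- (t * y powr 1))) * y powr (-1 - a)) * indicator {0<..} y) \<partial>lborel)"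
    using assms by (intro nn_integral_cong) (auto simp: indicator_def ennreal_mult'[symmetric] mult_ac)
  also have "\<dots> = ennreal a * (\<integral>\<^sup>+y. ennreal ((1 - exp (- (t * y powr 1))) * y powr (-1 - a)) * indicator {0<..} y \<partial>lborel)"
    by (rule nn_integral_cmult) measurable
  also have "(\<integral>\<^sup>+y. ennreal ((1 - exp (- (t * y powr 1))) * y powr (-1 - a)) * indicator {0<..} y \<partial>lborel)
     = ennreal (t powr (a / 1)) * power_const 1 a"
    using assms by (intro nn_integral_power_exp) auto
  finally show ?thesis using assms by (simp add: ennreal_mult mult.assoc)
qed

definition levy_const :: "real \<Rightarrow> real" where
  "levy_const a = a * enn2real (power_const 1 a)"

lemma levy_const_pos: "0 < a \<Longrightarrow> a < 1 \<Longrightarrow> 0 < levy_const a"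
  using power_const_pos[of 1 a] power_const_finite[of a 1]
  by (auto simp: levy_const_def enn2real_positive_iff)

lemma nn_integral_levy':
  assumes "0 < a" "a < 1" "0 \<le> t"
  shows "(\<integral>\<^sup>+y. ennreal ((1 - exp (- (t * y))) * (a * y powr (-1 - a))) * indicator {0<..} y \<partial>lborel)
    = ennreal (levy_const a * t powr a)"
proof -
  have "power_const 1 a = ennreal (enn2real (power_const 1 a))"
    using power_const_finite[of a 1] assms by simp
  then have "ennreal (a * t powr a) * power_const 1 a = ennreal (a * t powr a) * ennreal (enn2real (power_const 1 a))"
    by simp
  also have "\<dots> = ennreal (levy_const a * t powr a)"
    using assms by (simp add: ennreal_mult[symmetric] levy_const_def mult_ac)
  finally show ?thesis using assms by (simp add: nn_integral_levy)
qed

lemma ennreal_levy_exponent: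
  assumes "0 < a" "a < 1" "0 < n" "0 \<le> t"
  shows "ennreal (levy_exponent a n t) =
     (\<integral>\<^sup>+y. ennreal ((1 - exp (- (t * y))) * (a * y powr (-1 - a))) * indicator {n powr (- 1 / a)..} y \<partial>lborel)"
    and "levy_exponent a n t \<le> levy_const a * t powr a"
proof -
  have e: "0 < y" if "n powr (- 1 / a) \<le> y" for y
    by (rule less_le_trans[OF _ that]) (use assms in simp)
  have "(\<integral>\<^sup>+y. ennreal ((1 - exp (- (t * y))) * (a * y powr (-1 - a))) * indicator {n powr (- 1 / a)..} y \<partial>lborel)
    \<le> (\<integral>\<^sup>+y. ennreal ((1 - exp (- (t * y))) * (a * y powr (-1 - a))) * indicator {0<..} y \<partial>lborel)" (is "?I \<le> _")
  proof (intro nn_integral_mono)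
    fix y
    show "ennreal ((1 - exp (- (t * y))) * (a * y powr (-1 - a))) * indicator {n powr (- 1 / a)..} y
      \<le> ennreal ((1 - exp (- (t * y))) * (a * y powr (-1 - a))) * indicator {0<..} y"
      using e[of y] by (cases "n powr (- 1 / a) \<le> y") simp_all
  qed
  then have le: "?I \<le> ennreal (levy_const a * t powr a)" using assms by (simp add: nn_integral_levy')
  then show eq: "ennreal (levy_exponent a n t) = ?I"
    unfolding levy_exponent_def by (simp add: le_less_trans)
  have "ennreal (levy_exponent a n t) \<le> ennreal (levy_const a * t powr a)"
    unfolding eq by (rule le)
  then show "levy_exponent a n t \<le> levy_const a * t powr a"
    using levy_const_pos[of a] assms by (subst (asm) ennreal_le_iff) auto
qed

text \<open>
  The truncation point \<open>n^(-1/a)\<close> tends to zero, and the integral over the whole half-line is finite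
  because \<open>a < 1\<close>.
\<close>

lemma levy_exponent_tendsto:
  assumes "0 < a" "a < 1" "0 \<le> t"
  shows "(\<lambda>n. levy_exponent a (real n) t) \<longlonglongrightarrow> levy_const a * t powr a"
proof -
  let ?f = "\<lambda>y. ennreal ((1 - exp (- (t * y))) * (a * y powr (-1 - a)))"
  have lim: "(\<lambda>n. \<integral>\<^sup>+y. ?f y * indicator {0<..} y * indicator {real n powr (- 1 / a)..} y \<partial>lborel) \<longlonglongrightarrow>
     (\<integral>\<^sup>+y. ?f y * indicator {0<..} y \<partial>lborel)"
  proof (rule nn_integral_dominated_convergence)
    show "(\<integral>\<^sup>+y. ?f y * indicator {0<..} y \<partial>lborel) < \<infinity>"
      using assms by (simp add: nn_integral_levy')
    show "AE y in lborel. (\<lambda>n. ?f y * indicator {0<..} y * indicator {real n powr (- 1 / a)..} y) \<longlonglongrightarrow> ?f y * indicator {0<..} y"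
    proof (rule AE_I2)
      fix y :: real
      have "(\<lambda>n. real n powr (- 1 / a)) \<longlonglongrightarrow> 0"
        using assms by (intro tendsto_neg_powr filterlim_real_sequentially) auto
      then have "\<forall>\<^sub>F n in sequentially. real n powr (- 1 / a) < y" if "0 < y"
        using that by (rule order_tendstoD)
      then have "\<forall>\<^sub>F n in sequentially. ?f y * indicator {0<..} y * indicator {real n powr (- 1 / a)..} y = ?f y * indicator {0<..} y"
        by (cases "0 < y") (auto elim!: eventually_mono)
      then show "(\<lambda>n. ?f y * indicator {0<..} y * indicator {real n powr (- 1 / a)..} y) \<longlonglongrightarrow> ?f y * indicator {0<..} y"
        by (rule tendsto_eventually)
    qed
    show "AE y in lborel. ?f y * indicator {0<..} y * indicator {real n powr (- 1 / a)..} y \<le> ?f y * indicator {0<..} y" for n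
      by (rule AE_I2) (auto simp: indicator_def)
    show "(\<lambda>y. ?f y * indicator {0<..} y * indicator {real n powr (- 1 / a)..} y) \<in> borel_measurable lborel" for n
      by simp
    show "(\<lambda>y. ?f y * indicator {0<..} y) \<in> borel_measurable lborel"
      by simp
    show "(\<lambda>y. ?f y * indicator {0<..} y) \<in> borel_measurable lborel"
      by simp
  qed
  have ev: "\<forall>\<^sub>F n in sequentially. (\<integral>\<^sup>+y. ?f y * indicator {0<..} y * indicator {real n powr (- 1 / a)..} y \<partial>lborel)
      = ennreal (levy_exponent a (real n) t)"
    using eventually_gt_at_top[of 0]
  proof eventually_elim
    case (elim n)
    then have e: "0 < y" if "real n powr (- 1 / a) \<le> y" for y
      by (intro less_le_trans[OF _ that]) simp
    have "(\<integral>\<^sup>+y. ?f y * indicator {0<..} y * indicator {real n powr (- 1 / a)..} y \<partial>lborel)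
      = (\<integral>\<^sup>+y. ?f y * indicator {real n powr (- 1 / a)..} y \<partial>lborel)"
    proof (intro nn_integral_cong)
      fix y
      show "?f y * indicator {0<..} y * indicator {real n powr (- 1 / a)..} y = ?f y * indicator {real n powr (- 1 / a)..} y"
        using e[of y] by (cases "real n powr (- 1 / a) \<le> y") simp_all
    qed
    then show ?case using elim assms by (simp add: ennreal_levy_exponent)
  qed
  have "(\<lambda>n. ennreal (levy_exponent a (real n) t)) \<longlonglongrightarrow> ennreal (levy_const a * t powr a)"
    using Lim_transform_eventually[OF lim ev] by (simp only: nn_integral_levy'[OF assms])
  moreover have "\<forall>\<^sub>F n in sequentially. 0 \<le> levy_exponent a (real n) t"
    by (intro always_eventually allI) (simp only: levy_exponent_def enn2real_nonneg)
  moreover have "0 \<le> levy_const a * t powr a"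
    using levy_const_pos[OF assms(1,2)] by simp
  ultimately show ?thesis by (rule tendsto_ennrealD)
qed

lemma pareto_laplace:
  assumes "0 < a" "a < 1" "0 < n" "0 \<le> t"
  shows "(LINT y|pareto a n. exp (- (t * \<bar>y\<bar>))) = 1 - levy_exponent a n t / n"
    and "levy_exponent a n t \<le> n"
proof -
  interpret prob_space "pareto a n" using assms by (intro prob_space_pareto)
  let ?f = "\<lambda>y. exp (- (t * \<bar>y\<bar>))"
  have int: "integrable (pareto a n) ?f"
    using assms by (intro integrable_const_bound[where B=1]) auto
  have e: "0 < y" if "n powr (- 1 / a) \<le> y" for y
    by (rule less_le_trans[OF _ that]) (use assms in simp)
  have "ennreal (LINT y|pareto a n. 1 - ?f y) = (\<integral>\<^sup>+y. ennreal (1 - ?f y) \<partial>pareto a n)"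
    using int assms by (intro nn_integral_eq_integral[symmetric]) auto
  also have "\<dots> = (\<integral>\<^sup>+y. ennreal (1 / n) * (ennreal ((1 - exp (- (t * y))) * (a * y powr (-1 - a))) * indicator {n powr (- 1 / a)..} y) \<partial>lborel)"
  proof -
    have "(\<integral>\<^sup>+y. ennreal (1 - ?f y) \<partial>pareto a n) =
      (\<integral>\<^sup>+y. ennreal (a / n * y powr (-1 - a)) * indicator {n powr (- 1 / a)..} y * ennreal (1 - ?f y) \<partial>lborel)"
      unfolding pareto_def by (rule nn_integral_density) measurable
    also have "\<dots> = (\<integral>\<^sup>+y. ennreal (1 / n) * (ennreal ((1 - exp (- (t * y))) * (a * y powr (-1 - a))) * indicator {n powr (- 1 / a)..} y) \<partial>lborel)"
    proof (intro nn_integral_cong)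
      fix y
      show "ennreal (a / n * y powr (-1 - a)) * indicator {n powr (- 1 / a)..} y * ennreal (1 - ?f y)
        = ennreal (1 / n) * (ennreal ((1 - exp (- (t * y))) * (a * y powr (-1 - a))) * indicator {n powr (- 1 / a)..} y)"
        using e[of y] assms
        by (cases "n powr (- 1 / a) \<le> y") (simp_all add: ennreal_mult'[symmetric] ennreal_mult''[symmetric] mult_ac)
    qed
    finally show ?thesis .
  qed
  also have "\<dots> = ennreal (1 / n) * ennreal (levy_exponent a n t)"
    using assms by (simp add: nn_integral_cmult ennreal_levy_exponent)
  also have "\<dots> = ennreal (levy_exponent a n t / n)"
    using assms by (simp add: ennreal_mult'[symmetric])
  finally have eq: "(LINT y|pareto a n. 1 - ?f y) = levy_exponent a n t / n"
    by (subst (asm) ennreal_inj) (use assms in \<open>auto intro!: integral_nonneg_AE simp: levy_exponent_def\<close>)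
  then show 1: "(LINT y|pareto a n. ?f y) = 1 - levy_exponent a n t / n"
    using int prob_space by (simp add: Bochner_Integration.integral_diff)
  have "0 \<le> (LINT y|pareto a n. ?f y)" by (intro integral_nonneg_AE) auto
  then show "levy_exponent a n t \<le> n" using 1 assms by (simp add: field_simps)
qed

text \<open>
  The moment of order \<open>b\<close> of \<open>\<Sum>\<^sub>l c\<^sub>l Y\<^sub>l\<close>, where each \<open>Y\<^sub>l\<close> is a sum of \<open>n\<close> independent Pareto variables.
  The variables are positive almost surely; the absolute values make this visible in the formula.
\<close>

definition pareto_moment :: "real \<Rightarrow> real \<Rightarrow> nat \<Rightarrow> nat \<Rightarrow> (nat \<Rightarrow> real) \<Rightarrow> ennreal" where
  "pareto_moment a b n k c = (\<integral>\<^sup>+x. ennreal ((\<Sum>l<k. (\<Sum>i<n. \<bar>x (l, i)\<bar>) * c l) powr b)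
      \<partial>PiM ({..<k} \<times> {..<n}) (\<lambda>_. pareto a (real n)))"

text \<open>
  The power is written as an integral of \<open>1 - exp\<close>, and by independence the Laplace transform of the sum is
  the product of the Laplace transforms of its terms.
\<close>

lemma pareto_moment_eq:
  fixes c :: "nat \<Rightarrow> real"
  assumes a: "0 < a" "a < 1" and b: "0 < b" and n: "0 < n" and c: "\<And>l. l < k \<Longrightarrow> 0 \<le> c l"
  shows "power_const 1 b * pareto_moment a b n k c =
    (\<integral>\<^sup>+s. ennreal ((1 - (\<Prod>l<k. (1 - levy_exponent a (real n) (s * c l) / real n) ^ n)) * s powr (-1 - b))
       * indicator {0<..} s \<partial>lborel)"
proof -
  interpret pareto: prob_space "pareto a (real n)" using a n by (intro prob_space_pareto) auto
  interpret product_prob_space "\<lambda>_::nat \<times> nat. pareto a (real n)" ..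
  let ?J = "{..<k} \<times> {..<n}"
  let ?P = "PiM ?J (\<lambda>_. pareto a (real n))"
  interpret PJ: prob_space ?P by (intro prob_space_PiM pareto.prob_space_axioms)
  interpret PL: pair_sigma_finite ?P "lborel :: real measure" ..
  let ?S = "\<lambda>x. \<Sum>l<k. (\<Sum>i<n. \<bar>x (l, i)\<bar>) * c l"
  have S: "0 \<le> ?S x" for x :: "nat \<times> nat \<Rightarrow> real"
    using c by (intro sum_nonneg mult_nonneg_nonneg) auto
  have "power_const 1 b * pareto_moment a b n k c
    = (\<integral>\<^sup>+x. (\<integral>\<^sup>+s. ennreal ((1 - exp (- (?S x * s powr 1))) * s powr (-1 - b)) * indicator {0<..} s \<partial>lborel) \<partial>?P)"
  proof -
    have "(\<integral>\<^sup>+s. ennreal ((1 - exp (- (?S x * s powr 1))) * s powr (-1 - b)) * indicator {0<..} s \<partial>lborel)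
      = ennreal (?S x powr (b / 1)) * power_const 1 b" for x :: "nat \<times> nat \<Rightarrow> real"
      using S b by (intro nn_integral_power_exp) auto
    then show ?thesis
      unfolding pareto_moment_def by (simp only: mult.commute[of "power_const 1 b"] div_by_1) (subst nn_integral_multc[symmetric], simp_all)
  qed
  also have "\<dots> = (\<integral>\<^sup>+s. (\<integral>\<^sup>+x. ennreal ((1 - exp (- (?S x * s powr 1))) * s powr (-1 - b)) * indicator {0<..} s \<partial>?P) \<partial>lborel)"
    by (rule PL.Fubini'[symmetric]) measurable
  also have "\<dots> = (\<integral>\<^sup>+s. ennreal ((1 - (\<Prod>l<k. (1 - levy_exponent a (real n) (s * c l) / real n) ^ n)) * s powr (-1 - b))
       * indicator {0<..} s \<partial>lborel)"
  proof (intro nn_integral_cong)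
    fix s :: real
    show "(\<integral>\<^sup>+x. ennreal ((1 - exp (- (?S x * s powr 1))) * s powr (-1 - b)) * indicator {0<..} s \<partial>?P)
      = ennreal ((1 - (\<Prod>l<k. (1 - levy_exponent a (real n) (s * c l) / real n) ^ n)) * s powr (-1 - b)) * indicator {0<..} s"
    proof (cases "0 < s")
      case True
      let ?g = "\<lambda>j y. exp (- (s * c (fst j) * \<bar>y\<bar>))"
      have e: "exp (- (?S x * s powr 1)) = (\<Prod>j\<in>?J. ?g j (x j))" for x :: "nat \<times> nat \<Rightarrow> real"
      proof -
        have "- (?S x * s powr 1) = (\<Sum>j\<in>?J. - (s * c (fst j) * \<bar>x j\<bar>))"
          using True by (simp add: sum.cartesian_product' sum_distrib_left sum_distrib_right sum_negf mult_ac)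
        then show ?thesis by (simp add: exp_sum)
      qed
      have int: "integrable (pareto a (real n)) (?g j)" if "j \<in> ?J" for j
        using True c that by (intro pareto.integrable_const_bound[where B=1]) auto
      have "(LINT x|?P. (\<Prod>j\<in>?J. ?g j (x j))) = (\<Prod>j\<in>?J. LINT y|pareto a (real n). ?g j y)"
        by (rule product_integral_prod) (use int in auto)
      also have "\<dots> = (\<Prod>j\<in>?J. 1 - levy_exponent a (real n) (s * c (fst j)) / real n)"
        using True c a n by (intro prod.cong refl pareto_laplace) auto
      also have "\<dots> = (\<Prod>l<k. (1 - levy_exponent a (real n) (s * c l) / real n) ^ n)"
        by (simp add: prod.cartesian_product')
      finally have I: "(LINT x|?P. (\<Prod>j\<in>?J. ?g j (x j))) = (\<Prod>l<k. (1 - levy_exponent a (real n) (s * c l) / real n) ^ n)" .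
      have intP: "integrable ?P (\<lambda>x. \<Prod>j\<in>?J. ?g j (x j))"
        by (rule product_integrable_prod) (use int in auto)
      have "(\<integral>\<^sup>+x. ennreal (1 - (\<Prod>j\<in>?J. ?g j (x j))) \<partial>?P) = ennreal (LINT x|?P. 1 - (\<Prod>j\<in>?J. ?g j (x j)))"
      proof (rule nn_integral_eq_integral)
        show "AE x in ?P. 0 \<le> 1 - (\<Prod>j\<in>?J. ?g j (x j))"
          using S True by (intro AE_I2) (simp add: e[symmetric])
      qed (use intP in auto)
      also have "\<dots> = ennreal (1 - (\<Prod>l<k. (1 - levy_exponent a (real n) (s * c l) / real n) ^ n))"
        using intP PJ.prob_space by (simp add: Bochner_Integration.integral_diff I)
      finally have E: "(\<integral>\<^sup>+x. ennreal (1 - (\<Prod>j\<in>?J. ?g j (x j))) \<partial>?P)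
        = ennreal (1 - (\<Prod>l<k. (1 - levy_exponent a (real n) (s * c l) / real n) ^ n))" .
      show ?thesis unfolding e using True
        by (simp add: ennreal_mult'' nn_integral_multc E)
    qed simp
  qed
  finally show ?thesis .
qed

lemma power_diff_le_mult_nat:
  fixes x y :: real
  assumes "0 \<le> x" "x \<le> 1" "0 \<le> y" "y \<le> 1"
  shows "\<bar>x ^ n - y ^ n\<bar> \<le> real n * \<bar>x - y\<bar>"
  using norm_power_diff[of x y n] assms by simp

text \<open>
  On the unit interval the power function of exponent \<open>n\<close> has Lipschitz constant \<open>n\<close>, which cancels the
  denominator, so \<open>v n\<close> may be replaced by its limit.
\<close>

lemma one_minus_div_power_tendsto:
  fixes v :: "nat \<Rightarrow> real"
  assumes v: "v \<longlonglongrightarrow> w" and bound: "\<And>n. 0 < n \<Longrightarrow> 0 \<le> v n \<and> v n \<le> real n" and w: "0 \<le> w"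
  shows "(\<lambda>n. (1 - v n / real n) ^ n) \<longlonglongrightarrow> exp (- w)"
proof -
  have E: "(\<lambda>n. (1 - w / real n) ^ n) \<longlonglongrightarrow> exp (- w)"
    using tendsto_exp_limit_sequentially[of "- w"] by simp
  have "(\<lambda>n. (1 - v n / real n) ^ n - (1 - w / real n) ^ n) \<longlonglongrightarrow> 0"
  proof (rule Lim_null_comparison)
    show "(\<lambda>n. \<bar>v n - w\<bar>) \<longlonglongrightarrow> 0"
      using v by (simp add: LIM_zero_iff tendsto_rabs_zero_iff)
    show "\<forall>\<^sub>F n in sequentially. norm ((1 - v n / real n) ^ n - (1 - w / real n) ^ n) \<le> \<bar>v n - w\<bar>"
      using eventually_gt_at_top[of "max 0 (nat \<lceil>w\<rceil>)"]
    proof eventually_elim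
      case (elim n)
      then have n: "0 < n" "w \<le> real n" by linarith+
      have "\<bar>(1 - v n / real n) ^ n - (1 - w / real n) ^ n\<bar> \<le> real n * \<bar>(1 - v n / real n) - (1 - w / real n)\<bar>"
        using bound[OF n(1)] n w by (intro power_diff_le_mult_nat) auto
      also have "(1 - v n / real n) - (1 - w / real n) = (w - v n) / real n" by (simp add: diff_divide_distrib)
      also have "real n * \<bar>(w - v n) / real n\<bar> = \<bar>v n - w\<bar>" using n by (simp add: abs_minus_commute)
      finally show ?case by simp
    qed
  qed
  from tendsto_add[OF this E] show ?thesis by simp
qed

lemma one_minus_prod_le_sum:
  fixes x :: "'i \<Rightarrow> real"
  assumes "finite I" "\<And>i. i \<in> I \<Longrightarrow> 0 \<le> x i \<and> x i \<le> 1"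
  shows "1 - (\<Prod>i\<in>I. x i) \<le> (\<Sum>i\<in>I. 1 - x i)"
  using assms
proof (induction I)
  case (insert i I)
  have P: "0 \<le> (\<Prod>i\<in>I. x i)" "(\<Prod>i\<in>I. x i) \<le> 1"
    using insert by (auto intro!: prod_nonneg prod_le_1)
  have "1 - x i * (\<Prod>i\<in>I. x i) = (1 - x i) + x i * (1 - (\<Prod>i\<in>I. x i))" by (simp add: algebra_simps)
  also have "\<dots> \<le> (1 - x i) + 1 * (1 - (\<Prod>i\<in>I. x i))"
    using insert P by (intro add_left_mono mult_right_mono) auto
  finally show ?case using insert by auto
qed simp

lemma le_two_one_minus_exp:
  fixes x y :: real
  assumes "0 \<le> y" "x \<le> 1" "x \<le> y"
  shows "x \<le> 2 * (1 - exp (- y))"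
proof (cases "y \<le> 1")
  case True
  have "exp (- y) \<le> 1 / (1 + y)"
    using exp_ge_add_one_self[of y] assms by (simp add: exp_minus inverse_eq_divide frac_le)
  also have "\<dots> \<le> 1 - y / 2"
    using True assms mult_left_le[of y y] by (simp add: field_simps)
  finally show ?thesis using assms by simp
next
  case False
  have "exp (-y) \<le> exp (-1)" using False by simp
  also have "\<dots> \<le> (1/2::real)"
    using exp_ge_add_one_self[of "1::real"] by (simp add: exp_minus field_simps)
  finally show ?thesis using assms by simp
qed

text \<open>
  Up to the factor \<open>power_const 1 b\<close>, the moment of order \<open>b\<close> of \<open>\<Sum>\<^sub>l c\<^sub>l Y\<^sub>l\<close> for independent positive
  \<open>a\<close>-stable variables \<open>Y\<^sub>l\<close>.
\<close>

definition stable_moment :: "real \<Rightarrow> real \<Rightarrow> nat \<Rightarrow> (nat \<Rightarrow> real) \<Rightarrow> ennreal" where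
  "stable_moment a b k c = ennreal ((levy_const a * (\<Sum>l<k. c l powr a)) powr (b / a)) * power_const a b"

text \<open>
  The Laplace transforms converge to \<open>exp (- A u^a)\<close>. Bernoulli's inequality bounds one minus the Laplace
  transform of a Pareto sum by \<open>A u^a\<close>, hence by twice \<open>1 - exp (- A u^a)\<close>; this is the majorant for the
  convergence of the integrals and also gives the uniform bound.
\<close>

lemma pareto_moment_limit:
  fixes c :: "nat \<Rightarrow> real"
  assumes a: "a < 1" and b: "0 < b" "b < a" and c: "\<And>l. l < k \<Longrightarrow> 0 \<le> c l"
  shows "(\<lambda>n. power_const 1 b * pareto_moment a b n k c) \<longlonglongrightarrow> stable_moment a b k c"
    and "0 < n \<Longrightarrow> power_const 1 b * pareto_moment a b n k c \<le> 2 * stable_moment a b k c"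
proof -
  have a0: "0 < a" using b by simp
  define A where "A = levy_const a * (\<Sum>l<k. c l powr a)"
  have A: "0 \<le> A" using levy_const_pos[of a] a a0 by (simp add: A_def sum_nonneg)
  have As: "(\<Sum>l<k. levy_const a * (s * c l) powr a) = A * s powr a" if "0 < s" for s
    using that c by (simp add: A_def powr_mult sum_distrib_left sum_distrib_right mult_ac)
  define e where "e n s = (\<Prod>l<k. (1 - levy_exponent a (real n) (s * c l) / real n) ^ n)" for n :: nat and s
  have [measurable]: "e n \<in> borel_measurable borel" for n unfolding e_def by measurable
  let ?w = "\<lambda>s. s powr (-1 - b)"
  let ?g = "\<lambda>n s. ennreal ((1 - e n s) * ?w s) * indicator {0<..} s"
  let ?h = "\<lambda>s. ennreal ((1 - exp (- (A * s powr a))) * ?w s) * indicator {0<..} s"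
  have lev: "0 \<le> levy_exponent a (real n) (s * c l) \<and> levy_exponent a (real n) (s * c l) \<le> real n"
    if "0 < n" "0 < s" "l < k" for n s l
    using pareto_laplace(2)[of a "real n" "s * c l"] that a a0 c by (simp add: levy_exponent_def)
  have stab: "stable_moment a b k c = (\<integral>\<^sup>+s. ?h s \<partial>lborel)"
    unfolding stable_moment_def A_def[symmetric] using a0 b A by (intro nn_integral_power_exp[symmetric])
  have pm: "power_const 1 b * pareto_moment a b n k c = (\<integral>\<^sup>+s. ?g n s \<partial>lborel)" if "0 < n" for n
    unfolding e_def using a a0 b c that by (intro pareto_moment_eq) auto
  have bound: "?g n s \<le> 2 * ?h s" if n: "0 < n" for n s
  proof (cases "0 < s")
    case s: True
    have l: "0 \<le> (1 - levy_exponent a (real n) (s * c l) / real n) ^ n"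
       "(1 - levy_exponent a (real n) (s * c l) / real n) ^ n \<le> 1" if "l < k" for l
      using lev[OF n s that] n by (auto intro!: zero_le_power power_le_one)
    have "1 - e n s \<le> (\<Sum>l<k. 1 - (1 - levy_exponent a (real n) (s * c l) / real n) ^ n)"
      unfolding e_def using l by (intro one_minus_prod_le_sum) auto
    also have "\<dots> \<le> (\<Sum>l<k. levy_const a * (s * c l) powr a)"
    proof (intro sum_mono)
      fix l assume "l \<in> {..<k}"
      then have l: "l < k" by simp
      have "1 + real n * (- (levy_exponent a (real n) (s * c l) / real n)) \<le> (1 + (- (levy_exponent a (real n) (s * c l) / real n))) ^ n"
        using lev[OF n s l] n by (intro Bernoulli_inequality) auto
      then have "1 - (1 - levy_exponent a (real n) (s * c l) / real n) ^ n \<le> levy_exponent a (real n) (s * c l)"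
        using n by simp
      also have "\<dots> \<le> levy_const a * (s * c l) powr a"
        using a a0 n s c[OF l] by (intro ennreal_levy_exponent) auto
      finally show "1 - (1 - levy_exponent a (real n) (s * c l) / real n) ^ n \<le> levy_const a * (s * c l) powr a" .
    qed
    also have "\<dots> = A * s powr a" by (rule As[OF s])
    finally have "1 - e n s \<le> A * s powr a" .
    moreover have "0 \<le> e n s" unfolding e_def using l by (intro prod_nonneg) auto
    ultimately have "1 - e n s \<le> 2 * (1 - exp (- (A * s powr a)))"
      using A by (intro le_two_one_minus_exp) auto
    then have "(1 - e n s) * ?w s \<le> 2 * ((1 - exp (- (A * s powr a))) * ?w s)"
      unfolding mult.assoc[symmetric] by (rule mult_right_mono) simp
    then have "ennreal ((1 - e n s) * ?w s) \<le> ennreal (2 * ((1 - exp (- (A * s powr a))) * ?w s))"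
      by (rule ennreal_leI)
    then show ?thesis using s A by (simp add: ennreal_mult)
  qed simp
  then show "power_const 1 b * pareto_moment a b n k c \<le> 2 * stable_moment a b k c" if "0 < n"
    using that unfolding pm[OF that] stab
    by (subst nn_integral_cmult[symmetric]) (auto intro!: nn_integral_mono)
  have "(\<lambda>n. \<integral>\<^sup>+s. ?g (Suc n) s \<partial>lborel) \<longlonglongrightarrow> (\<integral>\<^sup>+s. ?h s \<partial>lborel)"
  proof (rule nn_integral_dominated_convergence)
    show "AE s in lborel. ?g (Suc n) s \<le> 2 * ?h s" for n
      using bound by (intro AE_I2) simp
    have "(\<integral>\<^sup>+s. ?h s \<partial>lborel) < \<infinity>"
      unfolding stab[symmetric] stable_moment_def using power_const_finite[of b a] b
      by (simp add: ennreal_mult_less_top)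
    then show "(\<integral>\<^sup>+s. 2 * ?h s \<partial>lborel) < \<infinity>"
      by (subst nn_integral_cmult) (auto simp: ennreal_mult_less_top)
    show "AE s in lborel. (\<lambda>n. ?g (Suc n) s) \<longlonglongrightarrow> ?h s"
    proof (rule AE_I2)
      fix s :: real
      show "(\<lambda>n. ?g (Suc n) s) \<longlonglongrightarrow> ?h s"
      proof (cases "0 < s")
        case s: True
        have "(\<lambda>n. e n s) \<longlonglongrightarrow> (\<Prod>l<k. exp (- (levy_const a * (s * c l) powr a)))"
          unfolding e_def
        proof (intro tendsto_prod one_minus_div_power_tendsto)
          fix l assume l: "l \<in> {..<k}"
          then have "0 \<le> s * c l" using s c by simp
          then show "(\<lambda>n. levy_exponent a (real n) (s * c l)) \<longlonglongrightarrow> levy_const a * (s * c l) powr a"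
            using a a0 by (intro levy_exponent_tendsto) auto
        qed (use lev s levy_const_pos[of a] a a0 in auto)
        also have "(\<Prod>l<k. exp (- (levy_const a * (s * c l) powr a))) = exp (- (A * s powr a))"
          by (simp add: exp_sum[symmetric] sum_negf As[OF s])
        finally have "(\<lambda>n. e (Suc n) s) \<longlonglongrightarrow> exp (- (A * s powr a))" by (rule LIMSEQ_Suc)
        then have "(\<lambda>n. ennreal ((1 - e (Suc n) s) * ?w s)) \<longlonglongrightarrow> ennreal ((1 - exp (- (A * s powr a))) * ?w s)"
          by (intro tendsto_ennrealI tendsto_intros)
        then show ?thesis using s by simp
      qed simp
    qed
  qed measurable
  then have "(\<lambda>n. power_const 1 b * pareto_moment a b (Suc n) k c) \<longlonglongrightarrow> stable_moment a b k c"
    by (simp add: pm stab)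
  then show "(\<lambda>n. power_const 1 b * pareto_moment a b n k c) \<longlonglongrightarrow> stable_moment a b k c"
    by (rule LIMSEQ_imp_Suc)
qed

section \<open>Domination of powers of sequence norms by powers of linear forms\<close>

text \<open>
  Two measures carrying maps into the scalar \<open>k\<close>-tuples such that, for powers of moduli of linear forms,
  the first is dominated by \<open>A\<close> times the second. The measures may be of different nature: in the
  application the first is a counting measure and the second a product of stable measures.
\<close>

locale linear_form_domination = P: sigma_finite_measure P + Q: sigma_finite_measure Q
  for P :: "'a measure" and Q :: "'b measure" +
  fixes k :: nat and p :: real and A :: ennreal
    and u :: "'a \<Rightarrow> nat \<Rightarrow> 'k::real_or_complex" and v :: "'b \<Rightarrow> nat \<Rightarrow> 'k"
  assumes p_pos: "0 < p" and A_finite: "A < \<infinity>"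
    and u_measurable [measurable]: "\<And>l. (\<lambda>x. u x l) \<in> borel_measurable P"
    and v_measurable [measurable]: "\<And>l. (\<lambda>x. v x l) \<in> borel_measurable Q"
    and linear_forms: "\<And>w. (\<integral>\<^sup>+x. ennreal (norm (\<Sum>l<k. w l * u x l) powr p) \<partial>P)
      \<le> A * (\<integral>\<^sup>+x. ennreal (norm (\<Sum>l<k. w l * v x l) powr p) \<partial>Q)"
begin

lemma lq_domination_same:
  "(\<integral>\<^sup>+x. ennreal (\<Sum>l<k. norm (u x l) powr p) \<partial>P) \<le> A * (\<integral>\<^sup>+x. ennreal (\<Sum>l<k. norm (v x l) powr p) \<partial>Q)"
proof -
  have coord: "(\<Sum>l'<k. (if l' = l then 1 else 0) * y l') = y l" if "l < k" for l and y :: "nat \<Rightarrow> 'k"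
    using that by (simp add: if_distrib[of "\<lambda>c. c * _"] cong: if_cong)
  have "(\<integral>\<^sup>+x. ennreal (\<Sum>l<k. norm (u x l) powr p) \<partial>P) = (\<Sum>l<k. \<integral>\<^sup>+x. ennreal (norm (u x l) powr p) \<partial>P)"
    by (subst nn_integral_sum[symmetric]) simp_all
  also have "\<dots> \<le> (\<Sum>l<k. A * (\<integral>\<^sup>+x. ennreal (norm (v x l) powr p) \<partial>Q))"
  proof (intro sum_mono)
    fix l assume "l \<in> {..<k}"
    then have "l < k" by simp
    then show "(\<integral>\<^sup>+x. ennreal (norm (u x l) powr p) \<partial>P) \<le> A * (\<integral>\<^sup>+x. ennreal (norm (v x l) powr p) \<partial>Q)"
      using linear_forms[of "\<lambda>l'. if l' = l then 1 else 0"] by (simp only: coord)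
  qed
  also have "\<dots> = A * (\<integral>\<^sup>+x. ennreal (\<Sum>l<k. norm (v x l) powr p) \<partial>Q)"
    by (subst sum_distrib_left[symmetric], subst nn_integral_sum[symmetric]) simp_all
  finally show ?thesis .
qed

text \<open>
  A Gaussian combination with variances \<open>\<tau>\<^sub>l |y\<^sub>l|^2\<close> has \<open>p\<close>-th moment proportional to
  \<open>(\<Sum>\<^sub>l \<tau>\<^sub>l |y\<^sub>l|^2)^(p/2)\<close>, which is thus an average of powers of linear forms.
\<close>

lemma weighted_square_domination:
  assumes \<tau>: "\<And>l. l < k \<Longrightarrow> 0 \<le> \<tau> l"
  shows "(\<integral>\<^sup>+x. ennreal ((\<Sum>l<k. \<tau> l * (norm (u x l))\<^sup>2) powr (p / 2)) \<partial>P)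
    \<le> A * (\<integral>\<^sup>+x. ennreal ((\<Sum>l<k. \<tau> l * (norm (v x l))\<^sup>2) powr (p / 2)) \<partial>Q)"
proof -
  let ?G = "PiM {..<k} (\<lambda>_. standard_gaussian :: 'k measure)"
  interpret G: prob_space ?G by (intro prob_space_PiM gaussian.prob_space_axioms)
  interpret PG: pair_sigma_finite P ?G ..
  interpret QG: pair_sigma_finite Q ?G ..
  define c where "c = (\<integral>\<^sup>+z. ennreal (norm (z::'k) powr p) \<partial>standard_gaussian)"
  have c: "c \<noteq> 0" "c \<noteq> \<infinity>"
    using gaussian.moment_pos[where 'k='k, of p] gaussian_moment_finite[OF p_pos, where 'k='k]
    by (auto simp: c_def)
  have avg: "c * ennreal ((\<Sum>l<k. \<tau> l * (norm (y l))\<^sup>2) powr (p / 2)) =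
    (\<integral>\<^sup>+g. ennreal (norm (\<Sum>l<k. (of_real (sqrt (\<tau> l)) * g l) * y l) powr p) \<partial>?G)" for y :: "nat \<Rightarrow> 'k"
  proof -
    have "(\<Sum>l<k. norm (of_real (sqrt (\<tau> l)) * y l) powr 2) = (\<Sum>l<k. \<tau> l * (norm (y l))\<^sup>2)"
      using \<tau> by (intro sum.cong) (auto simp: norm_mult power_mult_distrib)
    then show ?thesis
      using gaussian.moment_sum[OF finite_lessThan p_pos, of k "\<lambda>l. of_real (sqrt (\<tau> l)) * y l"]
      by (simp add: c_def mult_ac)
  qed
  have "c * (\<integral>\<^sup>+x. ennreal ((\<Sum>l<k. \<tau> l * (norm (u x l))\<^sup>2) powr (p / 2)) \<partial>P)
    = (\<integral>\<^sup>+x. (\<integral>\<^sup>+g. ennreal (norm (\<Sum>l<k. (of_real (sqrt (\<tau> l)) * g l) * u x l) powr p) \<partial>?G) \<partial>P)"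
    by (simp only: avg[symmetric]) (rule nn_integral_cmult[symmetric], measurable)
  also have "\<dots> = (\<integral>\<^sup>+g. (\<integral>\<^sup>+x. ennreal (norm (\<Sum>l<k. (of_real (sqrt (\<tau> l)) * g l) * u x l) powr p) \<partial>P) \<partial>?G)"
    by (rule PG.Fubini'[symmetric]) measurable
  also have "\<dots> \<le> (\<integral>\<^sup>+g. A * (\<integral>\<^sup>+x. ennreal (norm (\<Sum>l<k. (of_real (sqrt (\<tau> l)) * g l) * v x l) powr p) \<partial>Q) \<partial>?G)"
    by (intro nn_integral_mono linear_forms)
  also have "\<dots> = A * (\<integral>\<^sup>+g. (\<integral>\<^sup>+x. ennreal (norm (\<Sum>l<k. (of_real (sqrt (\<tau> l)) * g l) * v x l) powr p) \<partial>Q) \<partial>?G)"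
    by (rule nn_integral_cmult) measurable
  also have "(\<integral>\<^sup>+g. (\<integral>\<^sup>+x. ennreal (norm (\<Sum>l<k. (of_real (sqrt (\<tau> l)) * g l) * v x l) powr p) \<partial>Q) \<partial>?G)
    = (\<integral>\<^sup>+x. (\<integral>\<^sup>+g. ennreal (norm (\<Sum>l<k. (of_real (sqrt (\<tau> l)) * g l) * v x l) powr p) \<partial>?G) \<partial>Q)"
    by (rule QG.Fubini') measurable
  also have "\<dots> = c * (\<integral>\<^sup>+x. ennreal ((\<Sum>l<k. \<tau> l * (norm (v x l))\<^sup>2) powr (p / 2)) \<partial>Q)"
    by (simp only: avg[symmetric]) (rule nn_integral_cmult, measurable)
  finally have "c * (\<integral>\<^sup>+x. ennreal ((\<Sum>l<k. \<tau> l * (norm (u x l))\<^sup>2) powr (p / 2)) \<partial>P)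
    \<le> c * (A * (\<integral>\<^sup>+x. ennreal ((\<Sum>l<k. \<tau> l * (norm (v x l))\<^sup>2) powr (p / 2)) \<partial>Q))"
    by (simp add: mult_ac)
  then show ?thesis using c by (simp add: ennreal_mult_le_mult_iff)
qed

text \<open>
  Averaging over the weights \<open>\<tau>\<^sub>l\<close>, taken to be independent sums of Pareto variables, preserves domination.
\<close>

lemma pareto_moment_domination:
  assumes a: "0 < a" "a < 1" and n: "0 < n"
  shows "(\<integral>\<^sup>+x. pareto_moment a (p / 2) n k (\<lambda>l. (norm (u x l))\<^sup>2) \<partial>P)
    \<le> A * (\<integral>\<^sup>+x. pareto_moment a (p / 2) n k (\<lambda>l. (norm (v x l))\<^sup>2) \<partial>Q)"
proof -
  interpret pareto: prob_space "pareto a (real n)" using a n by (intro prob_space_pareto) auto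
  let ?R = "PiM ({..<k} \<times> {..<n}) (\<lambda>_. pareto a (real n))"
  interpret R: prob_space ?R by (intro prob_space_PiM pareto.prob_space_axioms)
  interpret PR: pair_sigma_finite P ?R ..
  interpret QR: pair_sigma_finite Q ?R ..
  let ?f = "\<lambda>t y. ennreal ((\<Sum>l<k. (\<Sum>i<n. \<bar>t (l, i)\<bar>) * (norm (y l :: 'k))\<^sup>2) powr (p / 2))"
  have "(\<integral>\<^sup>+x. (\<integral>\<^sup>+t. ?f t (u x) \<partial>?R) \<partial>P) = (\<integral>\<^sup>+t. (\<integral>\<^sup>+x. ?f t (u x) \<partial>P) \<partial>?R)"
    by (rule PR.Fubini'[symmetric]) measurable
  also have "\<dots> \<le> (\<integral>\<^sup>+t. A * (\<integral>\<^sup>+x. ?f t (v x) \<partial>Q) \<partial>?R)"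
    by (intro nn_integral_mono weighted_square_domination sum_nonneg) simp
  also have "\<dots> = A * (\<integral>\<^sup>+t. (\<integral>\<^sup>+x. ?f t (v x) \<partial>Q) \<partial>?R)"
    by (rule nn_integral_cmult) measurable
  also have "(\<integral>\<^sup>+t. (\<integral>\<^sup>+x. ?f t (v x) \<partial>Q) \<partial>?R) = (\<integral>\<^sup>+x. (\<integral>\<^sup>+t. ?f t (v x) \<partial>?R) \<partial>Q)"
    by (rule QR.Fubini') measurable
  finally show ?thesis by (simp add: pareto_moment_def)
qed

text \<open>
  With \<open>a = q/2\<close>, \<open>b = p/2\<close> and \<open>c\<^sub>l = |y\<^sub>l|^2\<close>, the limit of the Pareto moments is a multiple of
  \<open>(\<Sum>\<^sub>l |y\<^sub>l|^q)^(p/q)\<close>. Fatou's lemma passes to the limit on the dominated side, the uniform bound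
  on the dominating side.
\<close>

lemma lq_domination_stable:
  assumes q: "p < q" "q < 2"
    and fin: "(\<integral>\<^sup>+x. ennreal ((\<Sum>l<k. norm (v x l) powr q) powr (p / q)) \<partial>Q) < \<infinity>"
  shows "(\<integral>\<^sup>+x. ennreal ((\<Sum>l<k. norm (u x l) powr q) powr (p / q)) \<partial>P)
    \<le> A * (\<integral>\<^sup>+x. ennreal ((\<Sum>l<k. norm (v x l) powr q) powr (p / q)) \<partial>Q)"
proof -
  let ?a = "q / 2" and ?b = "p / 2"
  have ab: "0 < ?a" "?a < 1" "0 < ?b" "?b < ?a" using p_pos q by auto
  define C where "C = ennreal (levy_const ?a powr (p / q)) * power_const ?a ?b"
  have C: "C \<noteq> 0" "C \<noteq> \<infinity>"
    using levy_const_pos[OF ab(1,2)] power_const_pos[of ?a ?b] power_const_finite[OF ab(3,4)] ab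
    by (auto simp: C_def ennreal_mult_eq_top_iff)
  let ?F = "\<lambda>n y. power_const 1 ?b * pareto_moment ?a ?b (Suc n) k (\<lambda>l. (norm (y l :: 'k))\<^sup>2)"
  let ?G = "\<lambda>y. C * ennreal ((\<Sum>l<k. norm (y l :: 'k) powr q) powr (p / q))"
  have G: "stable_moment ?a ?b k (\<lambda>l. (norm (y l))\<^sup>2) = ?G y" for y :: "nat \<Rightarrow> 'k"
  proof -
    have "((norm (y l))\<^sup>2) powr ?a = norm (y l) powr q" for l
    proof (cases "y l = 0")
      case False
      then have "(norm (y l))\<^sup>2 = norm (y l) powr 2" by simp
      then show ?thesis by (simp only: powr_powr) simp
    qed simp
    moreover have "0 \<le> (\<Sum>l<k. norm (y l) powr q)" by (intro sum_nonneg) simp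
    ultimately show ?thesis
      using levy_const_pos[OF ab(1,2)]
      by (simp add: stable_moment_def C_def powr_mult ennreal_mult mult_ac)
  qed
  have lim: "(\<lambda>n. ?F n y) \<longlonglongrightarrow> ?G y" for y :: "nat \<Rightarrow> 'k"
    unfolding G[symmetric] using ab by (intro LIMSEQ_Suc pareto_moment_limit) auto
  have le: "?F n y \<le> 2 * ?G y" for n and y :: "nat \<Rightarrow> 'k"
    unfolding G[symmetric] using ab by (intro pareto_moment_limit) auto
  have prob: "sigma_finite_measure (PiM ({..<k} \<times> {..<Suc n}) (\<lambda>_. pareto ?a (real (Suc n))))" for n
    by (intro prob_space_imp_sigma_finite prob_space_PiM prob_space_pareto) (use ab in auto)
  have [measurable]: "(\<lambda>x. ?F n (u x)) \<in> borel_measurable P" "(\<lambda>x. ?F n (v x)) \<in> borel_measurable Q" for n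
  proof -
    interpret sigma_finite_measure "PiM ({..<k} \<times> {..<Suc n}) (\<lambda>_. pareto ?a (real (Suc n)))" by (rule prob)
    show "(\<lambda>x. ?F n (u x)) \<in> borel_measurable P" "(\<lambda>x. ?F n (v x)) \<in> borel_measurable Q"
      unfolding pareto_moment_def by measurable
  qed
  have "(\<integral>\<^sup>+x. ?G (u x) \<partial>P) = (\<integral>\<^sup>+x. liminf (\<lambda>n. ?F n (u x)) \<partial>P)"
    using lim_imp_Liminf[OF sequentially_bot lim] by (intro nn_integral_cong) simp
  also have "\<dots> \<le> liminf (\<lambda>n. \<integral>\<^sup>+x. ?F n (u x) \<partial>P)"
    by (rule nn_integral_liminf) measurable
  also have "\<dots> \<le> liminf (\<lambda>n. A * (\<integral>\<^sup>+x. ?F n (v x) \<partial>Q))"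
  proof (intro Liminf_mono always_eventually allI)
    fix n
    interpret sigma_finite_measure "PiM ({..<k} \<times> {..<Suc n}) (\<lambda>_. pareto ?a (real (Suc n)))" by (rule prob)
    have "(\<integral>\<^sup>+x. ?F n (u x) \<partial>P) = power_const 1 ?b * (\<integral>\<^sup>+x. pareto_moment ?a ?b (Suc n) k (\<lambda>l. (norm (u x l))\<^sup>2) \<partial>P)"
      unfolding pareto_moment_def by (rule nn_integral_cmult) measurable
    also have "\<dots> \<le> power_const 1 ?b * (A * (\<integral>\<^sup>+x. pareto_moment ?a ?b (Suc n) k (\<lambda>l. (norm (v x l))\<^sup>2) \<partial>Q))"
      using ab by (intro mult_left_mono pareto_moment_domination) auto
    also have "\<dots> = A * (power_const 1 ?b * (\<integral>\<^sup>+x. pareto_moment ?a ?b (Suc n) k (\<lambda>l. (norm (v x l))\<^sup>2) \<partial>Q))"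
      by (simp only: mult_ac)
    also have "power_const 1 ?b * (\<integral>\<^sup>+x. pareto_moment ?a ?b (Suc n) k (\<lambda>l. (norm (v x l))\<^sup>2) \<partial>Q) = (\<integral>\<^sup>+x. ?F n (v x) \<partial>Q)"
      unfolding pareto_moment_def by (rule nn_integral_cmult[symmetric]) measurable
    finally show "(\<integral>\<^sup>+x. ?F n (u x) \<partial>P) \<le> A * (\<integral>\<^sup>+x. ?F n (v x) \<partial>Q)" .
  qed
  also have "\<dots> = A * (\<integral>\<^sup>+x. ?G (v x) \<partial>Q)"
  proof (rule lim_imp_Liminf)
    have "(\<lambda>n. \<integral>\<^sup>+x. ?F n (v x) \<partial>Q) \<longlonglongrightarrow> (\<integral>\<^sup>+x. ?G (v x) \<partial>Q)"
    proof (rule nn_integral_dominated_convergence)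
      show "(\<integral>\<^sup>+x. 2 * ?G (v x) \<partial>Q) < \<infinity>"
        using fin C by (simp add: nn_integral_cmult ennreal_mult_eq_top_iff less_top[symmetric])
    qed (use lim le in auto)
    then show "(\<lambda>n. A * (\<integral>\<^sup>+x. ?F n (v x) \<partial>Q)) \<longlonglongrightarrow> A * (\<integral>\<^sup>+x. ?G (v x) \<partial>Q)"
      using A_finite by (intro ennreal_tendsto_cmult) auto
  qed simp
  finally have "C * (\<integral>\<^sup>+x. ennreal ((\<Sum>l<k. norm (u x l) powr q) powr (p / q)) \<partial>P)
    \<le> C * (A * (\<integral>\<^sup>+x. ennreal ((\<Sum>l<k. norm (v x l) powr q) powr (p / q)) \<partial>Q))"
    by (simp add: nn_integral_cmult mult_ac)
  then show ?thesis using C by (simp add: ennreal_mult_le_mult_iff)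
qed

lemma lq_domination:
  assumes q: "q = 2 \<or> p = q \<or> p < q \<and> q < 2"
    and fin: "(\<integral>\<^sup>+x. ennreal ((\<Sum>l<k. norm (v x l) powr q) powr (p / q)) \<partial>Q) < \<infinity>"
  shows "(\<integral>\<^sup>+x. ennreal ((\<Sum>l<k. norm (u x l) powr q) powr (p / q)) \<partial>P)
    \<le> A * (\<integral>\<^sup>+x. ennreal ((\<Sum>l<k. norm (v x l) powr q) powr (p / q)) \<partial>Q)"
  using q
proof (elim disjE)
  assume "q = 2"
  then show ?thesis using weighted_square_domination[of "\<lambda>_. 1"] by simp
next
  assume "p = q"
  then show ?thesis using lq_domination_same p_pos by (simp add: sum_nonneg)
next
  assume "p < q \<and> q < 2"
  then show ?thesis using lq_domination_stable fin by blast
qed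

end

section \<open>Multilinear maps on tuples\<close>

lemma sum_PiE_insert:
  assumes "k \<notin> I"
  shows "(\<Sum>j\<in>PiE (insert k I) F. f j) = (\<Sum>a\<in>F k. \<Sum>j\<in>PiE I F. f (j(k := a)))"
proof -
  have "(\<Sum>j\<in>PiE (insert k I) F. f j) = (\<Sum>(a, j)\<in>F k \<times> PiE I F. f (j(k := a)))"
    unfolding PiE_insert_eq
    by (subst sum.reindex[OF inj_combinator[OF assms]]) (simp add: case_prod_unfold)
  then show ?thesis by (simp add: sum.cartesian_product)
qed

lemma vector_space_mult: "vector_space ((*) :: 'k::field \<Rightarrow> 'k \<Rightarrow> 'k)"
  by unfold_locales (simp_all add: algebra_simps)

lemma linear_functionalI:
  fixes f :: "'k::field ^ 'n \<Rightarrow> 'k"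
  assumes "\<And>x y. f (x + y) = f x + f y" and "\<And>c x. f (c *s x) = c * f x"
  shows "Vector_Spaces.linear (*s) (*) f"
  using assms
  by (intro Vector_Spaces.linear.intro module_hom.intro module_hom_axioms.intro
      vector_space_mult vec.vector_space_axioms module_iff_vector_space[THEN iffD2])

lemma linear_cart_expansion:
  assumes "Vector_Spaces.linear (*s) sX f"
  shows "f (x :: 'k::field ^ 'n) = (\<Sum>i\<in>UNIV. sX (x $ i) (f (axis i 1)))"
proof -
  interpret f: Vector_Spaces.linear "(*s)" sX f by (rule assms)
  have "f x = f (\<Sum>i\<in>UNIV. (x $ i) *s axis i 1)" by (simp add: basis_expansion)
  also have "\<dots> = (\<Sum>i\<in>UNIV. sX (x $ i) (f (axis i 1)))" by (simp only: f.sum f.scale)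
  finally show ?thesis .
qed

text \<open>
  Expanding only the variables in \<open>I\<close> is what allows induction on the set of expanded variables.
\<close>

lemma multilinear_partial_expansion:
  fixes T :: "('m \<Rightarrow> 'k::real_or_complex ^ 'n) \<Rightarrow> 'x::ab_group_add"
  assumes T: "multilinear (*s) sX T" and sX: "vector_space sX" and I: "finite I"
  shows "T z = (\<Sum>i\<in>PiE I (\<lambda>_. UNIV).
    sX (\<Prod>k\<in>I. z k $ i k) (T (\<lambda>k. if k \<in> I then axis (i k) 1 else z k)))"
  using I
proof (induction I)
  case empty
  interpret vector_space sX by (rule sX)
  show ?case by simp
next
  case (insert k I)
  interpret vector_space sX by (rule sX)
  have "T z = (\<Sum>i\<in>PiE I (\<lambda>_. UNIV).
    sX (\<Prod>k\<in>I. z k $ i k) (T (\<lambda>k. if k \<in> I then axis (i k) 1 else z k)))" by (rule insert.IH)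
  also have "\<dots> = (\<Sum>i\<in>PiE I (\<lambda>_. UNIV). \<Sum>a\<in>UNIV.
    sX (\<Prod>k'\<in>insert k I. z k' $ (i(k := a)) k') (T (\<lambda>k'. if k' \<in> insert k I then axis ((i(k := a)) k') 1 else z k')))"
  proof (intro sum.cong refl)
    fix i :: "'m \<Rightarrow> 'n"
    let ?y = "\<lambda>k. if k \<in> I then axis (i k) 1 else z k"
    have "T ?y = T (?y(k := z k))" using insert.hyps by (intro arg_cong[where f=T]) auto
    also have "\<dots> = (\<Sum>a\<in>UNIV. sX (z k $ a) (T (?y(k := axis a 1))))"
      using T unfolding multilinear_def by (intro linear_cart_expansion) blast
    finally have "sX (\<Prod>k\<in>I. z k $ i k) (T ?y) = (\<Sum>a\<in>UNIV. sX ((\<Prod>k\<in>I. z k $ i k) * z k $ a) (T (?y(k := axis a 1))))"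
      by (simp add: scale_sum_right)
    also have "\<dots> = (\<Sum>a\<in>UNIV. sX (\<Prod>k'\<in>insert k I. z k' $ (i(k := a)) k')
        (T (\<lambda>k'. if k' \<in> insert k I then axis ((i(k := a)) k') 1 else z k')))"
    proof (intro sum.cong refl arg_cong2[where f=sX] arg_cong[where f=T])
      fix a :: 'n
      have "(\<Prod>k'\<in>I. z k' $ (i(k := a)) k') = (\<Prod>k\<in>I. z k $ i k)"
        using insert.hyps by (intro prod.cong) auto
      then show "(\<Prod>k\<in>I. z k $ i k) * z k $ a = (\<Prod>k'\<in>insert k I. z k' $ (i(k := a)) k')"
        using insert.hyps by (simp add: mult.commute)
      show "?y(k := axis a 1) = (\<lambda>k'. if k' \<in> insert k I then axis ((i(k := a)) k') 1 else z k')"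
        using insert.hyps by auto
    qed
    finally show "sX (\<Prod>k\<in>I. z k $ i k) (T ?y) = (\<Sum>a\<in>UNIV. sX (\<Prod>k'\<in>insert k I. z k' $ (i(k := a)) k')
        (T (\<lambda>k'. if k' \<in> insert k I then axis ((i(k := a)) k') 1 else z k')))" .
  qed
  also have "\<dots> = (\<Sum>i\<in>PiE (insert k I) (\<lambda>_. UNIV). sX (\<Prod>k'\<in>insert k I. z k' $ i k')
      (T (\<lambda>k'. if k' \<in> insert k I then axis (i k') 1 else z k')))"
    using insert.hyps by (subst sum_PiE_insert) (simp_all add: sum.swap[of _ UNIV])
  finally show ?case .
qed

lemma multilinear_expansion:
  fixes T :: "('m::finite \<Rightarrow> 'k::real_or_complex ^ 'n) \<Rightarrow> 'x::ab_group_add"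
  assumes "multilinear (*s) sX T" "vector_space sX"
  shows "T z = (\<Sum>i\<in>UNIV. sX (\<Prod>k\<in>UNIV. z k $ i k) (T (\<lambda>k. axis (i k) 1)))"
  using multilinear_partial_expansion[OF assms finite_class.finite_UNIV, of z] by simp

lemma multilinear_functional_measurable:
  fixes \<phi> :: "('m::finite \<Rightarrow> 'k::real_or_complex ^ 'n) \<Rightarrow> 'k"
  assumes "multilinear (*s) (*) \<phi>"
  shows "\<phi> \<in> borel_measurable (PiM UNIV (\<lambda>_. borel))"
proof -
  have [measurable]: "(\<lambda>z :: 'm \<Rightarrow> 'k ^ 'n. z k $ a) \<in> borel_measurable (PiM UNIV (\<lambda>_. borel))" for k :: 'm and a :: 'n
  proof -
    have "(\<lambda>v::'k^'n. v $ a) \<in> borel_measurable borel"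
      by (intro borel_measurable_continuous_onI continuous_intros)
    from measurable_compose[OF measurable_component_singleton[where i = k and I = UNIV and M = "\<lambda>_. borel"] this] show ?thesis by simp
  qed
  have "(\<lambda>z. \<Sum>i\<in>UNIV. (\<Prod>k\<in>UNIV. z k $ i k) * \<phi> (\<lambda>k. axis (i k) 1)) \<in> borel_measurable (PiM UNIV (\<lambda>_. borel))"
    by measurable
  then show ?thesis
    by (subst measurable_cong[OF multilinear_expansion[OF assms vector_space_mult]])
qed

text \<open>
  The variables in \<open>I\<close> are summed on the left and integrated on the right while the others stay
  fixed; enlarging \<open>I\<close> by one index uses the domination for the functional in that variable.
\<close>

lemma multilinear_domination:
  fixes \<phi> :: "('m::finite \<Rightarrow> 'k::real_or_complex ^ 'n) \<Rightarrow> 'k" and \<nu> :: "('k ^ 'n) measure"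
    and x :: "'m \<Rightarrow> nat \<Rightarrow> 'k ^ 'n"
  assumes \<phi>: "multilinear (*s) (*) \<phi>"
    and \<nu>: "sigma_finite_measure \<nu>" and sets: "sets \<nu> = sets borel"
    and dom: "\<And>k \<gamma>. Vector_Spaces.linear (*s) (*) \<gamma> \<Longrightarrow>
      (\<Sum>j<J k. ennreal (norm (\<gamma> (x k j)) powr p)) \<le> A k * (\<integral>\<^sup>+z. ennreal (norm (\<gamma> z) powr p) \<partial>\<nu>)"
  shows "(\<Sum>j\<in>PiE UNIV (\<lambda>k. {..<J k}). ennreal (norm (\<phi> (\<lambda>k. x k (j k))) powr p))
    \<le> (\<Prod>k\<in>UNIV. A k) * (\<integral>\<^sup>+z. ennreal (norm (\<phi> z) powr p) \<partial>PiM UNIV (\<lambda>_. \<nu>))"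
proof -
  interpret \<nu>: sigma_finite_measure \<nu> by (rule \<nu>)
  interpret product_sigma_finite "\<lambda>_::'m. \<nu>" ..
  note [measurable_cong] = sets
  \<comment> \<open>The tuple with the variables in \<open>I\<close> taken from \<open>z\<close> and the others from \<open>y\<close>.\<close>
  define mix where "mix I y z = (\<lambda>k. if k \<in> I then z k else y k)" for I :: "'m set" and y z :: "'m \<Rightarrow> 'k ^ 'n"
  define g where "g z = ennreal (norm (\<phi> z) powr p)" for z
  have g_meas: "g \<in> borel_measurable (PiM UNIV (\<lambda>_. \<nu>))"
  proof -
    have [measurable]: "\<phi> \<in> borel_measurable (PiM UNIV (\<lambda>_. borel))"
      by (rule multilinear_functional_measurable[OF \<phi>])
    have "g \<in> borel_measurable (PiM UNIV (\<lambda>_. borel))" unfolding g_def by measurable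
    moreover have "sets (PiM UNIV (\<lambda>_. \<nu>)) = sets (PiM UNIV (\<lambda>_::'m. borel))"
      by (intro sets_PiM_cong refl sets)
    ultimately show ?thesis using measurable_cong_sets by blast
  qed
  have mix_meas: "mix I y \<in> measurable (PiM I (\<lambda>_. \<nu>)) (PiM UNIV (\<lambda>_. \<nu>))" for I y
  proof (rule measurable_PiM_single')
    have "space \<nu> = UNIV" using sets_eq_imp_space_eq[OF sets] by simp
    then show "(\<lambda>z k. mix I y z k) \<in> space (PiM I (\<lambda>_. \<nu>)) \<rightarrow> (\<Pi>\<^sub>E k\<in>UNIV. space \<nu>)" by auto
    show "(\<lambda>z. mix I y z k) \<in> measurable (PiM I (\<lambda>_. \<nu>)) \<nu>" for k
      by (cases "k \<in> I") (auto simp: mix_def \<open>space \<nu> = UNIV\<close>)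
  qed
  have gm: "(\<lambda>z. g (mix I y z)) \<in> borel_measurable (PiM I (\<lambda>_. \<nu>))" for I y
    by (rule measurable_compose[OF mix_meas g_meas])
  have "(\<Sum>j\<in>PiE I (\<lambda>k. {..<J k}). g (mix I y (\<lambda>k. x k (j k))))
      \<le> (\<Prod>k\<in>I. A k) * (\<integral>\<^sup>+z. g (mix I y z) \<partial>PiM I (\<lambda>_. \<nu>))" if "finite I" for I y
    using that
  proof (induction I arbitrary: y)
    case empty
    have "mix {} y z = y" for z by (simp add: mix_def)
    then show ?case by (simp add: nn_integral_empty PiM_empty)
  next
    case (insert k I)
    have lin: "Vector_Spaces.linear (*s) (*) (\<lambda>w. \<phi> (z(k := w)))" for z
      using \<phi> by (simp add: multilinear_def)
    have upd: "mix I (y(k := w)) z = (mix I y z)(k := w)" for w z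
      using insert.hyps by (auto simp: mix_def)
    have m2: "(\<lambda>(z, w). g ((mix I y z)(k := w))) \<in> borel_measurable (PiM I (\<lambda>_. \<nu>) \<Otimes>\<^sub>M \<nu>)"
    proof -
      have "(\<lambda>(z, w). g (mix (insert k I) y (z(k := w)))) \<in> borel_measurable (PiM I (\<lambda>_. \<nu>) \<Otimes>\<^sub>M \<nu>)"
        using measurable_compose[OF measurable_add_dim gm[of "insert k I" y]] by (simp add: case_prod_unfold)
      moreover have "mix (insert k I) y (z(k := w)) = (mix I y z)(k := w)" for z w
        using insert.hyps by (auto simp: mix_def)
      ultimately show ?thesis by simp
    qed
    have "(\<Sum>j\<in>PiE (insert k I) (\<lambda>k. {..<J k}). g (mix (insert k I) y (\<lambda>k. x k (j k))))
      = (\<Sum>a<J k. \<Sum>j\<in>PiE I (\<lambda>k. {..<J k}). g (mix I (y(k := x k a)) (\<lambda>k. x k (j k))))"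
      using insert.hyps
      by (subst sum_PiE_insert) (auto intro!: sum.cong arg_cong[where f=g] simp: mix_def)
    also have "\<dots> \<le> (\<Sum>a<J k. (\<Prod>k\<in>I. A k) * (\<integral>\<^sup>+z. g (mix I (y(k := x k a)) z) \<partial>PiM I (\<lambda>_. \<nu>)))"
      by (intro sum_mono insert.IH)
    also have "\<dots> = (\<Prod>k\<in>I. A k) * (\<integral>\<^sup>+z. (\<Sum>a<J k. g (mix I (y(k := x k a)) z)) \<partial>PiM I (\<lambda>_. \<nu>))"
      by (subst nn_integral_sum) (simp_all add: gm sum_distrib_left)
    also have "\<dots> \<le> (\<Prod>k\<in>I. A k) * (\<integral>\<^sup>+z. A k * (\<integral>\<^sup>+w. g ((mix I y z)(k := w)) \<partial>\<nu>) \<partial>PiM I (\<lambda>_. \<nu>))"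
      unfolding upd g_def by (intro mult_left_mono nn_integral_mono dom[OF lin]) auto
    also have "(\<integral>\<^sup>+z. A k * (\<integral>\<^sup>+w. g ((mix I y z)(k := w)) \<partial>\<nu>) \<partial>PiM I (\<lambda>_. \<nu>))
       = A k * (\<integral>\<^sup>+z. (\<integral>\<^sup>+w. g ((mix I y z)(k := w)) \<partial>\<nu>) \<partial>PiM I (\<lambda>_. \<nu>))"
      by (rule nn_integral_cmult) (rule \<nu>.borel_measurable_nn_integral[OF m2])
    also have "(\<integral>\<^sup>+z. (\<integral>\<^sup>+w. g ((mix I y z)(k := w)) \<partial>\<nu>) \<partial>PiM I (\<lambda>_. \<nu>))
       = (\<integral>\<^sup>+z. g (mix (insert k I) y z) \<partial>PiM (insert k I) (\<lambda>_. \<nu>))"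
      using insert.hyps
      by (subst product_nn_integral_insert[OF _ _ gm])
        (auto intro!: nn_integral_cong arg_cong[where f=g] simp: mix_def)
    finally show ?case using insert.hyps by (simp add: mult_ac)
  qed
  from this[of UNIV] show ?thesis by (simp add: mix_def g_def)
qed

section \<open>Duality of the finite-dimensional sequence spaces\<close>

lemma conjugate_cases:
  fixes r r' :: ennreal
  assumes "1 \<le> r" "1 / r + 1 / r' = 1" "r' < \<infinity>"
  obtains "r = \<infinity>" "r' = 1"
  | a b where "1 < a" "1 < b" "1 / a + 1 / b = 1" "r = ennreal a" "r' = ennreal b"
proof (cases "r = \<infinity>")
  case True
  then have "1 / r' = 1" using assms by simp
  then have "r' = 1" by (simp add: divide_eq_1_ennreal)
  then show ?thesis using True that by blast
next
  case False
  then obtain a where a: "r = ennreal a" "0 \<le> a" by (cases r) auto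
  obtain b where b: "r' = ennreal b" "0 \<le> b" using assms(3) by (cases r') auto
  have a1: "1 \<le> a" using assms(1) a by (simp flip: ennreal_1)
  have b0: "b \<noteq> 0" using assms(2) b by (auto simp: ennreal_divide_zero)
  have "ennreal (1 / a + 1 / b) = ennreal (1 / a) + ennreal (1 / b)" using a1 b b0 by simp
  also have "\<dots> = 1 / r + 1 / r'"
    using a b a1 b0 by (simp add: divide_ennreal[symmetric] flip: ennreal_1)
  also have "\<dots> = ennreal 1" using assms(2) by simp
  finally have e: "1 / a + 1 / b = 1" by (subst (asm) ennreal_inj) (use a1 b b0 in auto)
  moreover have "1 < a" using e a1 b b0 by (cases "a = 1") auto
  moreover have "1 < b"
  proof (rule ccontr)
    assume "\<not> 1 < b"
    then have "1 \<le> 1 / b" using b b0 by simp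
    moreover have "0 < 1 / a" using a1 by simp
    ultimately show False using e by linarith
  qed
  ultimately show ?thesis using that a b by blast
qed

lemma ell_norm_nonneg: "0 \<le> ell_norm r x"
  by (auto simp: ell_norm_def lp_norm_def Max_ge_iff)

text \<open>
  The functional is evaluated at the vector where Hoelder's inequality is an equality. There its value is
  the sum \<open>S\<close> in question, and the norm of the vector is \<open>S^(1/a)\<close> for finite \<open>r = a > 1\<close> and at most one
  for infinite \<open>r\<close>; in both cases \<open>S \<le> 1\<close> follows.
\<close>

lemma dual_ball_coordinates:
  fixes \<gamma> :: "'k::real_or_complex ^ 'n \<Rightarrow> 'k"
  assumes r: "1 \<le> r" "1 / r + 1 / r' = 1" "r' < \<infinity>" and \<gamma>: "\<gamma> \<in> dual_ball (*s) (ell_norm r)"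
  shows "(\<Sum>i\<in>UNIV. norm (\<gamma> (axis i 1)) powr enn2real r') \<le> 1"
proof -
  have lin: "Vector_Spaces.linear (*s) (*) \<gamma>" and bound: "\<And>x. norm (\<gamma> x) \<le> ell_norm r x"
    using \<gamma> by (auto simp: dual_ball_def)
  let ?c = "\<lambda>i. \<gamma> (axis i 1)" and ?s = "enn2real r'"
  let ?S = "\<Sum>i\<in>UNIV. norm (?c i) powr ?s"
  \<comment> \<open>A vanishing coordinate of \<open>\<gamma>\<close> gives a vanishing coordinate here, as division by zero is zero.\<close>
  define x :: "'k ^ 'n" where "x = (\<chi> i. of_real (norm (?c i) powr ?s) / ?c i)"
  have S: "0 \<le> ?S" by (simp add: sum_nonneg)
  have s1: "1 \<le> ?s" using conjugate_cases[OF r] by (metis enn2real_1 enn2real_ennreal less_eq_real_def not_le order.strict_trans2 zero_le_one le_less)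
  have "\<gamma> x = (\<Sum>i\<in>UNIV. (x $ i) * ?c i)" by (rule linear_cart_expansion[OF lin])
  also have "\<dots> = (\<Sum>i\<in>UNIV. of_real (norm (?c i) powr ?s))"
    using s1 by (intro sum.cong) (auto simp: x_def)
  finally have "norm (\<gamma> x) = ?S" using S by (simp flip: of_real_sum)
  then have le: "?S \<le> ell_norm r x" using bound[of x] by simp
  have nx: "norm (x $ i) = (if ?c i = 0 then 0 else norm (?c i) powr (?s - 1))" for i
    by (auto simp: x_def norm_divide powr_diff)
  show ?thesis
    using r
  proof (cases rule: conjugate_cases)
    case 1
    have "ell_norm r x \<le> 1"
    proof -
      have "norm (x $ i) \<le> 1" for i using 1 by (simp add: nx)
      then have "Max (range (\<lambda>i. norm (x $ i))) \<le> 1" by (intro Max.boundedI) auto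
      then show ?thesis using 1 by (simp add: ell_norm_def lp_norm_def)
    qed
    then show ?thesis using le by simp
  next
    case (2 a b)
    have s: "?s = b" using 2 by simp
    have "norm (x $ i) powr a = norm (?c i) powr b" for i
    proof -
      have "(b - 1) * a = b" using 2 by (simp add: field_simps)
      then show ?thesis using 2 by (simp add: nx s powr_powr)
    qed
    then have "ell_norm r x = ?S powr (1 / a)"
      using 2 by (simp add: ell_norm_def lp_norm_def s)
    then have "?S \<le> ?S powr (1 / a)" using le by simp
    show ?thesis
    proof (rule ccontr)
      assume "\<not> ?thesis"
      then have "1 < ?S" by simp
      then have "?S powr (1 / a) < ?S powr 1" using 2 by (intro powr_less_mono) auto
      then show False using \<open>?S \<le> ?S powr (1 / a)\<close> \<open>1 < ?S\<close> by simp
    qed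
  qed
qed

text \<open>
  Hoelder's inequality, from Young's inequality applied to the normalised vector.
\<close>

lemma dual_ballI_coordinates:
  fixes \<gamma> :: "'k::real_or_complex ^ 'n \<Rightarrow> 'k"
  assumes r: "1 \<le> r" "1 / r + 1 / r' = 1" "r' < \<infinity>" and lin: "Vector_Spaces.linear (*s) (*) \<gamma>"
    and S: "(\<Sum>i\<in>UNIV. norm (\<gamma> (axis i 1)) powr enn2real r') \<le> 1"
  shows "\<gamma> \<in> dual_ball (*s) (ell_norm r)"
proof -
  let ?c = "\<lambda>i. \<gamma> (axis i 1)"
  have tri: "norm (\<gamma> x) \<le> (\<Sum>i\<in>UNIV. norm (x $ i) * norm (?c i))" for x
  proof -
    have "norm (\<gamma> x) = norm (\<Sum>i\<in>UNIV. (x $ i) * ?c i)" by (simp only: linear_cart_expansion[OF lin, of x])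
    also have "\<dots> \<le> (\<Sum>i\<in>UNIV. norm ((x $ i) * ?c i))" by (rule norm_sum)
    finally show ?thesis by (simp add: norm_mult)
  qed
  have "norm (\<gamma> x) \<le> ell_norm r x" for x
    using r
  proof (cases rule: conjugate_cases)
    case 1
    have "(\<Sum>i\<in>UNIV. norm (x $ i) * norm (?c i)) \<le> (\<Sum>i\<in>UNIV. ell_norm r x * norm (?c i))"
      using 1 by (intro sum_mono mult_right_mono) (auto simp: ell_norm_def lp_norm_def)
    also have "\<dots> = ell_norm r x * (\<Sum>i\<in>UNIV. norm (?c i))" by (simp add: sum_distrib_left)
    also have "\<dots> \<le> ell_norm r x * 1"
      using S 1 by (intro mult_left_mono ell_norm_nonneg) simp
    finally show ?thesis using tri[of x] by simp
  next
    case (2 a b)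
    let ?N = "\<Sum>i\<in>UNIV. norm (x $ i) powr a"
    have N0: "0 \<le> ?N" by (simp add: sum_nonneg)
    have ell: "ell_norm r x = ?N powr (1 / a)" using 2 by (simp add: ell_norm_def lp_norm_def)
    show ?thesis
    proof (cases "?N = 0")
      case True
      then have "\<forall>i\<in>UNIV. norm (x $ i) powr a = 0" by (subst (asm) sum_nonneg_eq_0_iff) auto
      then have "x $ i = 0" for i by (simp add: powr_eq_0_iff)
      then show ?thesis using tri[of x] by (simp add: ell_norm_nonneg order_trans)
    next
      case False
      then have N: "0 < ell_norm r x" using N0 by (simp add: ell)
      have Na: "ell_norm r x powr a = ?N" unfolding ell powr_powr using N0 2 by simp
      have "(\<Sum>i\<in>UNIV. norm (x $ i) * norm (?c i)) = ell_norm r x * (\<Sum>i\<in>UNIV. (norm (x $ i) / ell_norm r x) * norm (?c i))"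
        using N by (simp add: sum_distrib_left)
      also have "\<dots> \<le> ell_norm r x * (\<Sum>i\<in>UNIV. (norm (x $ i) / ell_norm r x) powr a / a + norm (?c i) powr b / b)"
        using 2 N by (intro mult_left_mono sum_mono Youngs_inequality) auto
      also have "(\<Sum>i\<in>UNIV. (norm (x $ i) / ell_norm r x) powr a / a + norm (?c i) powr b / b)
          = (?N / ell_norm r x powr a) / a + (\<Sum>i\<in>UNIV. norm (?c i) powr b) / b"
        using N by (simp add: sum.distrib powr_divide sum_divide_distrib)
      also have "\<dots> \<le> 1 / a + 1 / b"
        using S 2 False Na by (intro add_mono divide_right_mono) auto
      also have "\<dots> = 1" using 2 by simp
      finally show ?thesis using tri[of x] N by simp
    qed
  qed
  then show ?thesis using lin by (simp add: dual_ball_def)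
qed

section \<open>Weak norms and product measures\<close>

lemma zero_in_dual_ball: "(\<lambda>_. 0) \<in> dual_ball (*s) (ell_norm r :: 'k::real_or_complex ^ 'n \<Rightarrow> real)"
  unfolding dual_ball_def
  by (auto simp: ell_norm_nonneg intro!: linear_functionalI)

lemma bdd_above_weak_norm:
  assumes "0 < p"
  shows "bdd_above ((\<lambda>\<gamma>. (\<Sum>j<J. norm (\<gamma> (x j)) powr p) powr (1 / p)) ` dual_ball sE nE)"
proof (rule bdd_aboveI2)
  fix \<gamma> assume "\<gamma> \<in> dual_ball sE nE"
  then show "(\<Sum>j<J. norm (\<gamma> (x j)) powr p) powr (1 / p) \<le> (\<Sum>j<J. nE (x j) powr p) powr (1 / p)"
    using assms by (intro powr_mono2 sum_mono sum_nonneg) (auto simp: dual_ball_def)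
qed

lemma weak_norm_nonneg:
  fixes x :: "nat \<Rightarrow> 'k::real_or_complex ^ 'n"
  assumes "0 < p"
  shows "0 \<le> weak_norm (*s) (ell_norm r) p J x"
  unfolding weak_norm_def
  by (rule cSUP_upper2[OF bdd_above_weak_norm[OF assms] zero_in_dual_ball]) simp

text \<open>
  The functional divided by its dual norm takes part in the supremum that defines the weak norm.
\<close>

lemma weak_norm_bound:
  fixes x :: "nat \<Rightarrow> 'k::real_or_complex ^ 'n"
  assumes r: "1 \<le> r" "1 / r + 1 / r' = 1" "r' < \<infinity>" and p: "0 < p" and lin: "Vector_Spaces.linear (*s) (*) \<gamma>"
  defines "s \<equiv> enn2real r'"
  shows "(\<Sum>j<J. norm (\<gamma> (x j)) powr p) \<le>
    weak_norm (*s) (ell_norm r) p J x powr p * (\<Sum>i\<in>UNIV. norm (\<gamma> (axis i 1)) powr s) powr (p / s)"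
proof -
  interpret \<gamma>: Vector_Spaces.linear "(*s)" "(*)" \<gamma> by (rule lin)
  let ?S = "\<Sum>i\<in>UNIV. norm (\<gamma> (axis i 1)) powr s" and ?w = "weak_norm (*s) (ell_norm r) p J x"
  have s0: "0 < s" using conjugate_cases[OF r] unfolding s_def
    by (metis enn2real_1 enn2real_ennreal less_le_not_le linorder_linear order.strict_trans zero_less_one)
  have S0: "0 \<le> ?S" by (simp add: sum_nonneg)
  show ?thesis
  proof (cases "?S = 0")
    case True
    then have "\<forall>i\<in>UNIV. norm (\<gamma> (axis i 1)) powr s = 0" by (subst (asm) sum_nonneg_eq_0_iff) auto
    then have "\<gamma> (axis i 1) = 0" for i by (simp add: powr_eq_0_iff)
    then have "\<gamma> y = 0" for y using linear_cart_expansion[OF lin, of y] by simp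
    then show ?thesis using p by (simp add: sum_nonneg)
  next
    case False
    define \<sigma> where "\<sigma> = ?S powr (1 / s)"
    have \<sigma>: "0 < \<sigma>" using False S0 by (simp add: \<sigma>_def)
    have \<sigma>s: "\<sigma> powr s = ?S" using S0 s0 by (simp add: \<sigma>_def powr_powr)
    define \<delta> where "\<delta> y = of_real (1 / \<sigma>) * \<gamma> y" for y
    have lin': "Vector_Spaces.linear (*s) (*) \<delta>"
      unfolding \<delta>_def
      by (intro linear_functionalI) (simp_all add: \<gamma>.add \<gamma>.scale algebra_simps)
    have n\<delta>: "norm (\<delta> y) = norm (\<gamma> y) / \<sigma>" for y using \<sigma> by (simp add: \<delta>_def norm_mult norm_divide)
    have "(\<Sum>i\<in>UNIV. norm (\<delta> (axis i 1)) powr s) = ?S / \<sigma> powr s"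
      using \<sigma> by (simp add: n\<delta> powr_divide sum_divide_distrib)
    also have "\<dots> \<le> 1" using \<sigma>s by simp
    finally have "\<delta> \<in> dual_ball (*s) (ell_norm r)"
      using dual_ballI_coordinates[OF r lin'] by (simp add: s_def)
    then have le: "(\<Sum>j<J. norm (\<delta> (x j)) powr p) powr (1 / p) \<le> ?w"
      unfolding weak_norm_def by (rule cSUP_upper[OF _ bdd_above_weak_norm[OF p]])
    have "(\<Sum>j<J. norm (\<delta> (x j)) powr p) = ((\<Sum>j<J. norm (\<delta> (x j)) powr p) powr (1 / p)) powr p"
      using p by (simp add: powr_powr sum_nonneg)
    also have "\<dots> \<le> ?w powr p" using le p by (intro powr_mono2) auto
    finally have "(\<Sum>j<J. norm (\<delta> (x j)) powr p) \<le> ?w powr p" .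
    moreover have "(\<Sum>j<J. norm (\<gamma> (x j)) powr p) = (\<Sum>j<J. norm (\<delta> (x j)) powr p) * \<sigma> powr p"
      using \<sigma> by (simp add: n\<delta> powr_divide sum_distrib_right)
    moreover have "\<sigma> powr p = ?S powr (p / s)" by (simp add: \<sigma>_def powr_powr)
    ultimately show ?thesis by (simp add: mult_right_mono)
  qed
qed

lemma weak_norm_le:
  fixes x :: "nat \<Rightarrow> 'k::real_or_complex ^ 'n"
  assumes r: "1 \<le> r" "1 / r + 1 / r' = 1" "r' < \<infinity>" and p: "0 < p" and B: "0 \<le> B"
    and le: "\<And>\<gamma>. Vector_Spaces.linear (*s) (*) \<gamma> \<Longrightarrow> (\<Sum>i\<in>UNIV. norm (\<gamma> (axis i 1)) powr enn2real r') \<le> 1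
      \<Longrightarrow> (\<Sum>j<J. norm (\<gamma> (x j)) powr p) \<le> B powr p"
  shows "weak_norm (*s) (ell_norm r) p J x \<le> B"
  unfolding weak_norm_def
proof (rule cSUP_least)
  show "dual_ball (*s) (ell_norm r) \<noteq> ({} :: ('k ^ 'n \<Rightarrow> 'k) set)" using zero_in_dual_ball by blast
  fix \<gamma> :: "'k ^ 'n \<Rightarrow> 'k" assume \<gamma>: "\<gamma> \<in> dual_ball (*s) (ell_norm r)"
  then have "Vector_Spaces.linear (*s) (*) \<gamma>" by (simp add: dual_ball_def)
  then have "(\<Sum>j<J. norm (\<gamma> (x j)) powr p) \<le> B powr p"
    by (rule le) (rule dual_ball_coordinates[OF r \<gamma>])
  then have "(\<Sum>j<J. norm (\<gamma> (x j)) powr p) powr (1 / p) \<le> (B powr p) powr (1 / p)"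
    using p by (intro powr_mono2) (auto intro!: sum_nonneg)
  then show "(\<Sum>j<J. norm (\<gamma> (x j)) powr p) powr (1 / p) \<le> B"
    using p B by (simp add: powr_powr)
qed

lemma vec_lambda_measurable [measurable]:
  "vec_lambda \<in> measurable (PiM (UNIV :: 'n::finite set) (\<lambda>_. borel :: 'a::{second_countable_topology} measure)) borel"
proof -
  have "continuous_on UNIV (vec_lambda :: ('n \<Rightarrow> 'a) \<Rightarrow> 'a ^ 'n)"
    using continuous_on_vec_lambda[of UNIV "\<lambda>i x. x i"] by simp
  then have "vec_lambda \<in> measurable borel (borel :: ('a ^ 'n) measure)"
    by (rule borel_measurable_continuous_onI)
  then show ?thesis
    using measurable_cong_sets[OF sets_PiM_equal_borel refl] by blast
qed

lemma linear_functional_measurable: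
  fixes \<gamma> :: "'k::real_or_complex ^ 'n \<Rightarrow> 'k"
  assumes "Vector_Spaces.linear (*s) (*) \<gamma>"
  shows "\<gamma> \<in> borel_measurable borel"
proof -
  have [measurable]: "(\<lambda>v::'k^'n. v $ i) \<in> borel_measurable borel" for i
    by (intro borel_measurable_continuous_onI continuous_intros)
  have "(\<lambda>x. \<Sum>i\<in>UNIV. (x $ i) * \<gamma> (axis i 1)) \<in> borel_measurable borel" by measurable
  then show ?thesis by (subst measurable_cong[OF linear_cart_expansion[OF assms]])
qed

lemma sets_product_measure [simp, measurable_cong]: "sets (product_measure \<mu>) = sets borel"
  by (simp add: product_measure_def)

lemma measurable_PiM_product_measure:
  "measurable (PiM I (\<lambda>_. product_measure \<mu>)) N = measurable (PiM I (\<lambda>_. borel)) N"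
  by (intro measurable_cong_sets sets_PiM_cong refl sets_product_measure)

context isotropic_stable
begin

lemma prob_space_product_measure: "prob_space (product_measure \<mu> :: ('k ^ 'n) measure)"
proof -
  interpret P: prob_space "PiM (UNIV :: 'n set) (\<lambda>_. \<mu>)" by (intro prob_space_PiM prob_space_axioms)
  show ?thesis unfolding product_measure_def by (rule P.prob_space_distr) simp
qed

text \<open>
  A functional is a linear combination of independent stable coordinates.
\<close>

lemma functional_moment:
  fixes \<gamma> :: "'k ^ 'n \<Rightarrow> 'k"
  assumes lin: "Vector_Spaces.linear (*s) (*) \<gamma>" and p: "0 < p"
  shows "(\<integral>\<^sup>+z. ennreal (norm (\<gamma> z) powr p) \<partial>product_measure \<mu>) =
    ennreal ((\<Sum>i\<in>UNIV. norm (\<gamma> (axis i 1)) powr s) powr (p / s)) * (\<integral>\<^sup>+z. ennreal (norm z powr p) \<partial>\<mu>)"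
proof -
  note [measurable] = linear_functional_measurable[OF lin]
  have "(\<integral>\<^sup>+z. ennreal (norm (\<gamma> z) powr p) \<partial>product_measure \<mu>)
    = (\<integral>\<^sup>+z. ennreal (norm (\<gamma> (vec_lambda z)) powr p) \<partial>PiM (UNIV :: 'n set) (\<lambda>_. \<mu>))"
    unfolding product_measure_def by (rule nn_integral_distr) (simp_all, measurable)
  also have "\<dots> = (\<integral>\<^sup>+z. ennreal (norm (\<Sum>i\<in>UNIV. \<gamma> (axis i 1) * z i) powr p) \<partial>PiM (UNIV :: 'n set) (\<lambda>_. \<mu>))"
    by (simp add: linear_cart_expansion[OF lin, of "vec_lambda _"] mult.commute)
  also note moment_sum[OF _ p, of UNIV "\<lambda>i. \<gamma> (axis i 1)"]
  finally show ?thesis by simp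
qed

end

section \<open>Factorisation through finite-dimensional sequence spaces\<close>

lemma sum_fun_apply: "(\<Sum>i\<in>I. f i) x = (\<Sum>i\<in>I. f i x)" for f :: "'i \<Rightarrow> 'a \<Rightarrow> 'b::comm_monoid_add"
  by (induction I rule: infinite_finite_induct) simp_all

lemma linear_on_sum:
  assumes f: "linear_on A sA sB f" and I: "finite I" "\<And>i. i \<in> I \<Longrightarrow> g i \<in> A"
    and A: "0 \<in> A" "\<And>x y. x \<in> A \<Longrightarrow> y \<in> A \<Longrightarrow> x + y \<in> A" "\<And>c x. x \<in> A \<Longrightarrow> sA c x \<in> A"
  shows "f (\<Sum>i\<in>I. sA (c i) (g i)) = (\<Sum>i\<in>I. sB (c i) (f (g i)))"
proof -
  have f0: "f 0 = 0"
  proof -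
    have "f (0 + 0) = f 0 + f 0" using f A(1) unfolding linear_on_def by blast
    then show ?thesis by simp
  qed
  have "(\<Sum>i\<in>I. sA (c i) (g i)) \<in> A \<and> f (\<Sum>i\<in>I. sA (c i) (g i)) = (\<Sum>i\<in>I. sB (c i) (f (g i)))"
    using I
  proof (induction I)
    case (insert i I)
    then have "sA (c i) (g i) \<in> A" "(\<Sum>i\<in>I. sA (c i) (g i)) \<in> A" using A by auto
    then show ?case using insert f A(2) by (simp add: linear_on_def)
  qed (simp add: f0 A)
  then show ?thesis by simp
qed

context scalar_normed_space
begin

lemma continuous_on_scale: "continuous_on UNIV (\<lambda>a. scale a x)"
proof -
  have "bounded_linear (\<lambda>a. scale a x)"
  proof (rule bounded_linear_intro)
    show "scale (a + b) x = scale a x + scale b x" for a b by (rule scale_left_distrib)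
    show "scale (r *\<^sub>R a) x = r *\<^sub>R scale a x" for r a
      by (simp only: scaleR_conv_of_real[of r a] scale_of_real[symmetric] scale_scale)
    show "norm (scale a x) \<le> norm a * norm x" for a by (simp add: norm_scale)
  qed
  then show ?thesis by (rule linear_continuous_on)
qed

text \<open>
  Among the coefficient families bounded by one in modulus, those with modulus one at a given basis vector
  form a compact set, on which the norm of the combination attains a positive minimum. Every family that is
  not zero is brought into one of these sets by dividing it by its largest modulus.
\<close>

lemma independent_coefficient_bound:
  assumes B: "finite B" "independent B"
  shows "\<exists>C>0. \<forall>c. \<forall>b\<in>B. norm (c b) \<le> C * norm (\<Sum>b\<in>B. scale (c b) b)"
proof -
  define h where "h c = norm (\<Sum>b\<in>B. scale (c b) b)" for c
  have "continuous_on UNIV (\<lambda>c. scale (c b) b)" for b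
    by (rule continuous_on_compose2[OF continuous_on_scale continuous_on_product_coordinates]) simp
  then have cont: "continuous_on UNIV h" unfolding h_def by (intro continuous_intros)
  \<comment> \<open>Coefficients outside \<open>B\<close> are set to zero so that a product over all vectors is compact.\<close>
  define K where "K b = PiE UNIV (\<lambda>b'. if b' = b then sphere 0 1 else if b' \<in> B then cball 0 1 else {0 :: 'k})" for b
  have "\<exists>m>0. \<forall>c\<in>K b. m \<le> h c" if b: "b \<in> B" for b
  proof -
    have "compactin (product_topology (\<lambda>_. euclidean) UNIV) (K b)"
      unfolding K_def compactin_PiE by auto
    then have "compact (K b)" by (simp add: euclidean_product_topology)
    moreover have "(\<lambda>b'. if b' = b then 1 else 0) \<in> K b" by (auto simp: K_def)
    then have "K b \<noteq> {}" by blast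
    ultimately obtain c where c: "c \<in> K b" "\<And>c'. c' \<in> K b \<Longrightarrow> h c \<le> h c'"
      using continuous_attains_inf[of "K b" h] continuous_on_subset[OF cont] by blast
    have "norm (c b) = 1" using c(1) by (auto simp: K_def PiE_iff split: if_splits)
    then have "c b \<noteq> 0" by auto
    then have "h c \<noteq> 0" using B b unfolding h_def by (auto simp: dependent_finite)
    then have "0 < h c" by (simp add: h_def)
    then show ?thesis using c(2) by blast
  qed
  then obtain m where m: "\<And>b. b \<in> B \<Longrightarrow> 0 < m b" "\<And>b c. b \<in> B \<Longrightarrow> c \<in> K b \<Longrightarrow> m b \<le> h c"
    by metis
  define C where "C = 1 + (\<Sum>b\<in>B. 1 / m b)"
  have "0 \<le> (\<Sum>b\<in>B. 1 / m b)" using m(1) by (intro sum_nonneg) (simp add: less_imp_le)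
  then have C: "0 < C" by (simp add: C_def)
  have "norm (c b) \<le> C * h c" if b: "b \<in> B" for c b
  proof (cases "\<forall>b'\<in>B. c b' = 0")
    case True
    then show ?thesis using b C by (simp add: h_def)
  next
    case False
    have "Max ((\<lambda>b. norm (c b)) ` B) \<in> (\<lambda>b. norm (c b)) ` B" using B b by (intro Max_in) auto
    then obtain d where d: "d \<in> B" "norm (c d) = Max ((\<lambda>b. norm (c b)) ` B)" by auto
    then have le: "norm (c b') \<le> norm (c d)" if "b' \<in> B" for b' using B that by simp
    have pos: "0 < norm (c d)" using False le by (metis less_le_trans zero_less_norm_iff)
    define e where "e b' = (if b' \<in> B then c b' / of_real (norm (c d)) else 0)" for b'
    have "e \<in> K d" using le pos d(1) by (auto simp: K_def e_def norm_divide)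
    then have "m d \<le> h e" by (rule m(2)[OF d(1)])
    also have "h e = norm (scale (of_real (1 / norm (c d))) (\<Sum>b\<in>B. scale (c b) b))"
      unfolding h_def by (simp add: scale_sum_right e_def divide_inverse mult.commute)
    also have "\<dots> = h c / norm (c d)" by (simp add: norm_scale h_def norm_divide)
    finally have "norm (c d) * m d \<le> h c" using pos by (simp add: pos_le_divide_eq mult.commute)
    then have "norm (c d) \<le> (1 / m d) * h c" using m(1)[OF d(1)] by (simp add: field_simps)
    also have "\<dots> \<le> C * h c"
    proof (rule mult_right_mono)
      have "1 / m d \<le> (\<Sum>b\<in>B. 1 / m b)" using B d(1) m(1) by (intro member_le_sum) (auto intro: less_imp_le)
      then show "1 / m d \<le> C" by (simp add: C_def)
    qed (simp add: h_def)
    finally show ?thesis using le[OF b] by simp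
  qed
  then show ?thesis using C unfolding h_def by blast
qed

lemma linear_functional_bounded_on_span:
  fixes f :: "'x \<Rightarrow> 'k"
  assumes B: "finite B" and f: "linear_on (span B) scale (*) f"
  shows "\<exists>C\<ge>0. \<forall>x\<in>span B. norm (f x) \<le> C * norm x"
proof -
  obtain B' where B': "B' \<subseteq> B" "independent B'" "B \<subseteq> span B'" by (rule maximal_independent_subset)
  have span: "span B' = span B"
    using B' by (meson span_mono span_minimal subspace_span subset_antisym)
  have fin: "finite B'" using B B' finite_subset by blast
  obtain C where C: "0 < C" "\<And>c b. b \<in> B' \<Longrightarrow> norm (c b) \<le> C * norm (\<Sum>b\<in>B'. scale (c b) b)"
    using independent_coefficient_bound[OF fin B'(2)] by blast
  show ?thesis
  proof (intro exI[of _ "C * (\<Sum>b\<in>B'. norm (f b))"] conjI ballI)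
    show "0 \<le> C * (\<Sum>b\<in>B'. norm (f b))" using C(1) by (simp add: sum_nonneg)
    fix x assume "x \<in> span B"
    then obtain c where c: "x = (\<Sum>b\<in>B'. scale (c b) b)"
      using span_finite[OF fin] span by auto
    have "f x = (\<Sum>b\<in>B'. c b * f b)"
      unfolding c using B'(1) by (intro linear_on_sum[OF f fin]) (auto intro: span_base span_zero span_add span_scale)
    then have "norm (f x) \<le> (\<Sum>b\<in>B'. norm (c b) * norm (f b))"
      by (simp add: norm_mult[symmetric] norm_sum)
    also have "\<dots> \<le> (\<Sum>b\<in>B'. (C * norm x) * norm (f b))"
      using C(2) by (intro sum_mono mult_right_mono) (auto simp: c)
    finally show "norm (f x) \<le> C * (\<Sum>b\<in>B'. norm (f b)) * norm x"
      by (simp add: sum_distrib_left mult_ac)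
  qed
qed

end

lemma lp_norm_finite:
  "lp_norm I (ennreal q) x = (\<Sum>i\<in>I. norm (x i) powr q) powr (1 / q)" if "0 \<le> q"
  using that by (simp add: lp_norm_def)

text \<open>
  The operator norm is a supremum in the reals, so it bounds anything only once the set is known to be
  bounded above.
\<close>

lemma operator_norm_bound:
  assumes f: "\<And>t x. x \<in> A \<Longrightarrow> sA (of_real t) x \<in> A \<and> nB (f (sA (of_real t) x)) = \<bar>t\<bar> * nB (f x)"
    and nA: "\<And>t x. x \<in> A \<Longrightarrow> nA (sA (of_real t :: 'k::real_or_complex) x) = \<bar>t\<bar> * nA x"
    and bdd: "bdd_above ((\<lambda>x. nB (f x)) ` {x\<in>A. nA x \<le> 1})" and x: "x \<in> A" "0 < nA x"
  shows "nB (f x) \<le> operator_norm A nA nB f * nA x"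
proof -
  let ?y = "sA (of_real (1 / nA x)) x"
  have "?y \<in> A" "nA ?y = 1" "nB (f ?y) = nB (f x) / nA x"
    using f[of x "1 / nA x"] nA[of x "1 / nA x"] x by auto
  then have "nB (f x) / nA x \<le> operator_norm A nA nB f"
    unfolding operator_norm_def using bdd by (metis (mono_tags, lifting) cSUP_upper mem_Collect_eq order_refl)
  then show ?thesis using x(2) by (simp add: pos_divide_le_eq)
qed

text \<open>
  The two bounds say that \<open>R\<close> changes norms by factors whose product is at most \<open>l + e\<close>; the second
  holds because the left inverse \<open>S\<close> of \<open>R\<close> has operator norm \<open>a\<close>. Both operators are bounded since
  their domains have finite dimension.
\<close>

lemma Lg_space_factorization:
  fixes sX :: "'k::real_or_complex \<Rightarrow> 'x::real_normed_vector \<Rightarrow> 'x"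
  assumes Lg: "Lg_space q l sX" and q: "1 \<le> q" and B: "finite B" and e: "0 < e"
  obtains k R a b where "0 \<le> a" "0 \<le> b" "a * b \<le> l + e"
    "linear_on (module.span sX B) sX tuple_scale R"
    "\<And>x. x \<in> module.span sX B \<Longrightarrow> lp_norm {..<k} (ennreal q) (R x) \<le> b * norm x"
    "\<And>x. x \<in> module.span sX B \<Longrightarrow> norm x \<le> a * lp_norm {..<k} (ennreal q) (R x)"
proof -
  interpret X: scalar_normed_space sX using Lg by (simp add: Lg_space_def)
  let ?M = "X.span B" and ?n = "\<lambda>k. lp_norm {..<k} (ennreal q) :: (nat \<Rightarrow> 'k) \<Rightarrow> real"
  obtain k R S where R: "R ` ?M \<subseteq> tuples k" "linear_on ?M sX tuple_scale R"
    and S: "linear_on (tuples k) tuple_scale sX S" and SR: "\<And>x. x \<in> ?M \<Longrightarrow> S (R x) = x"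
    and le: "operator_norm (tuples k) (?n k) norm S * operator_norm ?M norm (?n k) R \<le> l + e"
  proof -
    have "\<exists>k R S. R ` ?M \<subseteq> tuples k \<and> linear_on ?M sX tuple_scale R \<and> linear_on (tuples k) tuple_scale sX S \<and>
      (\<forall>x\<in>?M. S (R x) = x) \<and> operator_norm (tuples k) (?n k) norm S * operator_norm ?M norm (?n k) R \<le> l + e"
      using Lg B e unfolding Lg_space_def by blast
    then show ?thesis using that by blast
  qed
  let ?a = "operator_norm (tuples k) (?n k) norm S" and ?b = "operator_norm ?M norm (?n k) R"
  have n_scale: "?n k (tuple_scale c x) = norm c * ?n k x" for c x
    using q by (simp add: lp_norm_finite tuple_scale_def norm_mult powr_mult sum_distrib_left[symmetric] sum_nonneg powr_powr)
  have n_nonneg: "0 \<le> ?n k x" for x using q by (simp add: lp_norm_finite)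
  have n_coord: "norm (x i) \<le> ?n k x" if "i < k" for x i
  proof -
    have "norm (x i) = (norm (x i) powr q) powr (1 / q)" using q by (simp add: powr_powr)
    also have "\<dots> \<le> (\<Sum>i<k. norm (x i) powr q) powr (1 / q)"
      using q that by (intro powr_mono2 member_le_sum) auto
    finally show ?thesis using q by (simp add: lp_norm_finite)
  qed
  have n_zero: "x = 0" if "x \<in> tuples k" "?n k x = 0" for x
  proof (rule ext)
    fix i show "x i = 0 i" using that n_coord[of i x] by (cases "i < k") (auto simp: tuples_def)
  qed
  have n_le: "?n k x \<le> (real k * c powr q) powr (1 / q)" if "\<And>i. i < k \<Longrightarrow> norm (x i) \<le> c" for x c
  proof -
    have "(\<Sum>i<k. norm (x i) powr q) \<le> (\<Sum>i<k. c powr q)"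
      using that q by (intro sum_mono powr_mono2) auto
    then show ?thesis using q by (simp add: lp_norm_finite sum_nonneg powr_mono2)
  qed
  have tuples: "0 \<in> tuples k" "\<And>x y. x \<in> tuples k \<Longrightarrow> y \<in> tuples k \<Longrightarrow> x + y \<in> tuples k"
    "\<And>c x. x \<in> tuples k \<Longrightarrow> tuple_scale c x \<in> tuples k"
    by (simp_all add: tuples_def tuple_scale_def)
  have S_bdd: "bdd_above ((\<lambda>x. norm (S x)) ` {x \<in> tuples k. ?n k x \<le> 1})"
  proof (rule bdd_aboveI2)
    fix x assume x: "x \<in> {x \<in> tuples k. ?n k x \<le> 1}"
    let ?d = "\<lambda>i j. if j = i then 1 else (0::'k)"
    have "x = (\<Sum>i<k. tuple_scale (x i) (?d i))"
    proof (rule ext)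
      fix j
      have "(\<Sum>i<k. tuple_scale (x i) (?d i)) j = (\<Sum>i<k. if i = j then x i else 0)"
        unfolding sum_fun_apply tuple_scale_def by (intro sum.cong) auto
      also have "\<dots> = x j" using x by (auto simp: tuples_def)
      finally show "x j = (\<Sum>i<k. tuple_scale (x i) (?d i)) j" by (rule sym)
    qed
    then have "S x = S (\<Sum>i<k. tuple_scale (x i) (?d i))" by (rule arg_cong)
    also have "\<dots> = (\<Sum>i<k. sX (x i) (S (?d i)))"
    proof (rule linear_on_sum[OF S finite_lessThan _ tuples])
      show "?d i \<in> tuples k" if "i \<in> {..<k}" for i using that by (simp add: tuples_def)
    qed
    finally have "norm (S x) \<le> (\<Sum>i<k. norm (x i) * norm (S (?d i)))"
      by (simp add: X.norm_scale[symmetric] norm_sum)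
    also have "\<dots> \<le> (\<Sum>i<k. 1 * norm (S (?d i)))"
      using x n_coord by (intro sum_mono mult_right_mono) (auto intro: order_trans)
    finally show "norm (S x) \<le> (\<Sum>i<k. norm (S (?d i)))" by simp
  qed
  have R_bdd: "bdd_above ((\<lambda>x. ?n k (R x)) ` {x \<in> ?M. norm x \<le> 1})"
  proof -
    have "\<exists>C\<ge>0. \<forall>x\<in>?M. norm (R x i) \<le> C * norm x" for i
    proof (rule X.linear_functional_bounded_on_span[OF B])
      show "linear_on ?M sX (*) (\<lambda>x. R x i)"
        using R(2) by (simp add: linear_on_def tuple_scale_def)
    qed
    then obtain C where C: "\<And>i. 0 \<le> C i" "\<And>i x. x \<in> ?M \<Longrightarrow> norm (R x i) \<le> C i * norm x" by metis
    show ?thesis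
    proof (rule bdd_aboveI2)
      fix x assume x: "x \<in> {x \<in> ?M. norm x \<le> 1}"
      show "?n k (R x) \<le> (real k * (\<Sum>i<k. C i) powr q) powr (1 / q)"
      proof (rule n_le)
        fix i assume "i < k"
        have "norm (R x i) \<le> C i * norm x" using x C(2) by simp
        also have "\<dots> \<le> C i * 1" using x C(1) by (intro mult_left_mono) auto
        also have "\<dots> \<le> (\<Sum>i<k. C i)" using \<open>i < k\<close> C(1) by (simp add: member_le_sum)
        finally show "norm (R x i) \<le> (\<Sum>i<k. C i)" .
      qed
    qed
  qed
  have R0: "R 0 = 0" and S0: "S 0 = 0"
  proof -
    have "R (0 + 0) = R 0 + R 0" using R(2) X.span_zero unfolding linear_on_def by blast
    then show "R 0 = 0" by simp
    have "S (0 + 0) = S 0 + S 0" using S tuples(1) unfolding linear_on_def by blast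
    then show "S 0 = 0" by simp
  qed
  have n0: "?n k 0 = 0" using q by (simp add: lp_norm_finite)
  have a0: "0 \<le> ?a" unfolding operator_norm_def
    by (rule cSUP_upper2[OF S_bdd, of 0]) (simp_all add: tuples(1) n0 S0)
  have b0: "0 \<le> ?b" unfolding operator_norm_def
    by (rule cSUP_upper2[OF R_bdd, of 0]) (simp_all add: X.span_zero n0 R0)
  have bR: "?n k (R x) \<le> ?b * norm x" if x: "x \<in> ?M" for x
  proof (cases "x = 0")
    case False
    show ?thesis
    proof (rule operator_norm_bound[where sA = sX])
      show "sX (of_real t) y \<in> ?M \<and> ?n k (R (sX (of_real t) y)) = \<bar>t\<bar> * ?n k (R y)" if "y \<in> ?M" for t y
        using that R(2) by (simp add: X.span_scale linear_on_def n_scale)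
      show "norm (sX (of_real t) y) = \<bar>t\<bar> * norm y" for t y by (simp add: X.norm_scale)
      show "0 < norm x" using False by simp
    qed (rule R_bdd x)+
  qed (simp add: R0 n0)
  have aR: "norm x \<le> ?a * ?n k (R x)" if x: "x \<in> ?M" for x
  proof (cases "?n k (R x) = 0")
    case True
    then have "R x = 0" using x R(1) by (intro n_zero) auto
    then have "x = 0" using SR[OF x] S0 by simp
    then show ?thesis by (simp add: R0 n0)
  next
    case False
    have "norm (S (R x)) \<le> ?a * ?n k (R x)"
    proof (rule operator_norm_bound[where sA = tuple_scale])
      show "tuple_scale (of_real t) y \<in> tuples k \<and> norm (S (tuple_scale (of_real t) y)) = \<bar>t\<bar> * norm (S y)"
        if "y \<in> tuples k" for t y
        using that S tuples(3) by (simp add: linear_on_def X.norm_scale)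
      show "0 < ?n k (R x)" using False n_nonneg[of "R x"] by simp
      show "?n k (tuple_scale (of_real t) y) = \<bar>t\<bar> * ?n k y" for t y by (simp add: n_scale)
      show "R x \<in> tuples k" using x R(1) by blast
    qed (rule S_bdd)
    then show ?thesis by (simp add: SR[OF x])
  qed
  show ?thesis by (rule that[OF a0 b0 le R(2) bR aR])
qed

section \<open>Moments of multilinear maps\<close>

lemma multilinear_scale:
  fixes T :: "('m::finite \<Rightarrow> 'k::real_or_complex ^ 'n) \<Rightarrow> 'x::ab_group_add"
  assumes T: "multilinear (*s) sX T" and sX: "vector_space sX"
  shows "T (\<lambda>k. c k *s z k) = sX (\<Prod>k\<in>UNIV. c k) (T z)"
proof -
  interpret vector_space sX by (rule sX)
  have "T (\<lambda>k. c k *s z k) = (\<Sum>i\<in>UNIV. sX (\<Prod>k\<in>UNIV. c k) (sX (\<Prod>k\<in>UNIV. z k $ i k) (T (\<lambda>k. axis (i k) 1))))"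
    by (subst multilinear_expansion[OF T sX]) (simp add: prod.distrib)
  then show ?thesis by (simp only: scale_sum_right[symmetric] multilinear_expansion[OF T sX, of z, symmetric])
qed

context scalar_normed_space
begin

lemma multilinear_norm_bound:
  fixes T :: "('m::finite \<Rightarrow> 'k ^ 'n) \<Rightarrow> 'x"
  assumes T: "multilinear (*s) scale T"
  shows "norm (T z) \<le> (\<Sum>i\<in>UNIV. norm (T (\<lambda>k. axis (i k) 1))) * (\<Prod>k\<in>UNIV. norm (z k))"
proof -
  have "norm (T z) \<le> (\<Sum>i\<in>UNIV. norm (scale (\<Prod>k\<in>UNIV. z k $ i k) (T (\<lambda>k. axis (i k) 1))))"
    by (subst multilinear_expansion[OF T vector_space_axioms]) (rule norm_sum)
  also have "\<dots> \<le> (\<Sum>i\<in>UNIV. (\<Prod>k\<in>UNIV. norm (z k)) * norm (T (\<lambda>k. axis (i k) 1)))"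
    by (intro sum_mono) (simp add: norm_scale prod_norm[symmetric] mult_right_mono prod_mono Finite_Cartesian_Product.norm_nth_le)
  also have "\<dots> = (\<Sum>i\<in>UNIV. norm (T (\<lambda>k. axis (i k) 1))) * (\<Prod>k\<in>UNIV. norm (z k))"
    by (subst mult.commute) (simp add: sum_distrib_left)
  finally show ?thesis .
qed

lemma multilinear_in_span:
  fixes T :: "('m::finite \<Rightarrow> 'k ^ 'n) \<Rightarrow> 'x"
  assumes T: "multilinear (*s) scale T"
  shows "T z \<in> span (range (\<lambda>i. T (\<lambda>k. axis (i k) 1)))"
  by (rule ssubst[OF multilinear_expansion[OF T vector_space_axioms]])
    (intro span_sum span_scale span_base rangeI)

lemma multilinear_tendsto:
  fixes T :: "('m::finite \<Rightarrow> 'k ^ 'n) \<Rightarrow> 'x"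
  assumes T: "multilinear (*s) scale T" and lim: "\<And>k. (\<lambda>j. f j k) \<longlonglongrightarrow> z k"
  shows "(\<lambda>j. T (f j)) \<longlonglongrightarrow> T z"
proof -
  have "(\<lambda>j. \<Sum>i\<in>UNIV. scale (\<Prod>k\<in>UNIV. f j k $ i k) (T (\<lambda>k. axis (i k) 1)))
    \<longlonglongrightarrow> (\<Sum>i\<in>UNIV. scale (\<Prod>k\<in>UNIV. z k $ i k) (T (\<lambda>k. axis (i k) 1)))"
    by (intro tendsto_sum continuous_on_tendsto_compose[OF continuous_on_scale] tendsto_prod tendsto_vec_nth lim) auto
  then show ?thesis by (simp only: multilinear_expansion[OF T vector_space_axioms, symmetric])
qed

lemma multilinear_compose:
  fixes T :: "('m \<Rightarrow> 'k ^ 'n) \<Rightarrow> 'x" and f :: "'x \<Rightarrow> 'k"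
  assumes T: "multilinear (*s) scale T" and range: "\<And>z. T z \<in> M" and f: "linear_on M scale (*) f"
  shows "multilinear (*s) (*) (\<lambda>z. f (T z))"
  unfolding multilinear_def
proof (intro allI)
  fix i z
  interpret L: Vector_Spaces.linear "(*s)" scale "\<lambda>v. T (z(i := v))" using T unfolding multilinear_def by blast
  have "f (T (z(i := v + w))) = f (T (z(i := v))) + f (T (z(i := w)))" for v w
    using f range unfolding linear_on_def L.add by blast
  moreover have "f (T (z(i := c *s v))) = c * f (T (z(i := v)))" for c v
    using f range unfolding linear_on_def L.scale by blast
  ultimately show "Vector_Spaces.linear (*s) (*) (\<lambda>v. f (T (z(i := v))))"
    by (intro linear_functionalI)
qed

end

lemma norm_continuous_measurable:
  fixes T :: "('m::finite \<Rightarrow> 'k::real_or_complex ^ 'n) \<Rightarrow> 'x::real_normed_vector"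
  assumes "continuous_on UNIV T"
  shows "(\<lambda>z. norm (T z)) \<in> borel_measurable (PiM UNIV (\<lambda>_. borel))"
proof -
  have "(\<lambda>z. norm (T z)) \<in> borel_measurable borel"
    using assms by (intro borel_measurable_continuous_onI continuous_intros)
  then show ?thesis using measurable_cong_sets[OF sets_PiM_equal_borel refl] by blast
qed

context isotropic_stable
begin

lemma product_measure_moment_finite:
  assumes p: "0 < p" and fin: "(\<integral>\<^sup>+z. ennreal (norm z powr p) \<partial>\<mu>) < \<infinity>"
  shows "(\<integral>\<^sup>+z. ennreal (norm (z :: 'k ^ 'n) powr p) \<partial>product_measure \<mu>) < \<infinity>"
proof -
  have lin: "Vector_Spaces.linear (*s) (*) (\<lambda>z::'k ^ 'n. z $ i)" for i
    by (intro linear_functionalI) simp_all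
  note [measurable] = linear_functional_measurable[OF lin]
  have "norm z powr p \<le> real CARD('n) powr p * (\<Sum>i\<in>UNIV. norm (z $ i) powr p)" for z :: "'k ^ 'n"
  proof -
    have "norm z \<le> (\<Sum>i\<in>UNIV. norm (z $ i))" unfolding norm_vec_def by (rule L2_set_le_sum) simp
    then have "norm z powr p \<le> (\<Sum>i\<in>UNIV. norm (z $ i)) powr p" using p by (intro powr_mono2) auto
    also have "\<dots> \<le> real CARD('n) powr p * (\<Sum>i\<in>UNIV. norm (z $ i) powr p)"
      using p by (intro powr_sum_le) auto
    finally show ?thesis .
  qed
  then have "(\<integral>\<^sup>+z. ennreal (norm (z :: 'k ^ 'n) powr p) \<partial>product_measure \<mu>)
    \<le> (\<integral>\<^sup>+z. ennreal (real CARD('n) powr p) * (\<Sum>i\<in>UNIV. ennreal (norm (z $ i) powr p)) \<partial>(product_measure \<mu> :: ('k ^ 'n) measure))"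
    by (intro nn_integral_mono) (simp add: ennreal_mult[symmetric] sum_nonneg ennreal_leI)
  also have "\<dots> = ennreal (real CARD('n) powr p) *
      (\<Sum>i\<in>UNIV. \<integral>\<^sup>+z. ennreal (norm (z $ i) powr p) \<partial>(product_measure \<mu> :: ('k ^ 'n) measure))"
    by (simp add: nn_integral_cmult nn_integral_sum del: sum_ennreal)
  also have "\<dots> < \<infinity>"
    using fin by (simp add: functional_moment[OF lin p] ennreal_mult_less_top)
  finally show ?thesis .
qed

lemma prod_norm_moment_finite:
  assumes C: "0 \<le> C" and p: "0 < p" and fin: "(\<integral>\<^sup>+z. ennreal (norm z powr p) \<partial>\<mu>) < \<infinity>"
  shows "(\<integral>\<^sup>+z. ennreal ((C * (\<Prod>k\<in>UNIV. norm (z k))) powr p)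
    \<partial>PiM (UNIV :: 'm::finite set) (\<lambda>_. product_measure \<mu> :: ('k ^ 'n) measure)) < \<infinity>"
proof -
  interpret N: prob_space "product_measure \<mu> :: ('k ^ 'n) measure" by (rule prob_space_product_measure)
  interpret product_sigma_finite "\<lambda>_::'m. product_measure \<mu> :: ('k ^ 'n) measure" ..
  let ?P = "PiM (UNIV :: 'm set) (\<lambda>_. product_measure \<mu> :: ('k ^ 'n) measure)"
  have "ennreal ((C * (\<Prod>k\<in>UNIV. norm (z k))) powr p) = ennreal (C powr p) * (\<Prod>k\<in>UNIV. ennreal (norm (z k) powr p))"
    for z :: "'m \<Rightarrow> 'k ^ 'n"
    using C by (simp add: powr_mult prod_powr_distrib prod_ennreal ennreal_mult prod_nonneg)
  then have "(\<integral>\<^sup>+z. ennreal ((C * (\<Prod>k\<in>UNIV. norm (z k))) powr p) \<partial>?P)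
    = ennreal (C powr p) * (\<integral>\<^sup>+z. (\<Prod>k\<in>UNIV. ennreal (norm (z k) powr p)) \<partial>?P)"
    by (simp add: nn_integral_cmult)
  also have "\<dots> < \<infinity>"
    using product_measure_moment_finite[OF p fin, where 'n='n]
    by (subst product_nn_integral_prod) (simp_all add: ennreal_mult_eq_top_iff power_eq_top_ennreal less_top[symmetric])
  finally show ?thesis .
qed

end

section \<open>The upper estimate\<close>

context isotropic_stable
begin

text \<open>
  Each linear form in the components of \<open>\<psi>\<close> is a scalar multilinear map, to which
  \<open>multilinear_domination\<close> applies, and \<open>lq_domination\<close> passes from linear forms to the norm.
\<close>

lemma multiple_sum_le_lq:
  fixes x :: "'m::finite \<Rightarrow> nat \<Rightarrow> 'k ^ 'n" and J :: "'m \<Rightarrow> nat"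
    and \<psi> :: "('m \<Rightarrow> 'k ^ 'n) \<Rightarrow> nat \<Rightarrow> 'k"
  assumes r: "1 \<le> r" "1 / r + 1 / r' = 1" "r' < \<infinity>" "enn2real r' = s"
    and p: "0 < p" and q: "q = 2 \<or> p = q \<or> p < q \<and> q < 2"
    and mom: "(\<integral>\<^sup>+z. ennreal (norm z powr p) \<partial>\<mu>) = ennreal M" "0 < M"
    and \<psi>: "\<And>w. multilinear (*s) (*) (\<lambda>z. \<Sum>l<k. w l * \<psi> z l)" "\<And>l. multilinear (*s) (*) (\<lambda>z. \<psi> z l)"
    and fin: "(\<integral>\<^sup>+z. ennreal ((\<Sum>l<k. norm (\<psi> z l) powr q) powr (p / q)) \<partial>PiM UNIV (\<lambda>_. product_measure \<mu>)) < \<infinity>"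
  defines "w \<equiv> \<lambda>i. weak_norm (*s) (ell_norm r) p (J i) (x i)"
  shows "(\<Sum>j\<in>PiE UNIV (\<lambda>i. {..<J i}). ennreal ((\<Sum>l<k. norm (\<psi> (\<lambda>i. x i (j i)) l) powr q) powr (p / q)))
    \<le> (\<Prod>i\<in>UNIV. ennreal (w i powr p / M)) *
       (\<integral>\<^sup>+z. ennreal ((\<Sum>l<k. norm (\<psi> z l) powr q) powr (p / q)) \<partial>PiM UNIV (\<lambda>_. product_measure \<mu>))"
proof -
  interpret N: prob_space "product_measure \<mu> :: ('k ^ 'n) measure" by (rule prob_space_product_measure)
  let ?Q = "PiM (UNIV :: 'm set) (\<lambda>_. product_measure \<mu> :: ('k ^ 'n) measure)"
  let ?JJ = "PiE UNIV (\<lambda>i. {..<J i})"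
  have finJ: "finite ?JJ" by (intro finite_PiE) auto
  interpret Q: prob_space ?Q by (intro prob_space_PiM N.prob_space_axioms)
  \<comment> \<open>The sum over index tuples is an integral against counting measure.\<close>
  interpret linear_form_domination "count_space ?JJ" ?Q k p "\<Prod>i\<in>UNIV. ennreal (w i powr p / M)"
    "\<lambda>j. \<psi> (\<lambda>i. x i (j i))" \<psi>
  proof
    show "\<exists>A. countable A \<and> A \<subseteq> sets (count_space ?JJ) \<and> \<Union>A = space (count_space ?JJ) \<and>
        (\<forall>a\<in>A. emeasure (count_space ?JJ) a \<noteq> \<infinity>)"
      using sigma_finite_measure_count_space_finite[OF finJ] unfolding sigma_finite_measure_def by blast
    show "0 < p" by (rule p)
    show "(\<Prod>i\<in>UNIV. ennreal (w i powr p / M)) < \<infinity>" by (simp add: less_top[symmetric] ennreal_prod_eq_top)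
    show "(\<lambda>x. \<psi> x l) \<in> borel_measurable ?Q" for l
      unfolding measurable_PiM_product_measure by (rule multilinear_functional_measurable[OF \<psi>(2)])
    show "(\<integral>\<^sup>+ j. ennreal (norm (\<Sum>l<k. v l * \<psi> (\<lambda>i. x i (j i)) l) powr p) \<partial>count_space ?JJ)
      \<le> (\<Prod>i\<in>UNIV. ennreal (w i powr p / M)) * (\<integral>\<^sup>+ z. ennreal (norm (\<Sum>l<k. v l * \<psi> z l) powr p) \<partial>?Q)" for v
    proof -
      have "(\<Sum>j\<in>?JJ. ennreal (norm (\<Sum>l<k. v l * \<psi> (\<lambda>i. x i (j i)) l) powr p))
        \<le> (\<Prod>i\<in>UNIV. ennreal (w i powr p / M)) * (\<integral>\<^sup>+ z. ennreal (norm (\<Sum>l<k. v l * \<psi> z l) powr p) \<partial>?Q)"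
      proof (rule multilinear_domination[OF \<psi>(1)])
        show "sigma_finite_measure (product_measure \<mu> :: ('k ^ 'n) measure)" ..
        fix i and \<gamma> :: "'k ^ 'n \<Rightarrow> 'k" assume lin: "Vector_Spaces.linear (*s) (*) \<gamma>"
        let ?S = "\<Sum>a\<in>UNIV. norm (\<gamma> (axis a 1)) powr s"
        have "(\<Sum>j<J i. norm (\<gamma> (x i j)) powr p) \<le> w i powr p * ?S powr (p / s)"
          using weak_norm_bound[OF r(1-3) p lin] r(4) by (simp add: w_def)
        also have "\<dots> = (w i powr p / M) * (?S powr (p / s) * M)" using mom(2) by simp
        finally have "(\<Sum>j<J i. ennreal (norm (\<gamma> (x i j)) powr p)) \<le> ennreal ((w i powr p / M) * (?S powr (p / s) * M))"
          by (simp add: ennreal_leI)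
        also have "\<dots> = ennreal (w i powr p / M) * (\<integral>\<^sup>+z. ennreal (norm (\<gamma> z) powr p) \<partial>product_measure \<mu>)"
          using mom by (simp add: functional_moment[OF lin p] ennreal_mult[symmetric])
        finally show "(\<Sum>j<J i. ennreal (norm (\<gamma> (x i j)) powr p))
          \<le> ennreal (w i powr p / M) * (\<integral>\<^sup>+z. ennreal (norm (\<gamma> z) powr p) \<partial>product_measure \<mu>)" .
      qed simp
      then show ?thesis by (simp only: nn_integral_count_space_finite[OF finJ])
    qed
  qed simp_all
  show ?thesis
    using lq_domination[OF q fin] by (simp only: nn_integral_count_space_finite[OF finJ])
qed

text \<open>
  The operator \<open>R\<close> embeds the span of the range of \<open>T\<close> into some \<open>\<ell>\<^sub>q^k\<close> and changes norms by at most a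
  factor \<open>1 + e\<close>, so the estimate for \<open>R \<circ> T\<close> holds for \<open>T\<close> up to \<open>(1 + e)^p\<close>.
\<close>

lemma multiple_sum_le:
  fixes T :: "('m::finite \<Rightarrow> 'k ^ 'n) \<Rightarrow> 'x::real_normed_vector" and x :: "'m \<Rightarrow> nat \<Rightarrow> 'k ^ 'n"
    and J :: "'m \<Rightarrow> nat"
  assumes r: "1 \<le> r" "1 / r + 1 / r' = 1" "r' < \<infinity>" "enn2real r' = s"
    and p: "0 < p" and q: "1 \<le> q" "q = 2 \<or> p = q \<or> p < q \<and> q < 2"
    and mom: "(\<integral>\<^sup>+z. ennreal (norm z powr p) \<partial>\<mu>) = ennreal M" "0 < M"
    and Lg: "Lg_space q 1 sX" and T: "multilinear (*s) sX T" "continuous_on UNIV T"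
    and I: "(\<integral>\<^sup>+z. ennreal (norm (T z) powr p) \<partial>PiM UNIV (\<lambda>_. product_measure \<mu>)) = ennreal I" "0 \<le> I"
  defines "w \<equiv> \<lambda>i. weak_norm (*s) (ell_norm r) p (J i) (x i)"
  shows "(\<Sum>j\<in>PiE UNIV (\<lambda>i. {..<J i}). norm (T (\<lambda>i. x i (j i))) powr p) \<le> (\<Prod>i\<in>UNIV. w i powr p / M) * I"
proof -
  interpret X: scalar_normed_space sX using Lg by (simp add: Lg_space_def)
  let ?Q = "PiM (UNIV :: 'm set) (\<lambda>_. product_measure \<mu> :: ('k ^ 'n) measure)"
  have [measurable]: "(\<lambda>z. norm (T z)) \<in> borel_measurable ?Q"
    unfolding measurable_PiM_product_measure by (rule norm_continuous_measurable[OF T(2)])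
  let ?JJ = "PiE UNIV (\<lambda>i. {..<J i})"
  let ?L = "\<Sum>j\<in>?JJ. norm (T (\<lambda>i. x i (j i))) powr p"
  let ?A = "\<Prod>i\<in>UNIV. w i powr p / M"
  have A0: "0 \<le> ?A" using mom(2) by (intro prod_nonneg) auto
  let ?B = "range (\<lambda>i. T (\<lambda>k. axis (i k) 1))"
  have inB: "T z \<in> X.span ?B" for z by (rule X.multilinear_in_span[OF T(1)])
  have approx: "?L \<le> (1 + e) powr p * (?A * I)" if e: "0 < e" for e
  proof -
    have "finite ?B" by simp
    then obtain k R a b where ab: "0 \<le> a" "0 \<le> b" "a * b \<le> 1 + e"
      and R: "linear_on (X.span ?B) sX tuple_scale R"
      and Rb: "\<And>x. x \<in> X.span ?B \<Longrightarrow> lp_norm {..<k} (ennreal q) (R x) \<le> b * norm x"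
      and Ra: "\<And>x. x \<in> X.span ?B \<Longrightarrow> norm x \<le> a * lp_norm {..<k} (ennreal q) (R x)"
      using Lg_space_factorization[OF Lg q(1) _ e] by metis
    define f where "f z = (\<Sum>l<k. norm (R (T z) l) powr q) powr (p / q)" for z
    have lp: "lp_norm {..<k} (ennreal q) (R (T z)) powr p = f z" for z
      using q p by (simp add: lp_norm_finite powr_powr f_def)
    have lp0: "0 \<le> lp_norm {..<k} (ennreal q) y" for y :: "nat \<Rightarrow> 'k" using q by (simp add: lp_norm_finite)
    have fb: "f z \<le> b powr p * norm (T z) powr p" for z
    proof -
      have "lp_norm {..<k} (ennreal q) (R (T z)) powr p \<le> (b * norm (T z)) powr p"
        using Rb[OF inB] p lp0 by (intro powr_mono2) auto
      then show ?thesis using ab by (simp add: lp powr_mult)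
    qed
    have fa: "norm (T z) powr p \<le> a powr p * f z" for z
    proof -
      have "norm (T z) powr p \<le> (a * lp_norm {..<k} (ennreal q) (R (T z))) powr p"
        using Ra[OF inB] p by (intro powr_mono2) auto
      then show ?thesis using ab lp0 by (simp add: lp powr_mult)
    qed
    have fI: "(\<integral>\<^sup>+z. ennreal (f z) \<partial>?Q) \<le> ennreal (b powr p * I)"
    proof -
      have "(\<integral>\<^sup>+z. ennreal (f z) \<partial>?Q) \<le> (\<integral>\<^sup>+z. ennreal (b powr p) * ennreal (norm (T z) powr p) \<partial>?Q)"
        using fb by (intro nn_integral_mono) (simp add: ennreal_mult[symmetric] ennreal_leI)
      also have "\<dots> = ennreal (b powr p) * (\<integral>\<^sup>+z. ennreal (norm (T z) powr p) \<partial>?Q)"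
        by (rule nn_integral_cmult) measurable
      finally show ?thesis using I by (simp add: ennreal_mult[symmetric])
    qed
    have "(\<Sum>j\<in>?JJ. ennreal (f (\<lambda>i. x i (j i)))) \<le> (\<Prod>i\<in>UNIV. ennreal (w i powr p / M)) * (\<integral>\<^sup>+z. ennreal (f z) \<partial>?Q)"
      unfolding f_def w_def
    proof (rule multiple_sum_le_lq[OF r p q(2) mom])
      show "multilinear (*s) (*) (\<lambda>z. \<Sum>l<k. v l * R (T z) l)" for v
        by (rule X.multilinear_compose[OF T(1) inB, of "\<lambda>y. \<Sum>l<k. v l * R y l"])
          (use R in \<open>simp add: linear_on_def tuple_scale_def sum.distrib sum_distrib_left algebra_simps\<close>)
      show "multilinear (*s) (*) (\<lambda>z. R (T z) l)" for l
        by (rule X.multilinear_compose[OF T(1) inB, of "\<lambda>y. R y l"])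
          (use R in \<open>simp add: linear_on_def tuple_scale_def\<close>)
      show "(\<integral>\<^sup>+z. ennreal ((\<Sum>l<k. norm (R (T z) l) powr q) powr (p / q)) \<partial>?Q) < \<infinity>"
        using fI unfolding f_def by (simp add: le_less_trans)
    qed
    also have "\<dots> \<le> ennreal ?A * ennreal (b powr p * I)"
      using fI mom(2) by (subst prod_ennreal) (auto intro!: mult_left_mono)
    also have "\<dots> = ennreal (?A * (b powr p * I))" using A0 I by (simp add: ennreal_mult)
    finally have fsum: "(\<Sum>j\<in>?JJ. f (\<lambda>i. x i (j i))) \<le> ?A * (b powr p * I)"
      using A0 I by (simp add: f_def sum_nonneg)
    have "?L \<le> (\<Sum>j\<in>?JJ. a powr p * f (\<lambda>i. x i (j i)))" by (intro sum_mono fa)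
    also have "\<dots> = a powr p * (\<Sum>j\<in>?JJ. f (\<lambda>i. x i (j i)))" by (simp add: sum_distrib_left)
    also have "\<dots> \<le> a powr p * (?A * (b powr p * I))" using fsum by (intro mult_left_mono) auto
    also have "\<dots> = (a * b) powr p * (?A * I)" using ab by (simp add: powr_mult)
    also have "\<dots> \<le> (1 + e) powr p * (?A * I)"
      using ab p A0 I by (intro mult_right_mono powr_mono2) auto
    finally show ?thesis .
  qed
  have "((\<lambda>e. (1 + e) powr p * (?A * I)) \<longlongrightarrow> (1 + 0) powr p * (?A * I)) (at_right 0)"
    by (intro tendsto_intros) auto
  then have "((\<lambda>e. (1 + e) powr p * (?A * I)) \<longlongrightarrow> ?A * I) (at_right 0)" by simp
  then show ?thesis
    by (rule tendsto_lowerbound) (auto simp: eventually_at_right_less intro!: approx eventually_at_rightI[of 0 1])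
qed

end

section \<open>The lower estimate\<close>

text \<open>
  A substitute for the triangle inequality in \<open>L\<^sub>p\<close> that also works for \<open>p < 1\<close>. One of the two terms alone is
  large enough, depending on whether the norm of \<open>y\<close> exceeds \<open>d\<close> times that of \<open>x\<close>.
\<close>

lemma powr_norm_add_le:
  fixes x y :: "'a::real_normed_vector"
  assumes "0 < p" "0 < d"
  shows "norm (x + y) powr p \<le> (1 + d) powr p * norm x powr p + (1 + 1 / d) powr p * norm y powr p"
proof (cases "norm y \<le> d * norm x")
  case True
  have "norm (x + y) \<le> norm x + norm y" by (rule norm_triangle_ineq)
  also have "\<dots> \<le> (1 + d) * norm x" using True by (simp add: algebra_simps)
  finally have "norm (x + y) powr p \<le> ((1 + d) * norm x) powr p" using assms by (intro powr_mono2) auto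
  then show ?thesis using assms by (simp add: powr_mult add_increasing2)
next
  case False
  have "norm (x + y) \<le> norm x + norm y" by (rule norm_triangle_ineq)
  also have "\<dots> \<le> (1 + 1 / d) * norm y" using False assms by (simp add: field_simps)
  finally have "norm (x + y) powr p \<le> ((1 + 1 / d) * norm y) powr p" using assms by (intro powr_mono2) auto
  then show ?thesis using assms by (simp add: powr_mult add_increasing)
qed

lemma nn_integral_simple_range:
  fixes f :: "'a \<Rightarrow> 'b" and J :: nat
  assumes v: "bij_betw v {..<J} (range f)" and h: "\<And>y. 0 \<le> h y"
    and fm: "finite_measure N"
    and [measurable]: "\<And>j. f -` {v j} \<in> sets N"
  shows "(\<integral>\<^sup>+z. ennreal (h (f z)) \<partial>N) = (\<Sum>j<J. ennreal (measure N (f -` {v j}) * h (v j)))"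
proof -
  interpret finite_measure N by (rule fm)
  have ind: "ennreal (h (f z)) = (\<Sum>j<J. ennreal (h (v j)) * indicator (f -` {v j}) z)" for z
  proof -
    obtain j0 where j0: "j0 < J" "v j0 = f z" using v unfolding bij_betw_def by (metis imageE lessThan_iff rangeI)
    have "(\<Sum>j<J. ennreal (h (v j)) * indicator (f -` {v j}) z) = (\<Sum>j<J. if j = j0 then ennreal (h (f z)) else 0)"
    proof (intro sum.cong refl)
      fix j assume "j \<in> {..<J}"
      then have "v j = f z \<longleftrightarrow> j = j0" using v j0 unfolding bij_betw_def inj_on_def by auto
      then show "ennreal (h (v j)) * indicator (f -` {v j}) z = (if j = j0 then ennreal (h (f z)) else 0)"
        by (auto simp: indicator_def)
    qed
    then show ?thesis using j0 by simp
  qed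
  have "(\<integral>\<^sup>+z. ennreal (h (f z)) \<partial>N) = (\<Sum>j<J. \<integral>\<^sup>+z. ennreal (h (v j)) * indicator (f -` {v j}) z \<partial>N)"
    unfolding ind by (rule nn_integral_sum) measurable
  also have "\<dots> = (\<Sum>j<J. ennreal (h (v j)) * emeasure N (f -` {v j}))"
    by (intro sum.cong refl nn_integral_cmult_indicator) measurable
  finally have "(\<integral>\<^sup>+z. ennreal (h (f z)) \<partial>N) = (\<Sum>j<J. ennreal (h (v j)) * emeasure N (f -` {v j}))" .
  then show ?thesis using h by (simp add: emeasure_eq_measure ennreal_mult[symmetric] mult.commute del: sum_ennreal)
qed

lemma nn_integral_PiM_simple_range:
  fixes f :: "'a \<Rightarrow> 'b" and N :: "'a measure" and h :: "('m::finite \<Rightarrow> 'b) \<Rightarrow> real" and J :: nat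
  assumes v: "bij_betw v {..<J} (range f)" and h: "\<And>y. 0 \<le> h y"
    and N: "prob_space N"
    and A[measurable]: "\<And>j. f -` {v j} \<in> sets N"
  shows "(\<integral>\<^sup>+z. ennreal (h (\<lambda>k. f (z k))) \<partial>PiM UNIV (\<lambda>_. N)) =
    (\<Sum>j\<in>PiE UNIV (\<lambda>_. {..<J}). ennreal ((\<Prod>k\<in>UNIV. measure N (f -` {v (j k)})) * h (\<lambda>k. v (j k))))"
proof -
  interpret N: prob_space N by (rule N)
  interpret product_sigma_finite "\<lambda>_::'m. N" ..
  let ?JJ = "PiE (UNIV :: 'm set) (\<lambda>_. {..<J})"
  have finJ: "finite ?JJ" by (intro finite_PiE) auto
  have ind: "ennreal (h (\<lambda>k. f (z k))) = (\<Sum>j\<in>?JJ. ennreal (h (\<lambda>k. v (j k))) * (\<Prod>k\<in>UNIV. indicator (f -` {v (j k)}) (z k)))" for z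
  proof -
    have "\<exists>j. j < J \<and> v j = f y" for y using v unfolding bij_betw_def by (metis imageE lessThan_iff rangeI)
    then have "\<forall>k. \<exists>j. j < J \<and> v j = f (z k)" by blast
    then obtain j0 where j0: "\<And>k. j0 k < J" "\<And>k. v (j0 k) = f (z k)" using choice by metis
    have "(\<Sum>j\<in>?JJ. ennreal (h (\<lambda>k. v (j k))) * (\<Prod>k\<in>UNIV. indicator (f -` {v (j k)}) (z k)))
       = (\<Sum>j\<in>?JJ. if j = j0 then ennreal (h (\<lambda>k. f (z k))) else 0)"
    proof (intro sum.cong refl)
      fix j assume j: "j \<in> ?JJ"
      have iff: "v (j k) = f (z k) \<longleftrightarrow> j k = j0 k" for k
      proof -
        have "j k < J" using j by auto
        then show ?thesis using v j0[of k] unfolding bij_betw_def inj_on_def by auto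
      qed
      show "ennreal (h (\<lambda>k. v (j k))) * (\<Prod>k\<in>UNIV. indicator (f -` {v (j k)}) (z k)) = (if j = j0 then ennreal (h (\<lambda>k. f (z k))) else 0)"
      proof (cases "j = j0")
        case True
        then show ?thesis by (simp add: j0)
      next
        case False
        then obtain k where "j k \<noteq> j0 k" by blast
        then have "f (z k) \<noteq> v (j k)" using iff[of k] by metis
        then have "indicator (f -` {v (j k)}) (z k) = (0 :: ennreal)" by simp
        then have "(\<Prod>k\<in>UNIV. indicator (f -` {v (j k)}) (z k) :: ennreal) = 0"
          by (intro prod_zero) (simp, blast)
        then show ?thesis using False by simp
      qed
    qed
    also have "\<dots> = ennreal (h (\<lambda>k. f (z k)))" using j0(1) finJ by (simp add: PiE_iff)
    finally show ?thesis by simp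
  qed
  have "(\<integral>\<^sup>+z. ennreal (h (\<lambda>k. f (z k))) \<partial>PiM UNIV (\<lambda>_. N))
    = (\<Sum>j\<in>?JJ. ennreal (h (\<lambda>k. v (j k))) * (\<integral>\<^sup>+z. (\<Prod>k\<in>UNIV. indicator (f -` {v (j k)}) (z k)) \<partial>PiM UNIV (\<lambda>_. N)))"
    unfolding ind by (subst nn_integral_sum) (auto simp: nn_integral_cmult)
  also have "\<dots> = (\<Sum>j\<in>?JJ. ennreal (h (\<lambda>k. v (j k))) * (\<Prod>k\<in>UNIV. emeasure N (f -` {v (j k)})))"
    by (subst product_nn_integral_prod) auto
  finally show ?thesis
    using h by (simp add: N.emeasure_eq_measure prod_ennreal ennreal_mult[symmetric] mult.commute prod_nonneg)
qed

context isotropic_stable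
begin

text \<open>
  Weighting the values of \<open>f\<close> by the masses of its level sets turns the sum of \<open>|\<gamma>(x\<^sub>j)|^p\<close> into the
  integral of \<open>|\<gamma>(f z)|^p\<close>. This is close to the integral of \<open>|\<gamma>(z)|^p\<close>, uniformly over the dual
  ball, because the coordinates of \<open>\<gamma>\<close> have modulus at most one.
\<close>

lemma weak_norm_sample_le:
  fixes f :: "'k ^ 'n \<Rightarrow> 'k ^ 'n" and v :: "nat \<Rightarrow> 'k ^ 'n"
  defines "\<nu> \<equiv> product_measure \<mu> :: ('k ^ 'n) measure"
  assumes r: "1 \<le> r" "1 / r + 1 / r' = 1" "r' < \<infinity>" "enn2real r' = s" and p: "0 < p"
    and mom: "(\<integral>\<^sup>+z. ennreal (norm z powr p) \<partial>\<mu>) = ennreal M" "0 < M"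
    and f [measurable]: "f \<in> borel_measurable borel" and v: "bij_betw v {..<J} (range f)"
    and d: "0 < d" and E: "(\<integral>\<^sup>+z. ennreal (norm (f z - z) powr p) \<partial>\<nu>) = ennreal E" "0 \<le> E"
  defines "x \<equiv> \<lambda>j. of_real (measure \<nu> (f -` {v j}) powr (1 / p)) *s v j"
  shows "weak_norm (*s) (ell_norm r) p J x \<le>
    ((1 + d) powr p * M + (1 + 1 / d) powr p * (real CARD('n) powr p * E)) powr (1 / p)"
proof (rule weak_norm_le[OF r(1-3) p])
  let ?Y = "(1 + d) powr p * M + (1 + 1 / d) powr p * (real CARD('n) powr p * E)"
  have Y: "0 \<le> ?Y" using mom E by simp
  interpret N: prob_space \<nu> unfolding \<nu>_def by (rule prob_space_product_measure)
  have sets: "sets \<nu> = sets borel" by (simp add: \<nu>_def)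
  note [measurable_cong] = sets
  have sp: "space \<nu> = UNIV" using sets_eq_imp_space_eq[OF sets] by simp
  fix \<gamma> :: "'k ^ 'n \<Rightarrow> 'k"
  assume lin: "Vector_Spaces.linear (*s) (*) \<gamma>" and S: "(\<Sum>i\<in>UNIV. norm (\<gamma> (axis i 1)) powr enn2real r') \<le> 1"
  interpret \<gamma>: Vector_Spaces.linear "(*s)" "(*)" \<gamma> by (rule lin)
  note [measurable] = linear_functional_measurable[OF lin]
  have meas: "f -` {v j} \<in> sets \<nu>" for j
    using measurable_sets[OF f, of "{v j}"] by (simp add: sets)
  have \<gamma>e: "norm (\<gamma> (axis i 1)) \<le> 1" for i
  proof -
    have "norm (\<gamma> (axis i 1)) powr s \<le> (\<Sum>i\<in>UNIV. norm (\<gamma> (axis i 1)) powr s)" by (rule member_le_sum) auto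
    also have "\<dots> \<le> 1" using S r(4) by simp
    finally have le: "norm (\<gamma> (axis i 1)) powr s \<le> 1" .
    show ?thesis
    proof (rule ccontr)
      assume "\<not> ?thesis"
      then have "1 powr s < norm (\<gamma> (axis i 1)) powr s" using index_pos by (intro powr_less_mono2) auto
      then show False using le by simp
    qed
  qed
  have \<gamma>n: "norm (\<gamma> y) \<le> real CARD('n) * norm y" for y
  proof -
    have "norm (\<gamma> y) \<le> (\<Sum>i\<in>UNIV. norm (y $ i * \<gamma> (axis i 1)))"
      by (subst linear_cart_expansion[OF lin]) (rule norm_sum)
    also have "\<dots> \<le> (\<Sum>i\<in>(UNIV::'n set). norm y * 1)"
      unfolding norm_mult by (intro sum_mono mult_mono \<gamma>e Finite_Cartesian_Product.norm_nth_le) auto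
    finally show ?thesis by simp
  qed
  have "(\<Sum>j<J. norm (\<gamma> (x j)) powr p) = (\<Sum>j<J. measure \<nu> (f -` {v j}) * norm (\<gamma> (v j)) powr p)"
    using p by (intro sum.cong) (simp_all add: x_def \<gamma>.scale norm_mult powr_mult powr_powr)
  then have "ennreal (\<Sum>j<J. norm (\<gamma> (x j)) powr p) = (\<Sum>j<J. ennreal (measure \<nu> (f -` {v j}) * norm (\<gamma> (v j)) powr p))"
    by simp
  also have "\<dots> = (\<integral>\<^sup>+z. ennreal (norm (\<gamma> (f z)) powr p) \<partial>\<nu>)"
    using nn_integral_simple_range[OF v, of "\<lambda>y. norm (\<gamma> y) powr p" \<nu>] meas N.finite_measure_axioms by simp
  also have "\<dots> \<le> (\<integral>\<^sup>+z. ennreal ((1 + d) powr p) * ennreal (norm (\<gamma> z) powr p)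
      + ennreal ((1 + 1 / d) powr p * real CARD('n) powr p) * ennreal (norm (f z - z) powr p) \<partial>\<nu>)"
  proof (intro nn_integral_mono)
    fix z
    have "norm (\<gamma> (f z)) powr p = norm (\<gamma> z + \<gamma> (f z - z)) powr p" by (simp add: \<gamma>.diff)
    also have "\<dots> \<le> (1 + d) powr p * norm (\<gamma> z) powr p + (1 + 1 / d) powr p * norm (\<gamma> (f z - z)) powr p"
      by (rule powr_norm_add_le[OF p d])
    also have "\<dots> \<le> (1 + d) powr p * norm (\<gamma> z) powr p + (1 + 1 / d) powr p * (real CARD('n) * norm (f z - z)) powr p"
      using p \<gamma>n by (intro add_left_mono mult_left_mono powr_mono2) auto
    finally have "norm (\<gamma> (f z)) powr p \<le> (1 + d) powr p * norm (\<gamma> z) powr p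
       + ((1 + 1 / d) powr p * real CARD('n) powr p) * norm (f z - z) powr p"
      by (simp add: powr_mult mult.assoc)
    then have "ennreal (norm (\<gamma> (f z)) powr p) \<le> ennreal ((1 + d) powr p * norm (\<gamma> z) powr p
       + ((1 + 1 / d) powr p * real CARD('n) powr p) * norm (f z - z) powr p)" by (rule ennreal_leI)
    then show "ennreal (norm (\<gamma> (f z)) powr p) \<le> ennreal ((1 + d) powr p) * ennreal (norm (\<gamma> z) powr p)
      + ennreal ((1 + 1 / d) powr p * real CARD('n) powr p) * ennreal (norm (f z - z) powr p)"
      by (simp add: ennreal_mult ennreal_plus)
  qed
  also have "\<dots> = ennreal ((1 + d) powr p) * (\<integral>\<^sup>+z. ennreal (norm (\<gamma> z) powr p) \<partial>\<nu>)
      + ennreal ((1 + 1 / d) powr p * real CARD('n) powr p) * (\<integral>\<^sup>+z. ennreal (norm (f z - z) powr p) \<partial>\<nu>)"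
    by (subst nn_integral_add) (simp_all add: nn_integral_cmult)
  also have "\<dots> \<le> ennreal ((1 + d) powr p) * ennreal M + ennreal ((1 + 1 / d) powr p * real CARD('n) powr p) * ennreal E"
  proof (intro add_mono mult_left_mono)
    have "(\<Sum>i\<in>UNIV. norm (\<gamma> (axis i 1)) powr s) powr (p / s) \<le> 1"
      using S r(4) p index_pos by (intro powr_le1) (auto simp: abs_of_nonneg sum_nonneg)
    then show "(\<integral>\<^sup>+z. ennreal (norm (\<gamma> z) powr p) \<partial>\<nu>) \<le> ennreal M"
      unfolding \<nu>_def functional_moment[OF lin p] mom(1) using mom(2)
      by (simp add: ennreal_mult[symmetric] mult_left_le_one_le ennreal_leI)
  qed (simp_all add: E)
  also have "\<dots> = ennreal ?Y" using mom E by (simp add: ennreal_mult[symmetric] ennreal_plus[symmetric] mult.assoc del: ennreal_plus)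
  finally have "(\<Sum>j<J. norm (\<gamma> (x j)) powr p) \<le> ?Y" using Y by (simp add: ennreal_le_iff)
  then show "(\<Sum>j<J. norm (\<gamma> (x j)) powr p) \<le> (?Y powr (1 / p)) powr p" using p Y by (simp add: powr_powr)
qed simp

text \<open>
  Simple functions \<open>F i\<close> converge to the identity with \<open>\<parallel>F i z\<parallel> \<le> 2 \<parallel>z\<parallel>\<close>. Products of \<open>p\<close>-th powers of norms
  are integrable and dominate, so the sampled integrals converge to \<open>I\<close> and the sampling errors to zero;
  then the auxiliary parameter \<open>d\<close> tends to zero.
\<close>

lemma admissible_constant_ge:
  fixes T :: "('m::finite \<Rightarrow> 'k ^ 'n) \<Rightarrow> 'x::real_normed_vector"
  assumes r: "1 \<le> r" "1 / r + 1 / r' = 1" "r' < \<infinity>" "enn2real r' = s" and p: "0 < p"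
    and mom: "(\<integral>\<^sup>+z. ennreal (norm z powr p) \<partial>\<mu>) = ennreal M" "0 < M"
    and sX: "scalar_normed_space sX" and T: "multilinear (*s) sX T" "continuous_on UNIV T"
    and I: "(\<integral>\<^sup>+z. ennreal (norm (T z) powr p) \<partial>PiM UNIV (\<lambda>_. product_measure \<mu>)) = ennreal I" "0 \<le> I"
    and C: "0 < C" and adm: "\<And>(J :: 'm \<Rightarrow> nat) (x :: 'm \<Rightarrow> nat \<Rightarrow> 'k ^ 'n).
      (\<Sum>j\<in>PiE UNIV (\<lambda>i. {..<J i}). norm (T (\<lambda>i. x i (j i))) powr p) powr (1 / p)
        \<le> C * (\<Prod>i\<in>UNIV. weak_norm (*s) (ell_norm r) p (J i) (x i))"
  shows "I \<le> C powr p * M ^ CARD('m)"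
proof -
  interpret X: scalar_normed_space sX by (rule sX)
  let ?N = "product_measure \<mu> :: ('k ^ 'n) measure"
  let ?Q = "PiM (UNIV :: 'm set) (\<lambda>_. ?N)"
  interpret N: prob_space ?N by (rule prob_space_product_measure)
  interpret Q: prob_space ?Q by (intro prob_space_PiM N.prob_space_axioms)
  have sp: "space ?N = UNIV" using sets_eq_imp_space_eq[OF sets_product_measure] by simp
  have fin: "(\<integral>\<^sup>+z. ennreal (norm z powr p) \<partial>\<mu>) < \<infinity>" using mom by simp
  have "(\<lambda>z. z) \<in> borel_measurable ?N" by simp
  from borel_measurable_implies_sequence_metric[OF this, of 0] obtain F where
    F: "\<And>i. simple_function ?N (F i)" "\<And>z. (\<lambda>i. F i z) \<longlonglongrightarrow> z" "\<And>i z. norm (F i z) \<le> 2 * norm z"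
    unfolding sp by (metis UNIV_I dist_0_norm dist_commute)
  have Fm [measurable]: "F i \<in> borel_measurable borel" for i
    using borel_measurable_simple_function[OF F(1)] by simp
  have Tm [measurable]: "(\<lambda>z. norm (T z)) \<in> borel_measurable ?Q"
    unfolding measurable_PiM_product_measure by (rule norm_continuous_measurable[OF T(2)])
  have TFm [measurable]: "(\<lambda>z. norm (T (\<lambda>k. F i (z k)))) \<in> borel_measurable ?Q" for i
  proof -
    have "(\<lambda>z k. F i (z k)) \<in> measurable ?Q (PiM UNIV (\<lambda>_. borel))"
      by (rule measurable_PiM_single') auto
    from measurable_compose[OF this norm_continuous_measurable[OF T(2)]] show ?thesis .
  qed
  define I' where "I' i = (\<integral>\<^sup>+z. ennreal (norm (T (\<lambda>k. F i (z k))) powr p) \<partial>?Q)" for i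
  define E where "E i = (\<integral>\<^sup>+z. ennreal (norm (F i z - z) powr p) \<partial>?N)" for i
  define D where "D = (\<Sum>i\<in>UNIV. norm (T (\<lambda>k. axis (i k) 1)))"
  have D: "0 \<le> D" by (simp add: D_def sum_nonneg)
  have I'lim: "I' \<longlonglongrightarrow> ennreal I"
    unfolding I'_def I(1)[symmetric]
  proof (rule nn_integral_dominated_convergence)
    show "AE z in ?Q. ennreal (norm (T (\<lambda>k. F i (z k))) powr p) \<le> ennreal ((D * 2 ^ CARD('m) * (\<Prod>k\<in>UNIV. norm (z k))) powr p)" for i
    proof (intro AE_I2 ennreal_leI powr_mono2)
      fix z :: "'m \<Rightarrow> 'k ^ 'n"
      have "norm (T (\<lambda>k. F i (z k))) \<le> D * (\<Prod>k\<in>UNIV. norm (F i (z k)))"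
        unfolding D_def by (rule X.multilinear_norm_bound[OF T(1)])
      also have "\<dots> \<le> D * (\<Prod>k\<in>UNIV. 2 * norm (z k))"
        using F(3) D by (intro mult_left_mono prod_mono) auto
      finally show "norm (T (\<lambda>k. F i (z k))) \<le> D * 2 ^ CARD('m) * (\<Prod>k\<in>UNIV. norm (z k))"
        by (simp add: prod.distrib)
    qed (use p in auto)
    show "(\<integral>\<^sup>+z. ennreal ((D * 2 ^ CARD('m) * (\<Prod>k\<in>UNIV. norm (z k))) powr p) \<partial>?Q) < \<infinity>"
      using D by (intro prod_norm_moment_finite p fin) auto
    show "AE z in ?Q. (\<lambda>i. ennreal (norm (T (\<lambda>k. F i (z k))) powr p)) \<longlonglongrightarrow> ennreal (norm (T z) powr p)"
    proof (rule AE_I2)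
      fix z
      have "(\<lambda>i. norm (T (\<lambda>k. F i (z k)))) \<longlonglongrightarrow> norm (T z)"
        by (intro tendsto_norm X.multilinear_tendsto[OF T(1)] F(2))
      then have "(\<lambda>i. norm (T (\<lambda>k. F i (z k))) powr p) \<longlonglongrightarrow> norm (T z) powr p"
        using p by (intro tendsto_powr') (auto simp: tendsto_const)
      then show "(\<lambda>i. ennreal (norm (T (\<lambda>k. F i (z k))) powr p)) \<longlonglongrightarrow> ennreal (norm (T z) powr p)"
        by (rule tendsto_ennrealI)
    qed
  qed measurable
  have Edom: "norm (F i z - z) powr p \<le> 3 powr p * norm z powr p" for i z
  proof -
    have "norm (F i z - z) \<le> norm (F i z) + norm z" by (rule norm_triangle_ineq4)
    also have "\<dots> \<le> 3 * norm z" using F(3)[of i z] by simp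
    finally have "norm (F i z - z) powr p \<le> (3 * norm z) powr p" using p by (intro powr_mono2) auto
    then show ?thesis by (simp add: powr_mult)
  qed
  have dom_fin: "(\<integral>\<^sup>+z. ennreal (3 powr p * norm z powr p) \<partial>?N) < \<infinity>"
    using product_measure_moment_finite[OF p fin, where 'n='n]
    by (simp add: ennreal_mult nn_integral_cmult ennreal_mult_less_top)
  have Elim: "E \<longlonglongrightarrow> 0"
  proof -
    have "E \<longlonglongrightarrow> (\<integral>\<^sup>+z. ennreal (norm (z - z) powr p) \<partial>?N)"
      unfolding E_def
    proof (rule nn_integral_dominated_convergence)
      show "AE z in ?N. ennreal (norm (F i z - z) powr p) \<le> ennreal (3 powr p * norm z powr p)" for i
        by (intro AE_I2 ennreal_leI Edom)
      show "AE z in ?N. (\<lambda>i. ennreal (norm (F i z - z) powr p)) \<longlonglongrightarrow> ennreal (norm (z - z) powr p)"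
      proof (rule AE_I2)
        fix z
        have "(\<lambda>i. norm (F i z - z)) \<longlonglongrightarrow> norm (z - z)" by (intro tendsto_intros F(2))
        then have "(\<lambda>i. norm (F i z - z) powr p) \<longlonglongrightarrow> norm (z - z) powr p"
          using p by (intro tendsto_powr') (auto simp: tendsto_const)
        then show "(\<lambda>i. ennreal (norm (F i z - z) powr p)) \<longlonglongrightarrow> ennreal (norm (z - z) powr p)"
          by (rule tendsto_ennrealI)
      qed
    qed (use dom_fin in \<open>simp_all add: measurable\<close>)
    then show ?thesis by simp
  qed
  have Efin: "E i < \<infinity>" for i
  proof -
    have "E i \<le> (\<integral>\<^sup>+z. ennreal (3 powr p * norm z powr p) \<partial>?N)"
      unfolding E_def by (intro nn_integral_mono ennreal_leI Edom)
    then show ?thesis using dom_fin by (rule le_less_trans)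
  qed
  define e where "e i = enn2real (E i)" for i
  have Ee: "E i = ennreal (e i)" "0 \<le> e i" for i using Efin[of i] by (simp_all add: e_def)
  have "(\<lambda>i. ennreal (e i)) \<longlonglongrightarrow> ennreal 0"
    using Elim by (simp add: Ee(1)[symmetric])
  then have elim: "e \<longlonglongrightarrow> 0"
    by (rule tendsto_ennrealD) (simp_all add: Ee(2))
  define Y where "Y d i = (1 + d) powr p * M + (1 + 1 / d) powr p * (real CARD('n) powr p * e i)" for d i
  have step: "I' i \<le> ennreal (C powr p * Y d i ^ CARD('m))" if d: "0 < d" for d i
  proof -
    have "finite (range (F i))" using simple_functionD(1)[OF F(1)] by (simp add: sp)
    then obtain v where v: "bij_betw v {..<card (range (F i))} (range (F i))"
      using ex_bij_betw_nat_finite atLeast0LessThan by metis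
    let ?J = "card (range (F i))"
    define A where "A j = measure ?N (F i -` {v j})" for j
    define x where "x j = of_real (A j powr (1 / p)) *s v j" for j
    have meas: "F i -` {v j} \<in> sets ?N" for j
      using measurable_sets[OF Fm, of "{v j}" i] by simp
    have Y0: "0 \<le> Y d i" using mom Ee by (simp add: Y_def)
    have w: "weak_norm (*s) (ell_norm r) p ?J x \<le> Y d i powr (1 / p)"
      unfolding x_def A_def Y_def
      by (rule weak_norm_sample_le[OF r p mom Fm v d]) (use Ee in \<open>simp_all add: E_def\<close>)
    have w0: "0 \<le> weak_norm (*s) (ell_norm r) p ?J x" by (rule weak_norm_nonneg[OF p])
    let ?JJ = "PiE (UNIV :: 'm set) (\<lambda>_. {..<?J})"
    have Tx: "norm (T (\<lambda>k. x (j k))) powr p = (\<Prod>k\<in>UNIV. A (j k)) * norm (T (\<lambda>k. v (j k))) powr p" for j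
    proof -
      have "norm (T (\<lambda>k. x (j k))) = (\<Prod>k\<in>UNIV. A (j k) powr (1 / p)) * norm (T (\<lambda>k. v (j k)))"
        unfolding x_def multilinear_scale[OF T(1) X.vector_space_axioms]
        by (simp add: X.norm_scale prod_norm[symmetric])
      moreover have "(\<Prod>k\<in>UNIV. A (j k) powr (1 / p)) powr p = (\<Prod>k\<in>UNIV. A (j k))"
        using p by (simp add: prod_powr_distrib[symmetric] powr_powr A_def prod_nonneg)
      ultimately show ?thesis by (simp add: powr_mult prod_nonneg)
    qed
    let ?S = "\<Sum>j\<in>?JJ. norm (T (\<lambda>k. x (j k))) powr p"
    have "I' i = (\<Sum>j\<in>?JJ. ennreal ((\<Prod>k\<in>UNIV. A (j k)) * norm (T (\<lambda>k. v (j k))) powr p))"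
      unfolding I'_def A_def
      using nn_integral_PiM_simple_range[OF v, of "\<lambda>y. norm (T y) powr p" ?N] meas N.prob_space_axioms by simp
    also have "\<dots> = ennreal ?S" by (simp add: Tx[symmetric])
    finally have IS: "I' i = ennreal ?S" .
    have S0: "0 \<le> ?S" by (simp add: sum_nonneg)
    have "?S powr (1 / p) \<le> C * (\<Prod>k\<in>(UNIV::'m set). weak_norm (*s) (ell_norm r) p ?J x)"
      using adm[of "\<lambda>_. x" "\<lambda>_. ?J"] by simp
    also have "\<dots> \<le> C * (\<Prod>k\<in>(UNIV::'m set). Y d i powr (1 / p))"
      using C w w0 by (intro mult_left_mono prod_mono) auto
    finally have "?S powr (1 / p) \<le> C * (Y d i powr (1 / p)) ^ CARD('m)" by simp
    then have "(?S powr (1 / p)) powr p \<le> (C * (Y d i powr (1 / p)) ^ CARD('m)) powr p"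
      using p by (intro powr_mono2) auto
    also have "\<dots> = C powr p * ((Y d i powr (1 / p)) powr p) ^ CARD('m)"
      using C by (simp add: powr_mult powr_power prod_powr_distrib[of "\<lambda>_::'m. Y d i powr (1 / p)" UNIV p, simplified])
    also have "\<dots> = C powr p * Y d i ^ CARD('m)" using p Y0 by (simp add: powr_powr)
    finally have "?S \<le> C powr p * Y d i ^ CARD('m)" using p S0 by (simp add: powr_powr)
    then show ?thesis unfolding IS by (rule ennreal_leI)
  qed
  have stepd: "I \<le> C powr p * ((1 + d) powr p * M) ^ CARD('m)" if d: "0 < d" for d
  proof -
    have "(\<lambda>i. Y d i) \<longlonglongrightarrow> (1 + d) powr p * M + (1 + 1 / d) powr p * (real CARD('n) powr p * 0)"
      unfolding Y_def by (intro tendsto_intros elim)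
    then have "(\<lambda>i. ennreal (C powr p * Y d i ^ CARD('m))) \<longlonglongrightarrow> ennreal (C powr p * ((1 + d) powr p * M) ^ CARD('m))"
      by (intro tendsto_ennrealI tendsto_mult tendsto_power tendsto_const) simp
    then have "ennreal I \<le> ennreal (C powr p * ((1 + d) powr p * M) ^ CARD('m))"
      by (rule LIMSEQ_le[OF I'lim]) (use step[OF d] in blast)
    then show ?thesis using C mom by (subst (asm) ennreal_le_iff) auto
  qed
  have "((\<lambda>d. C powr p * ((1 + d) powr p * M) ^ CARD('m)) \<longlongrightarrow> C powr p * ((1 + 0) powr p * M) ^ CARD('m)) (at_right 0)"
    by (intro tendsto_intros) auto
  then have "((\<lambda>d. C powr p * ((1 + d) powr p * M) ^ CARD('m)) \<longlongrightarrow> C powr p * M ^ CARD('m)) (at_right 0)" by simp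
  then show ?thesis
    by (rule tendsto_lowerbound) (auto intro!: stepd eventually_at_rightI[of 0 1])
qed

end

section \<open>The integral formula\<close>

theorem theorem1p2:
  fixes r r' :: ennreal and q p :: real
    and scaleX :: "'k::real_or_complex \<Rightarrow> 'x::real_normed_vector \<Rightarrow> 'x"
    and T :: "('m::finite \<Rightarrow> 'k ^ 'n) \<Rightarrow> 'x"
    and \<mu> :: "'k measure"
  assumes "1 \<le> r" and "1 / r + 1 / r' = 1"
    and "1 \<le> q" and "0 < p"
    and "Lg_space q 1 scaleX"
    and "multilinear (*s) scaleX T" and "continuous_on UNIV T"
    and "is_stable_measure (enn2real r') \<mu>"
    and "(r = 2 \<and> q = 2)
       \<or> (r = 2 \<and> (p < q \<and> q < 2 \<or> p = q))
       \<or> (ennreal p < r' \<and> r' < 2 \<and> (p < q \<and> q \<le> 2 \<or> p = q))"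
  shows "multiple_summing_norm (*s) (ell_norm r) p T =
     ennreal (1 / stable_const \<mu> p ^ CARD('m) *
       (LINT z|PiM (UNIV :: 'm set) (\<lambda>_. product_measure \<mu>). norm (T z) powr p) powr (1 / p))"
proof -
  define s where "s = enn2real r'"
  obtain \<kappa> where "isotropic_stable \<mu> s \<kappa>"
    using is_stable_measure_isotropic_stable assms(8) unfolding s_def by blast
  then interpret isotropic_stable \<mu> s \<kappa> .
  have r'fin: "r' < \<infinity>" using index_pos by (cases r') (auto simp: s_def)
  have r'2: "r' = 2" if "r = 2"
    using conjugate_cases[OF assms(1,2) r'fin]
  proof cases
    case 1
    then show ?thesis using that by simp
  next
    case (2 a b)
    then have "a = 2" using that by (metis ennreal_inj ennreal_numeral less_eq_real_def order_trans zero_le_numeral zero_less_one)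
    then have "b = 2" using 2 by (simp add: field_simps)
    then show ?thesis using 2 by simp
  qed
  have q: "q = 2 \<or> p = q \<or> p < q \<and> q < 2" using assms(9) by auto
  have fin: "(\<integral>\<^sup>+z. ennreal (norm z powr p) \<partial>\<mu>) < \<infinity>"
  proof (cases "r = 2")
    case True
    then have "s = 2" using r'2 by (simp add: s_def)
    then have "\<mu> = standard_gaussian" using assms(8) by (simp add: is_stable_measure_def s_def)
    then show ?thesis using gaussian_moment_finite[OF assms(4)] by simp
  next
    case False
    then have "ennreal p < r'" using assms(9) by blast
    then have "p < s" using r'fin assms(4) unfolding s_def
      by (cases r') (auto simp: ennreal_less_iff)
    then show ?thesis using moment_finite assms(4) by blast
  qed
  define M where "M = enn2real (\<integral>\<^sup>+z. ennreal (norm z powr p) \<partial>\<mu>)"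
  have mom: "(\<integral>\<^sup>+z. ennreal (norm z powr p) \<partial>\<mu>) = ennreal M" "0 < M"
    using fin moment_pos[of p] by (auto simp: M_def enn2real_positive_iff)
  have const: "stable_const \<mu> p = M powr (1 / p)"
    unfolding stable_const_def M_def by (subst integral_eq_nn_integral) auto
  have constp: "stable_const \<mu> p powr p = M" using mom assms(4) by (simp add: const powr_powr)
  have const0: "0 < stable_const \<mu> p" using mom by (simp add: const)
  interpret X: scalar_normed_space scaleX using assms(5) by (simp add: Lg_space_def)
  let ?Q = "PiM (UNIV :: 'm set) (\<lambda>_. product_measure \<mu> :: ('k ^ 'n) measure)"
  have Tm [measurable]: "(\<lambda>z. norm (T z)) \<in> borel_measurable ?Q"
    unfolding measurable_PiM_product_measure by (rule norm_continuous_measurable[OF assms(7)])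
  define I where "I = (LINT z|?Q. norm (T z) powr p)"
  have "(\<integral>\<^sup>+z. ennreal (norm (T z) powr p) \<partial>?Q) < \<infinity>"
  proof -
    let ?D = "\<Sum>i\<in>UNIV. norm (T (\<lambda>k. axis (i k) 1))"
    have "(\<integral>\<^sup>+z. ennreal (norm (T z) powr p) \<partial>?Q) \<le> (\<integral>\<^sup>+z. ennreal ((?D * (\<Prod>k\<in>UNIV. norm (z k))) powr p) \<partial>?Q)"
      using assms(4) by (intro nn_integral_mono ennreal_leI powr_mono2 X.multilinear_norm_bound assms(6)) auto
    also have "\<dots> < \<infinity>" by (intro prod_norm_moment_finite assms(4) fin sum_nonneg) simp
    finally show ?thesis .
  qed
  then have I: "(\<integral>\<^sup>+z. ennreal (norm (T z) powr p) \<partial>?Q) = ennreal I" "0 \<le> I"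
    unfolding I_def by (subst integral_eq_nn_integral; simp)+
  define A where "A = 1 / stable_const \<mu> p ^ CARD('m) * I powr (1 / p)"
  have A0: "0 \<le> A" using const0 by (simp add: A_def)
  have adm_upper: "(\<Sum>j\<in>PiE UNIV (\<lambda>k. {..<J k}). norm (T (\<lambda>k. x k (j k))) powr p) powr (1 / p)
      \<le> A * (\<Prod>k\<in>UNIV. weak_norm (*s) (ell_norm r) p (J k) (x k))"
    for J :: "'m \<Rightarrow> nat" and x :: "'m \<Rightarrow> nat \<Rightarrow> 'k ^ 'n"
  proof -
    let ?w = "\<lambda>k. weak_norm (*s) (ell_norm r) p (J k) (x k)"
    have w0: "0 \<le> ?w k" for k by (rule weak_norm_nonneg[OF assms(4)])
    have "(\<Sum>j\<in>PiE UNIV (\<lambda>k. {..<J k}). norm (T (\<lambda>k. x k (j k))) powr p) \<le> (\<Prod>k\<in>UNIV. ?w k powr p / M) * I"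
      by (rule multiple_sum_le[OF assms(1,2) r'fin s_def[symmetric] assms(4,3) q mom assms(5-7) I])
    then have "(\<Sum>j\<in>PiE UNIV (\<lambda>k. {..<J k}). norm (T (\<lambda>k. x k (j k))) powr p) powr (1 / p)
      \<le> ((\<Prod>k\<in>UNIV. ?w k powr p / M) * I) powr (1 / p)"
      using assms(4) by (intro powr_mono2) (auto intro: sum_nonneg)
    also have "\<dots> = (\<Prod>k\<in>UNIV. (?w k powr p / M) powr (1 / p)) * I powr (1 / p)"
      using mom I by (simp add: powr_mult prod_nonneg prod_powr_distrib)
    also have "(\<Prod>k\<in>UNIV. (?w k powr p / M) powr (1 / p)) = (\<Prod>k\<in>UNIV. ?w k / stable_const \<mu> p)"
      using mom w0 assms(4) by (intro prod.cong) (auto simp: powr_divide powr_powr const)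
    also have "\<dots> * I powr (1 / p) = A * (\<Prod>k\<in>UNIV. ?w k)"
      by (simp add: A_def prod_dividef)
    finally show ?thesis .
  qed
  let ?C = "{C. C > 0 \<and> (\<forall>(J :: 'm \<Rightarrow> nat) (x :: 'm \<Rightarrow> nat \<Rightarrow> 'k ^ 'n).
          (\<Sum>j\<in>PiE UNIV (\<lambda>k. {..<J k}). norm (T (\<lambda>k. x k (j k))) powr p) powr (1 / p)
            \<le> C * (\<Prod>k\<in>UNIV. weak_norm (*s) (ell_norm r) p (J k) (x k)))}"
  have "Inf (ennreal ` ?C) \<le> ennreal A"
  proof (rule ennreal_le_epsilon)
    fix e :: real assume e: "0 < e"
    have "A + e \<in> ?C"
    proof (intro CollectI conjI allI)
      show "0 < A + e" using A0 e by simp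
      fix J :: "'m \<Rightarrow> nat" and x :: "'m \<Rightarrow> nat \<Rightarrow> 'k ^ 'n"
      have "0 \<le> (\<Prod>k\<in>UNIV. weak_norm (*s) (ell_norm r) p (J k) (x k))"
        by (intro prod_nonneg ballI weak_norm_nonneg assms(4))
      then have "A * (\<Prod>k\<in>UNIV. weak_norm (*s) (ell_norm r) p (J k) (x k))
        \<le> (A + e) * (\<Prod>k\<in>UNIV. weak_norm (*s) (ell_norm r) p (J k) (x k))"
        using e by (intro mult_right_mono) auto
      with adm_upper show "(\<Sum>j\<in>PiE UNIV (\<lambda>k. {..<J k}). norm (T (\<lambda>k. x k (j k))) powr p) powr (1 / p)
            \<le> (A + e) * (\<Prod>k\<in>UNIV. weak_norm (*s) (ell_norm r) p (J k) (x k))" by (rule order_trans)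
    qed
    then have "Inf (ennreal ` ?C) \<le> ennreal (A + e)" by (intro Inf_lower imageI)
    then show "Inf (ennreal ` ?C) \<le> ennreal A + ennreal e" using A0 e by simp
  qed
  moreover have "ennreal A \<le> Inf (ennreal ` ?C)"
  proof (rule Inf_greatest)
    fix y assume "y \<in> ennreal ` ?C"
    then obtain C where y: "y = ennreal C" and C: "C \<in> ?C" by blast
    have C0: "0 < C" using C by simp
    have "I \<le> C powr p * M ^ CARD('m)"
      by (rule admissible_constant_ge[OF assms(1,2) r'fin s_def[symmetric] assms(4) mom X.scalar_normed_space_axioms assms(6,7) I C0])
        (use C in simp)
    then have "I powr (1 / p) \<le> (C powr p * M ^ CARD('m)) powr (1 / p)"
      using I assms(4) by (intro powr_mono2) auto
    also have "\<dots> = C * (M powr (1 / p)) ^ CARD('m)"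
      using C0 mom assms(4) prod_powr_distrib[of "\<lambda>_::'m. M" UNIV "1 / p"] by (simp add: powr_mult powr_powr)
    finally have "A \<le> C" using const0 by (simp add: A_def const[symmetric] divide_le_eq)
    then show "ennreal A \<le> y" unfolding y by (rule ennreal_leI)
  qed
  ultimately show ?thesis
    unfolding multiple_summing_norm_def A_def I_def by (rule antisym)
qed

end
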